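(* Let $\mathcal S$ be the even part of the special Lie superalgebra $S(m,n;\underline t)$ over a field of characteristic $p>3$, with $m,n\ge3$. Then $$\mathrm{Der}(\mathcal S)=\mathrm{ad}(\overline{\mathcal S}+\mathcal T)\oplus\mathrm{span}_{\mathbb F}\{(\mathrm{ad}\,D_i)^{p^{r_i}}\mid i\in Y_0,\ 1\le r_i<t_i\},$$ where for $E\in\overline{\mathcal S}+\mathcal T$, $\mathrm{ad}\,E$ denotes the derivation $X\mapsto[E,X]$ of $\mathcal S$, and $(\mathrm{ad}\,D_i)^{p^{r_i}}$ is restricted to $\mathcal S$.
   Context: $\mathbb F$ is a field of characteristic $p>3$; $m,n\ge 3$; $\underline t=(t_1,\dots,t_m)$ positive integers, $\pi_i=p^{t_i}-1$. $Y_0=\{1,\dots,m\}$, $Y_1=\{m+1,\dots,m+n\}$, $Y=Y_0\cup Y_1$, $\tau(r)=\bar0$ on $Y_0$, $\bar1$ on $Y_1$. $\mathfrak A=\mathfrak A(m,n;\underline t)$ is the supercommutative superalgebra with basis $x^{(\alpha)}x^u$ ($\alpha\in\mathbb N_0^m$, $\alpha_i\le\pi_i$; $u$ an increasing sequence in $Y_1$, $x^u$ the product of the odd generators $x_k$, $k\in u$), with divided-power multiplication $x^{(\alpha)}x^{(\beta)}=\prod_i\binom{\alpha_i+\beta_i}{\alpha_i}x^{(\alpha+\beta)}$ (zero if some index exceeds $\pi_i$), anticommuting $x_k$, parity $|u|\bmod2$; $x_i=x^{(\varepsilon_i)}$ for $i\in Y_0$. $D_i$ ($i\in Y_0$) sends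 $x^{(\alpha)}x^u\mapsto x^{(\alpha-\varepsilon_i)}x^u$; $D_k$ ($k\in Y_1$) is the odd partial derivative $\partial/\partial x_k$; $D_r$ has parity $\tau(r)$. $W=W(m,n;\underline t)=\{\sum f_rD_r:f_r\in\mathfrak A\}$ with bracket $[fD_r,gD_s]=fD_r(g)D_s-(-1)^{\mathrm p(fD_r)\mathrm p(gD_s)}gD_s(f)D_r$. $D_{rs}(f)=(-1)^{\tau(r)\tau(s)}D_r(f)D_s-(-1)^{(\tau(r)+\tau(s))\mathrm p(f)}D_s(f)D_r$ and $S=\mathrm{span}\{D_{rs}(f): r,s\in Y, f\in\mathfrak A\}$. The divergence is $\mathrm{div}(\sum_r f_rD_r)=\sum_r(-1)^{\tau(r)\mathrm p(f_r)}D_r(f_r)$ and $\overline S=\{D\in W:\mathrm{div}(D)=0\}$. $\mathcal W,\mathcal S,\overline{\mathcal S}$ denote the even parts of $W,S,\overline S$. $\Gamma_r=x_rD_r$ and $\mathcal T=\mathrm{span}_{\mathbb F}\{\Gamma_r:r\in Y\}\subset\mathcal W$. (Elements of $\overline{\mathcal S}+\mathcal T$ normalize $\mathcal S$ inside $\mathcal W$.) *)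

theory Defs
  imports Main "HOL.Modules" "HOL-Library.Function_Algebras"
begin

definition Y0 :: "nat \<Rightarrow> nat set" where "Y0 m = {1..m}"
definition Y1 :: "nat \<Rightarrow> nat \<Rightarrow> nat set" where "Y1 m n = {m+1..m+n}"
definition Y :: "nat \<Rightarrow> nat \<Rightarrow> nat set" where "Y m n = Y0 m \<union> Y1 m n"

text \<open>tau r = 0 on Y0 and 1 on Y1 (only used for r in Y).\<close>
definition tau :: "nat \<Rightarrow> nat \<Rightarrow> nat" where "tau m r = (if r \<in> Y0 m then 0 else 1)"

text \<open>Basis monomials x^(alpha) x^u: alpha supported on Y0 with alpha_i \<le> p^(t_i) - 1,
  u a subset of Y1 (identified with the increasing sequence of its elements).\<close>
type_synonym mon = "(nat \<Rightarrow> nat) \<times> nat set"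
type_synonym 'a alg = "mon \<Rightarrow> 'a"
type_synonym 'a wvec = "nat \<Rightarrow> 'a alg"

definition Mon :: "nat \<Rightarrow> nat \<Rightarrow> nat \<Rightarrow> (nat \<Rightarrow> nat) \<Rightarrow> mon set" where
  "Mon p m n t = {(\<alpha>, u). (\<forall>i. i \<notin> Y0 m \<longrightarrow> \<alpha> i = 0) \<and> (\<forall>i\<in>Y0 m. \<alpha> i \<le> p ^ t i - 1) \<and> u \<subseteq> Y1 m n}"

text \<open>Elements of the divided power superalgebra: coefficient functions supported on Mon.\<close>
definition algA :: "nat \<Rightarrow> nat \<Rightarrow> nat \<Rightarrow> (nat \<Rightarrow> nat) \<Rightarrow> ('a::field) alg set" where
  "algA p m n t = {f. \<forall>X. X \<notin> Mon p m n t \<longrightarrow> f X = 0}"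

definition par :: "mon \<Rightarrow> nat" where "par X = card (snd X) mod 2"

definition part :: "nat \<Rightarrow> ('a::field) alg \<Rightarrow> 'a alg" where
  "part b f = (\<lambda>X. if par X = b then f X else 0)"

definition homog :: "nat \<Rightarrow> ('a::field) alg \<Rightarrow> bool" where
  "homog b f \<longleftrightarrow> f = part b f"

text \<open>Structure constant: x^(a)x^u * x^(b)x^v = prod binom * sign * x^(a+b) x^(u \<union> v).\<close>
definition mcoef :: "nat \<Rightarrow> mon \<Rightarrow> mon \<Rightarrow> 'a::field" where
  "mcoef m a b = of_nat (\<Prod>i\<in>Y0 m. (fst a i + fst b i) choose (fst a i)) *
      (-1) ^ card {(k, l). k \<in> snd a \<and> l \<in> snd b \<and> l < k}"

definition amul :: "nat \<Rightarrow> nat \<Rightarrow> nat \<Rightarrow> (nat \<Rightarrow> nat) \<Rightarrow> ('a::field) alg \<Rightarrow> 'a alg \<Rightarrow> 'a alg" where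
  "amul p m n t f g = (\<lambda>X. if X \<in> Mon p m n t then
     (\<Sum>(a, b)\<in>Mon p m n t \<times> Mon p m n t.
        if (\<lambda>i. fst a i + fst b i) = fst X \<and> snd a \<inter> snd b = {} \<and> snd a \<union> snd b = snd X
        then mcoef m a b * f a * g b else 0)
     else 0)"

text \<open>Partial derivatives D_r: for r in Y0, x^(alpha)x^u \<mapsto> x^(alpha - eps_r)x^u;
  for r in Y1 the odd derivative d/dx_r.\<close>
definition Dop :: "nat \<Rightarrow> nat \<Rightarrow> nat \<Rightarrow> (nat \<Rightarrow> nat) \<Rightarrow> nat \<Rightarrow> ('a::field) alg \<Rightarrow> 'a alg" where
  "Dop p m n t r f = (\<lambda>X. if X \<in> Mon p m n t then
     (if r \<in> Y0 m then f ((fst X)(r := fst X r + 1), snd X)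
      else if r \<in> Y1 m n \<and> r \<notin> snd X then
        (-1) ^ card {l \<in> snd X. l < r} * f (fst X, insert r (snd X))
      else 0)
     else 0)"

text \<open>W: vector fields sum_r f_r D_r, f_r in A, represented by r \<mapsto> f_r (zero outside Y).\<close>
definition Wset :: "nat \<Rightarrow> nat \<Rightarrow> nat \<Rightarrow> (nat \<Rightarrow> nat) \<Rightarrow> ('a::field) wvec set" where
  "Wset p m n t = {E. (\<forall>r. E r \<in> algA p m n t) \<and> (\<forall>r. r \<notin> Y m n \<longrightarrow> E r = 0)}"

definition scaleW :: "'a::field \<Rightarrow> 'a wvec \<Rightarrow> 'a wvec" where
  "scaleW c E = (\<lambda>r X. c * E r X)"

text \<open>Super bracket on W, bilinear extension of
  [f D_r, g D_s] = f D_r(g) D_s - (-1)^(p(fD_r) p(gD_s)) g D_s(f) D_r on homogeneous parts.\<close>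
definition Wbr :: "nat \<Rightarrow> nat \<Rightarrow> nat \<Rightarrow> (nat \<Rightarrow> nat) \<Rightarrow> ('a::field) wvec \<Rightarrow> 'a wvec \<Rightarrow> 'a wvec" where
  "Wbr p m n t E F = (\<lambda>s. if s \<in> Y m n then
     (\<lambda>X. (\<Sum>r\<in>Y m n. \<Sum>a<2. \<Sum>b<2.
              amul p m n t (part a (E r)) (Dop p m n t r (part b (F s))) X)
         - (\<Sum>q\<in>Y m n. \<Sum>a<2. \<Sum>b<2.
              (-1) ^ (((a + tau m s) mod 2) * ((b + tau m q) mod 2)) *
              amul p m n t (part b (F q)) (Dop p m n t q (part a (E s))) X))
     else 0)"

definition Weven :: "nat \<Rightarrow> nat \<Rightarrow> nat \<Rightarrow> (nat \<Rightarrow> nat) \<Rightarrow> ('a::field) wvec set" where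
  "Weven p m n t = {E \<in> Wset p m n t. \<forall>r. homog (tau m r) (E r)}"

text \<open>D_rs(f) for f homogeneous of parity b.\<close>
definition Drs :: "nat \<Rightarrow> nat \<Rightarrow> nat \<Rightarrow> (nat \<Rightarrow> nat) \<Rightarrow> nat \<Rightarrow> nat \<Rightarrow> nat \<Rightarrow> ('a::field) alg \<Rightarrow> 'a wvec" where
  "Drs p m n t r s b f = (\<lambda>q X.
      (if q = s then (-1) ^ (tau m r * tau m s) * Dop p m n t r f X else 0)
    - (if q = r then (-1) ^ ((tau m r + tau m s) * b) * Dop p m n t s f X else 0))"

definition Sset :: "nat \<Rightarrow> nat \<Rightarrow> nat \<Rightarrow> (nat \<Rightarrow> nat) \<Rightarrow> ('a::field) wvec set" where
  "Sset p m n t = module.span scaleW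
     {Drs p m n t r s b f | r s b f. r \<in> Y m n \<and> s \<in> Y m n \<and> b < 2 \<and>
        f \<in> algA p m n t \<and> homog b f}"

text \<open>Divergence, extended linearly from homogeneous coefficients.\<close>
definition divW :: "nat \<Rightarrow> nat \<Rightarrow> nat \<Rightarrow> (nat \<Rightarrow> nat) \<Rightarrow> ('a::field) wvec \<Rightarrow> 'a alg" where
  "divW p m n t E = (\<lambda>X. \<Sum>r\<in>Y m n. \<Sum>b<2. (-1) ^ (tau m r * b) * Dop p m n t r (part b (E r)) X)"

definition calS :: "nat \<Rightarrow> nat \<Rightarrow> nat \<Rightarrow> (nat \<Rightarrow> nat) \<Rightarrow> ('a::field) wvec set" where
  "calS p m n t = Sset p m n t \<inter> Weven p m n t"

definition calSbar :: "nat \<Rightarrow> nat \<Rightarrow> nat \<Rightarrow> (nat \<Rightarrow> nat) \<Rightarrow> ('a::field) wvec set" where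
  "calSbar p m n t = {E \<in> Weven p m n t. divW p m n t E = 0}"

definition monvec :: "mon \<Rightarrow> ('a::field) alg" where
  "monvec Z = (\<lambda>X. if X = Z then 1 else 0)"

definition xgen :: "nat \<Rightarrow> nat \<Rightarrow> ('a::field) alg" where
  "xgen m r = (if r \<in> Y0 m then monvec ((\<lambda>i. 0)(r := 1), {}) else monvec (\<lambda>i. 0, {r}))"

definition Gam :: "nat \<Rightarrow> nat \<Rightarrow> ('a::field) wvec" where
  "Gam m r = (\<lambda>q. if q = r then xgen m r else 0)"

definition calT :: "nat \<Rightarrow> nat \<Rightarrow> ('a::field) wvec set" where
  "calT m n = module.span scaleW {Gam m r | r. r \<in> Y m n}"

definition Dvec :: "nat \<Rightarrow> ('a::field) wvec" where
  "Dvec i = (\<lambda>q. if q = i then monvec (\<lambda>j. 0, {}) else 0)"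

text \<open>Maps on calS are represented as functions on W vanishing outside calS.\<close>
definition scaleD :: "'a::field \<Rightarrow> ('a wvec \<Rightarrow> 'a wvec) \<Rightarrow> ('a wvec \<Rightarrow> 'a wvec)" where
  "scaleD c \<phi> = (\<lambda>X. scaleW c (\<phi> X))"

definition Der :: "nat \<Rightarrow> nat \<Rightarrow> nat \<Rightarrow> (nat \<Rightarrow> nat) \<Rightarrow> (('a::field) wvec \<Rightarrow> 'a wvec) set" where
  "Der p m n t = {\<phi>. (\<forall>X. X \<notin> calS p m n t \<longrightarrow> \<phi> X = 0) \<and>
      (\<forall>X\<in>calS p m n t. \<phi> X \<in> calS p m n t) \<and>
      (\<forall>X\<in>calS p m n t. \<forall>Z\<in>calS p m n t. \<phi> (X + Z) = \<phi> X + \<phi> Z) \<and>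
      (\<forall>c. \<forall>X\<in>calS p m n t. \<phi> (scaleW c X) = scaleW c (\<phi> X)) \<and>
      (\<forall>X\<in>calS p m n t. \<forall>Z\<in>calS p m n t.
         \<phi> (Wbr p m n t X Z) = Wbr p m n t (\<phi> X) Z + Wbr p m n t X (\<phi> Z))}"

definition adS :: "nat \<Rightarrow> nat \<Rightarrow> nat \<Rightarrow> (nat \<Rightarrow> nat) \<Rightarrow> ('a::field) wvec \<Rightarrow> ('a wvec \<Rightarrow> 'a wvec)" where
  "adS p m n t E = (\<lambda>X. if X \<in> calS p m n t then Wbr p m n t E X else 0)"

definition adDpow :: "nat \<Rightarrow> nat \<Rightarrow> nat \<Rightarrow> (nat \<Rightarrow> nat) \<Rightarrow> nat \<Rightarrow> nat \<Rightarrow> ('a::field) wvec \<Rightarrow> 'a wvec" where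
  "adDpow p m n t i k = (\<lambda>X. if X \<in> calS p m n t then (Wbr p m n t (Dvec i) ^^ (p ^ k)) X else 0)"

end

theory Submission
  imports Defs "HOL-Computational_Algebra.Primes"
begin

text \<open>
  Write \<open>\<xi>\<^sub>k\<close> for the odd variables and \<open>h\<^sub>i\<^sub>k = \<Gamma>\<^sub>i + \<Gamma>\<^sub>k\<close> with \<open>i \<in> Y\<^sub>0\<close>, \<open>k \<in> Y\<^sub>1\<close>. The Lie algebra \<open>\<S>\<close> is generated by the
  \<open>D\<^sub>i\<close>, the divided powers \<open>x\<^sub>i\<close>-to-the-\<open>p^r\<close> times \<open>D\<^sub>j\<close>, the \<open>\<xi>\<^sub>k D\<^sub>l\<close>, the \<open>\<xi>\<^sub>k \<xi>\<^sub>l D\<^sub>i\<close> (distinct indices) and the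
  \<open>D\<^sub>i\<^sub>k\<close>-images of (second divided power of \<open>x\<^sub>i\<close>) times \<open>\<xi>\<^sub>k\<close>. So a derivation from \<open>\<S>\<close> into the even vector fields \<open>\<W>\<close> is
  determined by its values on these, and the point is to make them vanish one after the other.

  Since \<open>ad D\<^sub>i\<close> is nilpotent of order \<open>p^t\<^sub>i\<close>, Jacobson's identity
  \<open>\<psi> \<circ> (ad x)^N = (ad x)^N \<circ> \<psi> + \<Sum>\<^sub>j (N choose j + 1) ad ((ad x)^j (\<psi> x)) (ad x)^(N - j - 1)\<close> shows that the values on the \<open>D\<^sub>i\<close>
  satisfy the integrability conditions of the truncated divided powers, so subtracting an inner derivation kills them.
  The same identity and \<open>(ad h\<^sub>i\<^sub>k)^p = ad h\<^sub>i\<^sub>k\<close> allow the same for the torus. What remains maps each generator, by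
  increasing degree, to a field with constant coefficients of the same weight; as \<open>m, n \<ge> 3\<close> and \<open>p > 3\<close>, this is a multiple of
  the generator, or of \<open>D\<^sub>j\<close> when the generator involves the \<open>p^r\<close>-th power of \<open>x\<^sub>i\<close> with \<open>r \<ge> 1\<close>. The former is accounted for by
  \<open>ad \<T>\<close> and the latter by \<open>(ad D\<^sub>i)^(p^r)\<close>. Finally, if \<open>z \<in> \<W>\<close> normalizes \<open>\<S>\<close>, then \<open>div z\<close> is annihilated by the \<open>D\<^sub>i\<close> and the \<open>h\<^sub>i\<^sub>k\<close>,
  hence is a constant, and \<open>z\<close> differs from a divergence-free field by an element of \<open>\<T>\<close>.
\<close>

text \<open>Only 0 in \<open>\<W>\<close> commutes with \<open>\<S>\<close>. So whenever an identity
  for a derivation leaves an inner term ad w that is 0 on \<open>\<S>\<close>, the field w itself is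
  0. This turns nilpotence of ad D_i into integrability, and (ad h)^p = ad h into solvability of
  [h, z] = y. The fields z found in this way need not normalize \<open>\<S>\<close> individually,
  which is why values in all of \<open>\<W>\<close> are allowed; that their sum normalizes
  \<open>\<S>\<close> is seen only at the end.

  Weights take values in the prime field, so the torus cannot tell x_i^(p^r) D_j from D_j when r >=
  1. This coincidence is the source of the outer derivations.

  Divided powers cause two obstacles. All C(p^r, a) with 0 < a < p^r vanish, so the exponents p^r
  have to be listed among the generators, and a derivation is treated one r at a time: step r needs
  it to vanish already on x_i^(p^r - 1) D_j. At the maximal exponent p^t_i - 1 there is nothing
  above to differentiate; such monomials are reached from below by raising with the D_ik-image of
  x_i^(2) \<xi>_k, where p^t_i = 0 in the field makes the coefficients small integers and only a
  division by 2 remains.\<close>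

lemmas papply = plus_fun_apply zero_fun_apply minus_apply uminus_apply

declare papply [simp del] split_paired_All [simp del] split_paired_Ex [simp del]

section \<open>Signs of products of odd variables\<close>

text \<open>The exponent of the sign in x^u x^v = +- x^(u \<union> v) for disjoint u and v: each
  pair in the wrong order costs one transposition of odd generators.\<close>

definition inversions :: "nat set \<Rightarrow> nat set \<Rightarrow> nat" where
  "inversions u v = card {(k, l). k \<in> u \<and> l \<in> v \<and> l < k}"

lemma inversions_eq_sum:
  assumes "finite u" "finite v"
  shows "inversions u v = (\<Sum>k\<in>u. \<Sum>l\<in>v. if l < k then 1 else 0)"
proof -
  have "{(k, l). k \<in> u \<and> l \<in> v \<and> l < k} = Sigma u (\<lambda>k. {l \<in> v. l < k})" by auto
  moreover have "card (Sigma u (\<lambda>k. {l \<in> v. l < k})) = (\<Sum>k\<in>u. card {l \<in> v. l < k})"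
    using assms by (subst card_SigmaI) auto
  moreover have "card {l \<in> v. l < k} = (\<Sum>l\<in>v. if l < k then 1 else 0)" for k
    using assms by (simp add: sum.If_cases Int_def)
  ultimately show ?thesis unfolding inversions_def by simp
qed

lemma inversions_Un1:
  assumes "finite u" "finite v" "finite w" "u \<inter> v = {}"
  shows "inversions (u \<union> v) w = inversions u w + inversions v w"
  using assms by (simp add: inversions_eq_sum sum.union_disjoint)

lemma inversions_Un2:
  assumes "finite u" "finite v" "finite w" "v \<inter> w = {}"
  shows "inversions u (v \<union> w) = inversions u v + inversions u w"
  using assms by (simp add: inversions_eq_sum sum.union_disjoint sum.distrib)

lemma card_less_eq_sum: "finite v \<Longrightarrow> card {l \<in> v. l < (k::nat)} = (\<Sum>l\<in>v. if l < k then 1 else 0)"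
  by (simp add: sum.If_cases Int_def)

lemma card_greater_eq_sum: "finite v \<Longrightarrow> card {l \<in> v. (k::nat) < l} = (\<Sum>l\<in>v. if k < l then 1 else 0)"
  by (simp add: sum.If_cases Int_def)

lemma inversions_insert1:
  assumes "finite u" "finite v" "k \<notin> u"
  shows "inversions (insert k u) v = card {l \<in> v. l < k} + inversions u v"
  using assms by (simp add: inversions_eq_sum card_less_eq_sum)

lemma inversions_insert2:
  assumes "finite u" "finite v" "k \<notin> v"
  shows "inversions u (insert k v) = card {l \<in> u. k < l} + inversions u v"
  using assms by (simp add: inversions_eq_sum card_greater_eq_sum sum.distrib)

lemma card_less_greater:
  assumes "finite u"
  shows "card {l \<in> u. l < (k::nat)} + card {l \<in> u. k < l} = card (u - {k})"
proof -
  have "u - {k} = {l \<in> u. l < k} \<union> {l \<in> u. k < l}" by auto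
  moreover have "card ({l \<in> u. l < k} \<union> {l \<in> u. k < l}) = card {l \<in> u. l < k} + card {l \<in> u. k < l}"
    using assms by (intro card_Un_disjoint) auto
  ultimately show ?thesis by simp
qed

text \<open>Each pair from u and v is in the wrong order in exactly one of the two products. Modulo
  2 this is supercommutativity.\<close>

lemma inversions_swap:
  assumes "finite u" "finite v" "u \<inter> v = {}"
  shows "inversions u v + inversions v u = card u * card v"
proof -
  have "inversions v u = (\<Sum>k\<in>u. \<Sum>l\<in>v. if k < l then 1 else 0)"
    using assms by (simp add: inversions_eq_sum) (rule sum.swap)
  then have "inversions u v + inversions v u = (\<Sum>k\<in>u. \<Sum>l\<in>v. (if l < k then 1 else 0) + (if k < l then 1 else 0))"
    using assms by (simp add: inversions_eq_sum sum.distrib)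
  also have "\<dots> = (\<Sum>k\<in>u. \<Sum>l\<in>v. 1)"
    by (intro sum.cong refl) (use assms in \<open>auto simp: not_less\<close>)
  finally show ?thesis by simp
qed

lemma minus_one_power_cong: "even (a + b) \<Longrightarrow> (-1) ^ a = ((-1) ^ b :: 'b::ring_1)"
  by (auto simp: minus_one_power_iff)

section \<open>Binomial coefficients modulo a prime\<close>

text \<open>From j C(q^k, j) = q^k C(q^k - 1, j - 1): if q did not divide the coefficient, q^k would
  divide j < q^k. In characteristic p this makes the truncation at p^t compatible with the Leibniz
  rule and makes p^k-th powers of inner derivations derivations.\<close>

lemma prime_dvd_choose_prime_power:
  fixes q :: nat
  assumes "prime q" "0 < j" "j < q ^ k"
  shows "q dvd (q ^ k choose j)"
proof -
  obtain i where i: "j = Suc i" using assms by (cases j) auto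
  obtain N where N: "q ^ k = Suc N" using assms by (cases "q ^ k") auto
  have eq: "j * (q ^ k choose j) = q ^ k * (N choose i)"
    unfolding i N by (simp only: Suc_times_binomial_eq mult.commute)
  show ?thesis
  proof (rule ccontr)
    assume "\<not> q dvd (q ^ k choose j)"
    then have "coprime (q ^ k) (q ^ k choose j)"
      using assms(1) prime_imp_coprime by (metis coprime_power_left_iff)
    moreover have "q ^ k dvd j * (q ^ k choose j)" unfolding eq by simp
    ultimately have "q ^ k dvd j" using coprime_dvd_mult_left_iff by blast
    with assms(2,3) show False by (simp add: nat_dvd_not_less)
  qed
qed

text \<open>A case of Lucas' theorem. Splitting off one block of size q^k by Vandermonde's identity
  leaves only the two end terms modulo q, so each block contributes 1.\<close>

lemma choose_prime_power_cong:
  fixes q :: nat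
  assumes "prime q"
  shows "(q ^ k * s choose q ^ k) mod q = s mod q"
proof (induction s)
  case 0
  have "q ^ k > 0" using assms prime_gt_0_nat by simp
  then show ?case by (simp add: zero_less_binomial_iff[THEN iffD1] binomial_eq_0)
next
  case (Suc s)
  let ?N = "q ^ k"
  have N: "?N > 0" using assms prime_gt_0_nat by simp
  have "?N * Suc s = ?N + ?N * s" by simp
  then have "(?N * Suc s choose ?N) = (\<Sum>j\<le>?N. (?N choose j) * (?N * s choose (?N - j)))"
    using vandermonde[of ?N "?N * s" ?N] by simp
  also have "\<dots> = (\<Sum>j\<in>{0, ?N}. (?N choose j) * (?N * s choose (?N - j)))
      + (\<Sum>j\<in>{..?N} - {0, ?N}. (?N choose j) * (?N * s choose (?N - j)))"
    by (subst sum.subset_diff[of "{0, ?N}"]) auto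
  also have "(\<Sum>j\<in>{0, ?N}. (?N choose j) * (?N * s choose (?N - j))) = (?N * s choose ?N) + 1"
    using N by simp
  finally have eq: "(?N * Suc s choose ?N) = (?N * s choose ?N) + 1
      + (\<Sum>j\<in>{..?N} - {0, ?N}. (?N choose j) * (?N * s choose (?N - j)))" .
  have "q dvd (\<Sum>j\<in>{..?N} - {0, ?N}. (?N choose j) * (?N * s choose (?N - j)))"
    by (intro dvd_sum dvd_mult2 prime_dvd_choose_prime_power assms) auto
  then obtain c where "(\<Sum>j\<in>{..?N} - {0, ?N}. (?N choose j) * (?N * s choose (?N - j))) = q * c" by blast
  then have "(?N * Suc s choose ?N) mod q = ((?N * s choose ?N) + 1) mod q"
    unfolding eq by simp
  also have "\<dots> = (s + 1) mod q" using Suc by (metis mod_add_left_eq)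
  finally show ?case by simp
qed

text \<open>For s = q^k s' with s' prime to q, the choice a = q^k works because the coefficient is
  congruent to s'. Hence every exponent that is not a power of p can be assembled from two smaller
  ones with a nonzero coefficient.\<close>

lemma choose_not_dvd_if_not_prime_power:
  fixes q :: nat
  assumes q: "prime q" and s: "s > 0" "\<And>k. s \<noteq> q ^ k"
  obtains a where "0 < a" "a < s" "\<not> q dvd (s choose a)"
proof -
  obtain k s' where s': "s = q ^ k * s'" "\<not> q dvd s'"
    using multiplicity_decompose'[of s q] q s by (metis not_prime_unit not_gr_zero)
  have "s' \<noteq> 1" using s(2)[of k] s'(1) by auto
  moreover have "s' \<noteq> 0" using s(1) s'(1) by (cases s') auto
  ultimately have "s' > 1" by simp
  then have "q ^ k < s" using s'(1) q prime_gt_0_nat[of q] by simp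
  moreover have "\<not> q dvd (s choose (q ^ k))"
    using choose_prime_power_cong[OF q, of k s'] s' by (simp add: dvd_eq_mod_eq_0)
  moreover have "0 < q ^ k" using q prime_gt_0_nat by simp
  ultimately show ?thesis using that by blast
qed

section \<open>The divided power superalgebra\<close>

definition scaleA :: "'a::field \<Rightarrow> 'a alg \<Rightarrow> 'a alg" where
  "scaleA c f = (\<lambda>X. c * f X)"

lemma scaleA_simps [simp]:
  "scaleA c 0 = 0" "scaleA 0 f = 0" "scaleA 1 f = f" "scaleA c (scaleA d f) = scaleA (c * d) f"
  "scaleA (-1) f = - f"
  by (auto simp: scaleA_def fun_eq_iff papply)

lemma scaleA_add: "scaleA c (f + g) = scaleA c f + scaleA c g"
  and scaleA_diff: "scaleA c (f - g) = scaleA c f - scaleA c g"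
  and scaleA_left_add: "scaleA (c + d) f = scaleA c f + scaleA d f"
  by (auto simp: scaleA_def fun_eq_iff algebra_simps papply)

lemma scaleA_apply: "scaleA c f X = c * f X"
  by (simp add: scaleA_def)

lemma scaleA_sum: "scaleA c (\<Sum>i\<in>I. f i) = (\<Sum>i\<in>I. scaleA c (f i))"
  by (induction I rule: infinite_finite_induct) (simp_all add: scaleA_add)

lemma homog_iff: "homog b f \<longleftrightarrow> (\<forall>X. f X \<noteq> 0 \<longrightarrow> par X = b)"
proof -
  have "f X = part b f X \<longleftrightarrow> (f X \<noteq> 0 \<longrightarrow> par X = b)" for X unfolding Defs.part_def by simp
  then show ?thesis unfolding homog_def fun_eq_iff by blast
qed

lemma sum_fun_apply: "(\<Sum>i\<in>I. f i) x = (\<Sum>i\<in>I. f i x)"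
  by (induction I rule: infinite_finite_induct) (simp_all add: papply)

locale special_lie =
  fixes p m n :: nat and t :: "nat \<Rightarrow> nat" and ty :: "'a::field itself"
  assumes char_p: "CHAR('a) = p" and p3: "p > 3" and m3: "m \<ge> 3" and n3: "n \<ge> 3"
    and t_pos: "\<And>i. i \<in> Y0 m \<Longrightarrow> t i \<ge> 1"
begin

abbreviation MM where "MM \<equiv> Mon p m n t"
abbreviation AA :: "'a alg set" where "AA \<equiv> algA p m n t"
abbreviation mul :: "'a alg \<Rightarrow> 'a alg \<Rightarrow> 'a alg" (infixl "\<odot>" 70) where "mul \<equiv> amul p m n t"
abbreviation D :: "nat \<Rightarrow> 'a alg \<Rightarrow> 'a alg" where "D \<equiv> Dop p m n t"
abbreviation tp :: "nat \<Rightarrow> nat" where "tp i \<equiv> p ^ t i - 1"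
abbreviation mv :: "mon \<Rightarrow> 'a alg" where "mv \<equiv> monvec"

lemma prime_p: "prime p"
  using prime_CHAR_semidom[where ?'a='a] char_p p3 by simp

lemma of_nat_0_iff: "of_nat k = (0::'a) \<longleftrightarrow> p dvd k"
  using of_nat_eq_0_iff_char_dvd[where ?'a='a] char_p by simp

lemma finite_Y [simp]: "finite (Y m n)" "finite (Y0 m)" "finite (Y1 m n)"
  by (auto simp: Y_def Y0_def Y1_def)

lemma Y0_Y1: "r \<in> Y0 m \<Longrightarrow> r \<notin> Y1 m n" "r \<in> Y1 m n \<Longrightarrow> r \<notin> Y0 m"
  by (auto simp: Y0_def Y1_def)

lemma tau_simps [simp]: "r \<in> Y0 m \<Longrightarrow> tau m r = 0" "r \<in> Y1 m n \<Longrightarrow> tau m r = 1"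
  using Y0_Y1 by (auto simp: tau_def)

lemma Y_cases: assumes "r \<in> Y m n" obtains "r \<in> Y0 m" | "r \<in> Y1 m n"
  using assms by (auto simp: Y_def)

lemma p_pow_gt: "i \<in> Y0 m \<Longrightarrow> p ^ t i > 3"
proof -
  assume "i \<in> Y0 m"
  then have "p ^ 1 \<le> p ^ t i" using t_pos p3 by (intro power_increasing) auto
  then show ?thesis using p3 by simp
qed

lemma le_tp: "i \<in> Y0 m \<Longrightarrow> a \<le> tp i \<longleftrightarrow> a < p ^ t i"
  using p_pow_gt[of i] by auto

lemma MM_iff: "(\<alpha>, u) \<in> MM \<longleftrightarrow>
    (\<forall>i. i \<notin> Y0 m \<longrightarrow> \<alpha> i = 0) \<and> (\<forall>i\<in>Y0 m. \<alpha> i < p ^ t i) \<and> u \<subseteq> Y1 m n"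
  unfolding Mon_def using le_tp by auto

lemma finite_MM [simp]: "finite MM"
proof -
  define N where "N = Max ((\<lambda>i. p ^ t i) ` Y0 m)"
  have "MM \<subseteq> {f. \<forall>i. (i \<in> Y0 m \<longrightarrow> f i \<in> {..N}) \<and> (i \<notin> Y0 m \<longrightarrow> f i = 0)} \<times> Pow (Y1 m n)"
  proof
    fix X assume "X \<in> MM"
    moreover have "\<And>i. i \<in> Y0 m \<Longrightarrow> p ^ t i \<le> N" unfolding N_def by (intro Max_ge) auto
    ultimately show "X \<in> {f. \<forall>i. (i \<in> Y0 m \<longrightarrow> f i \<in> {..N}) \<and> (i \<notin> Y0 m \<longrightarrow> f i = 0)} \<times> Pow (Y1 m n)"
      by (cases X) (fastforce simp: MM_iff)
  qed
  moreover have "finite ({f. \<forall>i. (i \<in> Y0 m \<longrightarrow> f i \<in> {..N}) \<and> (i \<notin> Y0 m \<longrightarrow> f i = 0)} \<times> Pow (Y1 m n))"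
    by (intro finite_cartesian_product finite_set_of_finite_funs) auto
  ultimately show ?thesis by (rule finite_subset)
qed

lemma finite_snd: "X \<in> MM \<Longrightarrow> finite (snd X)"
  by (cases X) (auto simp: MM_iff intro: finite_subset)

lemma AA_iff: "f \<in> AA \<longleftrightarrow> (\<forall>X. f X \<noteq> 0 \<longrightarrow> X \<in> MM)"
  by (auto simp: algA_def)

lemma AA_closed [simp]:
  "0 \<in> AA" "f \<in> AA \<Longrightarrow> g \<in> AA \<Longrightarrow> f + g \<in> AA" "f \<in> AA \<Longrightarrow> g \<in> AA \<Longrightarrow> f - g \<in> AA"
  "f \<in> AA \<Longrightarrow> - f \<in> AA" "f \<in> AA \<Longrightarrow> scaleA c f \<in> AA" "f \<odot> g \<in> AA" "D r f \<in> AA"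
  "X \<in> MM \<Longrightarrow> mv X \<in> AA"
  by (auto simp: algA_def scaleA_def amul_def Dop_def monvec_def papply)

lemma AA_sum: "(\<And>i. i \<in> I \<Longrightarrow> f i \<in> AA) \<Longrightarrow> (\<Sum>i\<in>I. f i) \<in> AA"
  by (induction I rule: infinite_finite_induct) simp_all

lemma True_all: "\<forall>X::mon. (f X :: 'a) \<noteq> 0 \<longrightarrow> True"
  by simp

text \<open>There are finitely many monomials, so every element is a finite combination. The
  predicate \<open>Q\<close> is carried along so that the same induction serves homogeneous
  elements.\<close>

lemma AA_induct [consumes 2, case_names zero step]:
  assumes "f \<in> AA" and "\<forall>X. f X \<noteq> 0 \<longrightarrow> Q X" and "P 0"
    and step: "\<And>c a f. a \<in> MM \<Longrightarrow> Q a \<Longrightarrow> f \<in> AA \<Longrightarrow> \<forall>X. f X \<noteq> 0 \<longrightarrow> Q X \<Longrightarrow> P f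
      \<Longrightarrow> P (scaleA c (mv a) + f)"
  shows "P f"
proof -
  have fin: "finite S \<Longrightarrow> {X. f X \<noteq> 0} \<subseteq> S \<Longrightarrow> f \<in> AA \<Longrightarrow> \<forall>X. f X \<noteq> 0 \<longrightarrow> Q X \<Longrightarrow> P f" for S f
  proof (induction S arbitrary: f rule: finite_induct)
    case empty
    then have "f = 0" by (auto simp: fun_eq_iff papply)
    then show ?case using assms(3) by simp
  next
    case (insert a S)
    define g where "g = f(a := 0)"
    have f: "f = scaleA (f a) (mv a) + g"
      by (auto simp: fun_eq_iff g_def scaleA_def monvec_def papply)
    have g: "g \<in> AA" "{X. g X \<noteq> 0} \<subseteq> S" "\<forall>X. g X \<noteq> 0 \<longrightarrow> Q X"
      using insert.prems by (auto simp: g_def AA_iff split: if_splits)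
    have Pg: "P g" using insert.IH g by blast
    show ?case
    proof (cases "f a = 0")
      case True
      then have "f = g" by (auto simp: g_def fun_eq_iff)
      then show ?thesis using Pg by simp
    next
      case False
      then have "a \<in> MM" "Q a" using insert.prems unfolding AA_iff by blast+
      then show ?thesis using step[OF _ _ g(1) g(3) Pg] f by metis
    qed
  qed
  have "finite {X. f X \<noteq> 0}" using assms(1) by (intro finite_subset[OF _ finite_MM]) (auto simp: AA_iff)
  then show ?thesis using fin assms by blast
qed

lemma mul_add_left: "(f + g) \<odot> h = f \<odot> h + g \<odot> h"
proof
  fix X
  have "(\<Sum>(a, b)\<in>MM \<times> MM.
        if (\<lambda>i. fst a i + fst b i) = fst X \<and> snd a \<inter> snd b = {} \<and> snd a \<union> snd b = snd X
        then mcoef m a b * (f + g) a * h b else 0) =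
      (\<Sum>(a, b)\<in>MM \<times> MM.
        (if (\<lambda>i. fst a i + fst b i) = fst X \<and> snd a \<inter> snd b = {} \<and> snd a \<union> snd b = snd X
        then mcoef m a b * f a * h b else 0) +
        (if (\<lambda>i. fst a i + fst b i) = fst X \<and> snd a \<inter> snd b = {} \<and> snd a \<union> snd b = snd X
        then mcoef m a b * g a * h b else 0))"
    by (rule sum.cong) (auto simp: algebra_simps papply)
  then show "((f + g) \<odot> h) X = (f \<odot> h + g \<odot> h) X"
    unfolding amul_def by (simp add: sum.distrib case_prod_beta papply)
qed

lemma mul_add_right: "h \<odot> (f + g) = h \<odot> f + h \<odot> g"
proof
  fix X
  have "(\<Sum>(a, b)\<in>MM \<times> MM.
        if (\<lambda>i. fst a i + fst b i) = fst X \<and> snd a \<inter> snd b = {} \<and> snd a \<union> snd b = snd X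
        then mcoef m a b * h a * (f + g) b else 0) =
      (\<Sum>(a, b)\<in>MM \<times> MM.
        (if (\<lambda>i. fst a i + fst b i) = fst X \<and> snd a \<inter> snd b = {} \<and> snd a \<union> snd b = snd X
        then mcoef m a b * h a * f b else 0) +
        (if (\<lambda>i. fst a i + fst b i) = fst X \<and> snd a \<inter> snd b = {} \<and> snd a \<union> snd b = snd X
        then mcoef m a b * h a * g b else 0))"
    by (rule sum.cong) (auto simp: algebra_simps papply)
  then show "(h \<odot> (f + g)) X = (h \<odot> f + h \<odot> g) X"
    unfolding amul_def by (simp add: sum.distrib case_prod_beta papply)
qed

lemma mul_scale_left: "scaleA c f \<odot> g = scaleA c (f \<odot> g)"
  and mul_scale_right: "f \<odot> scaleA c g = scaleA c (f \<odot> g)"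
  unfolding amul_def scaleA_def
  by (auto simp: fun_eq_iff papply sum_distrib_left case_prod_beta algebra_simps intro!: sum.cong)

lemma mul_0_left [simp]: "0 \<odot> f = 0"
  using mul_scale_left[of 0 f f] by simp

lemma mul_0_right [simp]: "f \<odot> 0 = 0"
  using mul_scale_right[of f 0 f] by simp

lemma mul_minus_left: "(- f) \<odot> g = - (f \<odot> g)"
  using mul_scale_left[of "-1" f g] by simp

lemma mul_minus_right: "f \<odot> (- g) = - (f \<odot> g)"
  using mul_scale_right[of f "-1" g] by simp

lemma mul_diff_left: "(f - g) \<odot> h = f \<odot> h - g \<odot> h"
  using mul_add_left[of "f" "- g" h] by (simp add: mul_minus_left)

lemma mul_diff_right: "h \<odot> (f - g) = h \<odot> f - h \<odot> g"
  using mul_add_right[of h "f" "- g"] by (simp add: mul_minus_right)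

lemma mul_sum_left: "(\<Sum>i\<in>I. f i) \<odot> g = (\<Sum>i\<in>I. f i \<odot> g)"
  by (induction I rule: infinite_finite_induct) (simp_all add: mul_add_left)

lemma mul_sum_right: "g \<odot> (\<Sum>i\<in>I. f i) = (\<Sum>i\<in>I. g \<odot> f i)"
  by (induction I rule: infinite_finite_induct) (simp_all add: mul_add_right)

definition mplus :: "mon \<Rightarrow> mon \<Rightarrow> mon" where
  "mplus a b = (\<lambda>i. fst a i + fst b i, snd a \<union> snd b)"

lemma mplus_simps [simp]: "fst (mplus a b) i = fst a i + fst b i" "snd (mplus a b) = snd a \<union> snd b"
  by (simp_all add: mplus_def)

definition okm :: "mon \<Rightarrow> mon \<Rightarrow> bool" where
  "okm a b \<longleftrightarrow> snd a \<inter> snd b = {} \<and> mplus a b \<in> MM"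

lemma mul_mv:
  assumes "a \<in> MM" "b \<in> MM"
  shows "mv a \<odot> mv b = (if okm a b then scaleA (mcoef m a b) (mv (mplus a b)) else 0)"
proof
  fix X
  define C where "C = (\<lambda>(a::mon) (b::mon). (\<lambda>i. fst a i + fst b i) = fst X \<and> snd a \<inter> snd b = {} \<and> snd a \<union> snd b = snd X)"
  have "(\<Sum>(a', b')\<in>MM \<times> MM. if C a' b' then mcoef m a' b' * mv a a' * mv b b' else 0) =
      (\<Sum>z\<in>MM \<times> MM. if z = (a, b) then (if C a b then mcoef m a b else 0) else 0)"
    by (rule sum.cong) (auto simp: monvec_def split: if_splits)
  also have "\<dots> = (if C a b then mcoef m a b else 0)"
    using assms by (subst sum.delta) auto
  finally have eq: "(mv a \<odot> mv b) X = (if X \<in> MM then if C a b then mcoef m a b else 0 else 0)"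
    unfolding amul_def C_def by simp
  have "C a b \<longleftrightarrow> snd a \<inter> snd b = {} \<and> X = mplus a b"
    by (cases X) (auto simp: C_def mplus_def)
  then show "(mv a \<odot> mv b) X = (if okm a b then scaleA (mcoef m a b) (mv (mplus a b)) else 0) X"
    unfolding eq okm_def by (auto simp: scaleA_def monvec_def papply)
qed

lemma mcoef_inversions: "mcoef m a b = of_nat (\<Prod>i\<in>Y0 m. (fst a i + fst b i) choose (fst a i)) * (-1::'a) ^ inversions (snd a) (snd b)"
  by (simp add: mcoef_def inversions_def)

lemma MM_mplus_left: "mplus a b \<in> MM \<Longrightarrow> a \<in> MM" and MM_mplus_right: "mplus a b \<in> MM \<Longrightarrow> b \<in> MM"
  by (cases a; cases b; fastforce simp: mplus_def MM_iff)+

lemma mplus_assoc: "mplus (mplus a b) c = mplus a (mplus b c)"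
  by (auto simp: mplus_def)

lemma mult_split:
  "x * x' = z * z' \<Longrightarrow> y * y' = w * w' \<Longrightarrow> (x * y) * (x' * y') = (z * w) * (z' * (w' :: 'a))"
  by (metis mult.assoc mult.left_commute)

text \<open>Index by index this is C(a+b, a) C(a+b+c, a+b) = C(b+c, b) C(a+b+c, a). Truncation does
  no harm: admissible exponents are closed downwards, so a product that leaves the range at an
  intermediate stage is 0 in both bracketings.\<close>

lemma mul_assoc_mv:
  assumes "a \<in> MM" "b \<in> MM" "c \<in> MM"
  shows "(mv a \<odot> mv b) \<odot> mv c = mv a \<odot> (mv b \<odot> mv c)"
proof (cases "snd a \<inter> snd b = {} \<and> snd a \<inter> snd c = {} \<and> snd b \<inter> snd c = {} \<and> mplus a (mplus b c) \<in> MM")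
  case True
  then have M: "mplus a b \<in> MM" "mplus b c \<in> MM"
    using MM_mplus_left[of "mplus a b" c] MM_mplus_right[of a "mplus b c"] by (auto simp: mplus_assoc)
  have fin: "finite (snd a)" "finite (snd b)" "finite (snd c)" using assms finite_snd by auto
  have "(\<Prod>i\<in>Y0 m. (fst a i + fst b i) choose (fst a i)) *
      (\<Prod>i\<in>Y0 m. (fst a i + fst b i + fst c i) choose (fst a i + fst b i)) =
      (\<Prod>i\<in>Y0 m. (fst b i + fst c i) choose (fst b i)) *
      (\<Prod>i\<in>Y0 m. (fst a i + (fst b i + fst c i)) choose (fst a i))"
  proof (subst (1 2) prod.distrib[symmetric], rule prod.cong[OF refl])
    fix i
    show "(fst a i + fst b i choose fst a i) * (fst a i + fst b i + fst c i choose (fst a i + fst b i)) =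
       (fst b i + fst c i choose fst b i) * (fst a i + (fst b i + fst c i) choose fst a i)"
      using choose_mult_lemma[of "fst b i" "fst c i" "fst a i"] by (simp add: ac_simps)
  qed
  then have P: "of_nat (\<Prod>i\<in>Y0 m. (fst a i + fst b i) choose (fst a i)) *
      of_nat (\<Prod>i\<in>Y0 m. (fst a i + fst b i + fst c i) choose (fst a i + fst b i)) =
      of_nat (\<Prod>i\<in>Y0 m. (fst b i + fst c i) choose (fst b i)) *
      (of_nat (\<Prod>i\<in>Y0 m. (fst a i + (fst b i + fst c i)) choose (fst a i)) :: 'a)"
    by (simp only: of_nat_mult[symmetric])
  have "inversions (snd a) (snd b) + inversions (snd a \<union> snd b) (snd c) = inversions (snd b) (snd c) + inversions (snd a) (snd b \<union> snd c)"
    using True fin by (simp add: inversions_Un1 inversions_Un2)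
  then have "(-1) ^ inversions (snd a) (snd b) * (-1) ^ inversions (snd a \<union> snd b) (snd c) =
     (-1) ^ inversions (snd b) (snd c) * ((-1::'a) ^ inversions (snd a) (snd b \<union> snd c))"
    by (simp flip: power_add)
  then have "mcoef m a b * mcoef m (mplus a b) c = mcoef m b c * (mcoef m a (mplus b c) :: 'a)"
    unfolding mcoef_inversions mplus_simps using P by (intro mult_split)
  moreover have "okm a b" "okm (mplus a b) c" "okm b c" "okm a (mplus b c)"
    using True M by (auto simp: okm_def mplus_assoc)
  ultimately show ?thesis using M assms
    by (simp add: mul_mv mul_scale_left mul_scale_right mplus_assoc mult.commute)
next
  case False
  have "(mv a \<odot> mv b) \<odot> mv c = 0"
  proof (cases "okm a b")
    case True
    then have "\<not> okm (mplus a b) c" "mplus a b \<in> MM" using False by (auto simp: okm_def mplus_assoc)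
    then show ?thesis using assms by (simp add: mul_mv mul_scale_left)
  qed (use assms in \<open>simp add: mul_mv\<close>)
  moreover have "mv a \<odot> (mv b \<odot> mv c) = 0"
  proof (cases "okm b c")
    case True
    then have "\<not> okm a (mplus b c)" "mplus b c \<in> MM" using False by (auto simp: okm_def)
    then show ?thesis using assms by (simp add: mul_mv mul_scale_right)
  qed (use assms in \<open>simp add: mul_mv\<close>)
  ultimately show ?thesis by simp
qed

lemma mul_assoc:
  assumes "f \<in> AA" "g \<in> AA" "h \<in> AA"
  shows "(f \<odot> g) \<odot> h = f \<odot> (g \<odot> h)"
proof -
  have 1: "(mv a \<odot> mv b) \<odot> h = mv a \<odot> (mv b \<odot> h)" if "a \<in> MM" "b \<in> MM" for a b
    using assms(3) True_all
  proof (induction h rule: AA_induct[where Q="\<lambda>_. True"])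
    case (step c x f)
    then show ?case using that mul_assoc_mv
      by (simp add: mul_add_right mul_scale_right)
  qed simp_all
  have 2: "(mv a \<odot> g) \<odot> h = mv a \<odot> (g \<odot> h)" if "a \<in> MM" for a
    using assms(2) True_all
  proof (induction g rule: AA_induct[where Q="\<lambda>_. True"])
    case (step c x f)
    then show ?case using that 1
      by (simp add: mul_add_right mul_add_left mul_scale_left mul_scale_right)
  qed simp_all
  show ?thesis
    using assms(1) True_all
  proof (induction f rule: AA_induct[where Q="\<lambda>_. True"])
    case (step c x f)
    then show ?case using 2
      by (simp add: mul_add_left mul_scale_left)
  qed simp_all
qed

lemma mul_comm_mv:
  assumes "a \<in> MM" "b \<in> MM"
  shows "mv b \<odot> mv a = scaleA ((-1) ^ (par a * par b)) (mv a \<odot> mv b)"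
proof (cases "okm a b")
  case True
  have fin: "finite (snd a)" "finite (snd b)" using assms finite_snd by auto
  have sw: "mplus b a = mplus a b" by (auto simp: mplus_def)
  have okm: "okm b a" using True by (auto simp: okm_def sw)
  have "inversions (snd a) (snd b) + inversions (snd b) (snd a) = card (snd a) * card (snd b)"
    using True fin by (intro inversions_swap) (auto simp: okm_def)
  then have "even (inversions (snd a) (snd b) + inversions (snd b) (snd a)) \<longleftrightarrow> even (card (snd a) * card (snd b))"
    by simp
  then have "even (inversions (snd b) (snd a) + (par a * par b + inversions (snd a) (snd b)))"
    unfolding par_def by simp blast
  then have "(-1) ^ inversions (snd b) (snd a) = (-1::'a) ^ (par a * par b + inversions (snd a) (snd b))"
    by (rule minus_one_power_cong)
  moreover have "(\<Prod>i\<in>Y0 m. (fst b i + fst a i) choose (fst b i)) = (\<Prod>i\<in>Y0 m. (fst a i + fst b i) choose (fst a i))"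
    using binomial_symmetric by (intro prod.cong refl) (metis add.commute add_diff_cancel_left' le_add1)
  ultimately have "mcoef m b a = (-1) ^ (par a * par b) * (mcoef m a b :: 'a)"
    unfolding mcoef_inversions by (simp add: power_add del: of_nat_prod)
  then show ?thesis using True okm assms by (simp add: mul_mv sw)
next
  case False
  have sw: "mplus b a = mplus a b" by (auto simp: mplus_def)
  have "\<not> okm b a" using False by (auto simp: okm_def sw)
  with False show ?thesis using assms by (simp add: mul_mv)
qed

lemma mul_comm:
  assumes "f \<in> AA" "g \<in> AA" "homog a f" "homog b g"
  shows "g \<odot> f = scaleA ((-1) ^ (a * b)) (f \<odot> g)"
proof -
  have 1: "g \<odot> mv x = scaleA ((-1) ^ (a * b)) (mv x \<odot> g)" if "x \<in> MM" "par x = a" for x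
    using assms(2) assms(4)[unfolded homog_iff]
  proof (induction g rule: AA_induct[where Q="\<lambda>X. par X = b"])
    case (step c y f)
    then show ?case using that mul_comm_mv[of x y]
      by (simp add: mul_add_right mul_add_left mul_scale_left mul_scale_right scaleA_add mult.commute)
  qed simp_all
  show ?thesis
    using assms(1) assms(3)[unfolded homog_iff]
  proof (induction f rule: AA_induct[where Q="\<lambda>X. par X = a"])
    case (step c y f)
    then show ?case using 1[of y]
      by (simp add: mul_add_right mul_add_left mul_scale_left mul_scale_right scaleA_add mult.commute)
  qed simp_all
qed


section \<open>The superderivations\<close>

lemma D_add: "D r (f + g) = D r f + D r g"
  by (auto simp: Dop_def fun_eq_iff papply algebra_simps)

lemma D_scale: "D r (scaleA c f) = scaleA c (D r f)"
  by (auto simp: Dop_def fun_eq_iff papply scaleA_def algebra_simps)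

lemma D_0 [simp]: "D r 0 = 0"
  using D_scale[of r 0 0] by simp

lemma D_minus: "D r (- f) = - D r f"
  using D_scale[of r "-1" f] by simp

lemma D_diff: "D r (f - g) = D r f - D r g"
  using D_add[of r f "- g"] by (simp add: D_minus)

lemma D_sum: "D r (\<Sum>i\<in>I. f i) = (\<Sum>i\<in>I. D r (f i))"
  by (induction I rule: infinite_finite_induct) (simp_all add: D_add)

lemma D_mv0:
  assumes "i \<in> Y0 m" "(\<alpha>, u) \<in> MM"
  shows "D i (mv (\<alpha>, u)) = (if \<alpha> i = 0 then 0 else mv (\<alpha>(i := \<alpha> i - 1), u))"
proof
  fix X :: mon
  obtain \<beta> v where X: "X = (\<beta>, v)" by (cases X)
  have *: "\<beta>(i := Suc (\<beta> i)) = \<alpha> \<longleftrightarrow> \<alpha> i > 0 \<and> \<beta> = \<alpha>(i := \<alpha> i - 1)"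
    by (auto simp: fun_eq_iff)
  have "(\<alpha>(i := \<alpha> i - 1), u) \<in> MM" using assms by (force simp: MM_iff)
  then show "D i (mv (\<alpha>, u)) X = (if \<alpha> i = 0 then 0 else mv (\<alpha>(i := \<alpha> i - 1), u)) X"
    using assms * by (auto simp: Dop_def monvec_def papply X)
qed

lemma D_mv1:
  assumes "k \<in> Y1 m n" "(\<alpha>, u) \<in> MM"
  shows "D k (mv (\<alpha>, u)) = (if k \<in> u then scaleA ((-1) ^ card {l \<in> u. l < k}) (mv (\<alpha>, u - {k})) else 0)"
proof
  fix X :: mon
  obtain \<beta> v where X: "X = (\<beta>, v)" by (cases X)
  have *: "k \<notin> v \<and> insert k v = u \<longleftrightarrow> k \<in> u \<and> v = u - {k}" by auto
  have **: "{l \<in> u - {k}. l < k} = {l \<in> u. l < k}" by auto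
  have "(\<alpha>, u - {k}) \<in> MM" using assms by (auto simp: MM_iff)
  then show "D k (mv (\<alpha>, u)) X = (if k \<in> u then scaleA ((-1) ^ card {l \<in> u. l < k}) (mv (\<alpha>, u - {k})) else 0) X"
    using assms * ** Y0_Y1 by (auto simp: Dop_def monvec_def papply X scaleA_def)
qed

lemma MM_lower: "(\<alpha>, u) \<in> MM \<Longrightarrow> (\<alpha>(i := \<alpha> i - 1), u) \<in> MM"
  by (force simp: MM_iff)

lemma mul_mv_split:
  assumes "i \<in> Y0 m" "(\<alpha>, u) \<in> MM" "(\<beta>, v) \<in> MM" "u \<inter> v = {}"
  shows "mv (\<alpha>, u) \<odot> mv (\<beta>, v) = (if (\<lambda>j. \<alpha> j + \<beta> j, u \<union> v) \<in> MM
    then scaleA (of_nat (\<alpha> i + \<beta> i choose \<alpha> i) *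
      (of_nat (\<Prod>j\<in>Y0 m - {i}. \<alpha> j + \<beta> j choose \<alpha> j) * (-1) ^ inversions u v))
      (mv (\<lambda>j. \<alpha> j + \<beta> j, u \<union> v)) else 0)"
  using assms by (simp add: mul_mv okm_def mplus_def mcoef_inversions prod.remove[of "Y0 m" i] mult.assoc)

text \<open>Inside the range this is Pascal's rule. When the sum of the exponents at
  \<open>i\<close> is exactly p^t_i, the product on the left is 0 by truncation, while the right
  side still produces an admissible monomial; its coefficient C(p^t_i, \<alpha>_i) is divisible by
  p.\<close>

lemma D_mul_mv0:
  assumes i: "i \<in> Y0 m" and a: "a \<in> MM" and b: "b \<in> MM"
  shows "D i (mv a \<odot> mv b) = D i (mv a) \<odot> mv b + mv a \<odot> D i (mv b)"
proof -
  obtain \<alpha> u where au: "a = (\<alpha>, u)" by (cases a)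
  obtain \<beta> v where bv: "b = (\<beta>, v)" by (cases b)
  note a = a[unfolded au] and b = b[unfolded bv]
  have a': "(\<alpha>(i := \<alpha> i - 1), u) \<in> MM" and b': "(\<beta>(i := \<beta> i - 1), v) \<in> MM"
    using a b MM_lower by blast+
  show ?thesis
  proof (cases "u \<inter> v = {}")
    case False
    then show ?thesis using i a b a' b'
      by (auto simp: au bv mul_mv okm_def D_mv0)
  next
    case dj: True
    define \<gamma> where "\<gamma> = (\<lambda>j. \<alpha> j + \<beta> j)"
    define \<gamma>' where "\<gamma>' = \<gamma>(i := \<gamma> i - 1)"
    define R :: 'a where "R = of_nat (\<Prod>j\<in>Y0 m - {i}. \<alpha> j + \<beta> j choose \<alpha> j) * (-1) ^ inversions u v"
    have P1: "(\<Prod>j\<in>Y0 m - {i}. (\<alpha>(i := \<alpha> i - 1)) j + \<beta> j choose ((\<alpha>(i := \<alpha> i - 1)) j)) =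
      (\<Prod>j\<in>Y0 m - {i}. \<alpha> j + \<beta> j choose \<alpha> j)" by (rule prod.cong) auto
    have P2: "(\<Prod>j\<in>Y0 m - {i}. \<alpha> j + (\<beta>(i := \<beta> i - 1)) j choose (\<alpha> j)) =
      (\<Prod>j\<in>Y0 m - {i}. \<alpha> j + \<beta> j choose \<alpha> j)" by (rule prod.cong) auto
    have T1: "mv (\<alpha>(i := \<alpha> i - 1), u) \<odot> mv (\<beta>, v) = (if (\<gamma>', u \<union> v) \<in> MM
        then scaleA (of_nat (\<alpha> i - 1 + \<beta> i choose (\<alpha> i - 1)) * R) (mv (\<gamma>', u \<union> v)) else 0)"
      if "\<alpha> i > 0"
    proof -
      have "(\<lambda>j. (\<alpha>(i := \<alpha> i - 1)) j + \<beta> j) = \<gamma>'" using that by (auto simp: \<gamma>'_def \<gamma>_def)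
      then show ?thesis unfolding mul_mv_split[OF i a' b dj] P1 R_def by simp
    qed
    have T2: "mv (\<alpha>, u) \<odot> mv (\<beta>(i := \<beta> i - 1), v) = (if (\<gamma>', u \<union> v) \<in> MM
        then scaleA (of_nat (\<alpha> i + (\<beta> i - 1) choose (\<alpha> i)) * R) (mv (\<gamma>', u \<union> v)) else 0)"
      if "\<beta> i > 0"
    proof -
      have "(\<lambda>j. \<alpha> j + (\<beta>(i := \<beta> i - 1)) j) = \<gamma>'" using that by (auto simp: \<gamma>'_def \<gamma>_def)
      then show ?thesis unfolding mul_mv_split[OF i a b' dj] P2 R_def by simp
    qed
    have T: "mv (\<alpha>, u) \<odot> mv (\<beta>, v) = (if (\<gamma>, u \<union> v) \<in> MM
        then scaleA (of_nat (\<gamma> i choose \<alpha> i) * R) (mv (\<gamma>, u \<union> v)) else 0)"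
      unfolding mul_mv_split[OF i a b dj] R_def \<gamma>_def by simp
    have low: "(\<gamma>', u \<union> v) \<in> MM" if "(\<gamma>, u \<union> v) \<in> MM"
      using that MM_lower unfolding \<gamma>'_def by blast
    show ?thesis
    proof (cases "\<gamma> i = 0")
      case True
      then show ?thesis using i a b by (simp add: au bv D_mv0 T D_scale \<gamma>_def)
    next
      case g: False
      show ?thesis
      proof (cases "(\<gamma>', u \<union> v) \<in> MM")
        case False
        then show ?thesis using low i a b T T1 T2 by (auto simp: au bv D_mv0)
      next
        case g': True
        have rhs: "D i (mv a) \<odot> mv b + mv a \<odot> D i (mv b) = scaleA (of_nat (\<gamma> i choose \<alpha> i) * R) (mv (\<gamma>', u \<union> v))"
        proof (cases "\<alpha> i"; cases "\<beta> i")
          assume "\<alpha> i = 0" "\<beta> i = 0" then show ?thesis using g by (simp add: \<gamma>_def)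
        next
          fix x assume "\<alpha> i = 0" "\<beta> i = Suc x"
          then show ?thesis using i a b g' T2 by (simp add: au bv D_mv0 \<gamma>_def)
        next
          fix x assume "\<beta> i = 0" "\<alpha> i = Suc x"
          then show ?thesis using i a b g' T1 by (simp add: au bv D_mv0 \<gamma>_def)
        next
          fix x y assume xy: "\<alpha> i = Suc x" "\<beta> i = Suc y"
          then have "D i (mv a) \<odot> mv b + mv a \<odot> D i (mv b) =
            scaleA (of_nat ((x + Suc y choose x) + (Suc x + y choose Suc x)) * R) (mv (\<gamma>', u \<union> v))"
            using i a b g' T1 T2 by (simp add: au bv D_mv0 scaleA_left_add algebra_simps)
          then show ?thesis using xy by (simp add: \<gamma>_def)
        qed
        show ?thesis
        proof (cases "(\<gamma>, u \<union> v) \<in> MM")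
          case True
          then show ?thesis unfolding rhs using i g by (simp add: au bv T D_scale D_mv0 \<gamma>'_def)
        next
          case False
          have "\<gamma> i \<ge> p ^ t i"
          proof (rule ccontr)
            assume "\<not> p ^ t i \<le> \<gamma> i"
            then have "(\<gamma>, u \<union> v) \<in> MM" using g' i unfolding MM_iff \<gamma>'_def
              by (metis fun_upd_other linorder_not_less)
            then show False using False by simp
          qed
          moreover have "\<gamma> i - 1 < p ^ t i" using g' i by (auto simp: MM_iff \<gamma>'_def)
          ultimately have gi: "\<gamma> i = p ^ t i" using g by linarith
          moreover have "\<alpha> i < p ^ t i" "\<beta> i < p ^ t i" using a b i by (auto simp: MM_iff)
          ultimately have "p dvd (\<gamma> i choose \<alpha> i)"
            using prime_dvd_choose_prime_power[OF prime_p, of "\<alpha> i" "t i"] by (simp add: \<gamma>_def)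
          then have "of_nat (\<gamma> i choose \<alpha> i) = (0::'a)" using of_nat_0_iff by blast
          then show ?thesis unfolding rhs using False by (simp add: au bv T)
        qed
      qed
    qed
  qed
qed

text \<open>The even exponents are untouched, so this is a sign count according to which factor
  contains \<open>k\<close>. If both do, the product is 0 and the two terms on the right cancel,
  since \<open>card u\<close> counts \<open>k\<close> itself besides the elements below and above
  it.\<close>

lemma D_mul_mv1:
  assumes k: "k \<in> Y1 m n" and a: "a \<in> MM" and b: "b \<in> MM"
  shows "D k (mv a \<odot> mv b) = D k (mv a) \<odot> mv b + scaleA ((-1) ^ par a) (mv a \<odot> D k (mv b))"
proof -
  obtain \<alpha> u where au: "a = (\<alpha>, u)" by (cases a)
  obtain \<beta> v where bv: "b = (\<beta>, v)" by (cases b)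
  note a = a[unfolded au] and b = b[unfolded bv]
  have fin: "finite u" "finite v" using a b finite_snd by fastforce+
  have a': "(\<alpha>, u - {k}) \<in> MM" and b': "(\<beta>, v - {k}) \<in> MM"
    using a b by (auto simp: MM_iff)
  define \<gamma> where "\<gamma> = (\<lambda>j. \<alpha> j + \<beta> j)"
  define R :: 'a where "R = of_nat (\<Prod>j\<in>Y0 m. \<alpha> j + \<beta> j choose \<alpha> j)"
  define B where "B \<longleftrightarrow> (\<gamma>, {}) \<in> MM"
  have M: "mv (\<alpha>, u') \<odot> mv (\<beta>, v') = (if B \<and> u' \<inter> v' = {}
      then scaleA (R * (-1) ^ inversions u' v') (mv (\<gamma>, u' \<union> v')) else 0)"
    if "u' \<subseteq> u" "v' \<subseteq> v" for u' v'
  proof -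
    have "(\<alpha>, u') \<in> MM" "(\<beta>, v') \<in> MM" "(\<gamma>, u' \<union> v') \<in> MM \<longleftrightarrow> B"
      using a b that by (auto simp: MM_iff B_def)
    then show ?thesis by (auto simp: mul_mv okm_def mplus_def mcoef_inversions R_def \<gamma>_def)
  qed
  have G: "(\<gamma>, u \<union> v) \<in> MM" if B using that a b by (auto simp: B_def MM_iff)
  have par: "(-1) ^ par a = ((-1::'a) ^ card u)"
    by (rule minus_one_power_cong) (simp add: par_def au)
  show ?thesis
  proof (cases B)
    case False
    then show ?thesis using a b k by (auto simp: au bv M D_mv1 mul_scale_left mul_scale_right)
  next
    case B: True
    consider "k \<notin> u" "k \<notin> v" | "k \<in> u" "k \<notin> v" | "k \<notin> u" "k \<in> v" | "k \<in> u" "k \<in> v" by blast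
    then show ?thesis
    proof cases
      case 1
      then show ?thesis using a b k G[OF B] by (auto simp: au bv M D_mv1 D_scale)
    next
      case 2
      have dj: "(u - {k}) \<inter> v = {} \<longleftrightarrow> u \<inter> v = {}" using 2 by auto
      show ?thesis
      proof (cases "u \<inter> v = {}")
        case False
        then show ?thesis using a b k 2 dj by (simp add: au bv M D_mv1 mul_scale_left)
      next
        case True
        have "inversions u v = card {l \<in> v. l < k} + inversions (u - {k}) v"
          using inversions_insert1[of "u - {k}" v k] fin 2 by (simp add: insert_absorb)
        moreover have "card {l \<in> u \<union> v. l < k} = card {l \<in> u. l < k} + card {l \<in> v. l < k}"
        proof -
          have "{l \<in> u \<union> v. l < k} = {l \<in> u. l < k} \<union> {l \<in> v. l < k}" by auto
          then show ?thesis using fin True by (simp add: card_Un_disjoint disjoint_iff)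
        qed
        ultimately have s: "(-1) ^ inversions u v * (-1) ^ card {l \<in> u \<union> v. l < k} =
            (-1) ^ card {l \<in> u. l < k} * ((-1::'a) ^ inversions (u - {k}) v)"
          by (simp only: power_add[symmetric]) (rule minus_one_power_cong, simp, argo)
        have "(u - {k}) \<union> v = (u \<union> v) - {k}" using 2 by auto
        then show ?thesis using a b k 2 dj True B G[OF B] s
          by (simp add: au bv M D_mv1 D_scale mul_scale_left mult.assoc mult.left_commute)
      qed
    next
      case 3
      have dj: "u \<inter> (v - {k}) = {} \<longleftrightarrow> u \<inter> v = {}" using 3 by auto
      show ?thesis
      proof (cases "u \<inter> v = {}")
        case False
        then show ?thesis using a b k 3 dj by (simp add: au bv M D_mv1 mul_scale_right)
      next
        case True
        have "inversions u v = card {l \<in> u. k < l} + inversions u (v - {k})"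
          using inversions_insert2[of u "v - {k}" k] fin 3 by (simp add: insert_absorb)
        moreover have "card {l \<in> u \<union> v. l < k} = card {l \<in> u. l < k} + card {l \<in> v. l < k}"
        proof -
          have "{l \<in> u \<union> v. l < k} = {l \<in> u. l < k} \<union> {l \<in> v. l < k}" by auto
          then show ?thesis using fin True by (simp add: card_Un_disjoint disjoint_iff)
        qed
        moreover have "card u = card {l \<in> u. l < k} + card {l \<in> u. k < l}"
          using card_less_greater[OF fin(1), of k] 3 by simp
        ultimately have s: "(-1) ^ inversions u v * (-1) ^ card {l \<in> u \<union> v. l < k} =
            (-1) ^ card u * ((-1) ^ card {l \<in> v. l < k} * ((-1::'a) ^ inversions u (v - {k})))"
          by (simp only: power_add[symmetric]) (rule minus_one_power_cong, simp, argo)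
        have "u \<union> (v - {k}) = (u \<union> v) - {k}" using 3 by auto
        then show ?thesis unfolding par using a b k 3 dj True B G[OF B] s
          by (simp add: au bv M D_mv1 D_scale mul_scale_right mult.assoc mult.left_commute)
      qed
    next
      case 4
      then have l: "mv a \<odot> mv b = 0" by (auto simp: au bv M)
      have dj: "(u - {k}) \<inter> v = {} \<longleftrightarrow> u \<inter> (v - {k}) = {}" using 4 by auto
      have un: "(u - {k}) \<union> v = u \<union> (v - {k})" using 4 by auto
      have "inversions (u - {k}) v = card {l \<in> u - {k}. k < l} + inversions (u - {k}) (v - {k})"
        using inversions_insert2[of "u - {k}" "v - {k}" k] fin 4 by (simp add: insert_absorb)
      moreover have "{l \<in> u - {k}. k < l} = {l \<in> u. k < l}" by auto
      moreover have "inversions u (v - {k}) = card {l \<in> v - {k}. l < k} + inversions (u - {k}) (v - {k})"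
        using inversions_insert1[of "u - {k}" "v - {k}" k] fin 4 by (simp add: insert_absorb)
      moreover have "{l \<in> v - {k}. l < k} = {l \<in> v. l < k}" by auto
      moreover have "card u = Suc (card {l \<in> u. l < k} + card {l \<in> u. k < l})"
        using card_less_greater[OF fin(1), of k] 4 fin by (metis card.remove)
      ultimately have s: "(-1) ^ card u * ((-1) ^ card {l \<in> v. l < k} * (-1) ^ inversions u (v - {k})) =
          - ((-1) ^ card {l \<in> u. l < k} * ((-1::'a) ^ inversions (u - {k}) v))"
        by (simp flip: power_add power_Suc) (simp add: power_add)
      have "D k (mv a) \<odot> mv b + scaleA ((-1) ^ par a) (mv a \<odot> D k (mv b)) = 0"
      proof (cases "(u - {k}) \<inter> v = {}")
        case False
        then show ?thesis unfolding par using a b k 4 dj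
          by (simp add: au bv M D_mv1 mul_scale_left mul_scale_right)
      next
        case True
        then have "D k (mv a) \<odot> mv b + scaleA ((-1) ^ par a) (mv a \<odot> D k (mv b)) =
          scaleA (R * ((-1) ^ card {l \<in> u. l < k} * ((-1::'a) ^ inversions (u - {k}) v)) +
          R * ((-1) ^ card u * ((-1) ^ card {l \<in> v. l < k} * (-1) ^ inversions u (v - {k})))) (mv (\<gamma>, u \<union> (v - {k})))"
          unfolding par using a b k 4 dj un B
          by (simp add: au bv M D_mv1 mul_scale_left mul_scale_right scaleA_left_add mult.assoc mult.left_commute)
        then show ?thesis unfolding s by simp
      qed
      then show ?thesis using l by simp
    qed
  qed
qed

lemma D_mul_mv:
  assumes "r \<in> Y m n" "a \<in> MM" "b \<in> MM"
  shows "D r (mv a \<odot> mv b) = D r (mv a) \<odot> mv b + scaleA ((-1) ^ (tau m r * par a)) (mv a \<odot> D r (mv b))"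
  using assms(1) by (rule Y_cases) (use assms(2,3) D_mul_mv0 D_mul_mv1 in simp_all)

lemma D_mul:
  assumes "r \<in> Y m n" "f \<in> AA" "g \<in> AA" "homog a f"
  shows "D r (f \<odot> g) = D r f \<odot> g + scaleA ((-1) ^ (tau m r * a)) (f \<odot> D r g)"
proof -
  have 1: "D r (mv x \<odot> g) = D r (mv x) \<odot> g + scaleA ((-1) ^ (tau m r * par x)) (mv x \<odot> D r g)"
    if "x \<in> MM" for x
    using assms(3) True_all
  proof (induction g rule: AA_induct[where Q="\<lambda>_. True"])
    case (step c y f)
    then show ?case using that assms(1)
      by (simp add: mul_add_right mul_scale_right D_add D_scale D_mul_mv scaleA_add mult.commute algebra_simps)
  qed simp_all
  show ?thesis
    using assms(2) assms(4)[unfolded homog_iff]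
  proof (induction f rule: AA_induct[where Q="\<lambda>X. par X = a"])
    case (step c y f)
    then show ?case using 1[of y]
      by (simp add: mul_add_left mul_scale_left D_add D_scale scaleA_add mult.commute algebra_simps)
  qed simp_all
qed

lemma card_less_insert:
  assumes "finite u" "k \<notin> u"
  shows "card {q \<in> insert k u. q < (l::nat)} = card {q \<in> u. q < l} + (if k < l then 1 else 0)"
proof -
  have "{q \<in> insert k u. q < l} = (if k < l then insert k {q \<in> u. q < l} else {q \<in> u. q < l})" by auto
  then show ?thesis using assms by simp
qed

lemma D_comm:
  assumes "r \<in> Y m n" "s \<in> Y m n" "f \<in> AA"
  shows "D r (D s f) = scaleA ((-1) ^ (tau m r * tau m s)) (D s (D r f))"
proof
  fix X :: mon
  obtain \<alpha> u where X: "X = (\<alpha>, u)" by (cases X)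
  have f0: "f Z = 0" if "Z \<notin> MM" for Z using assms(3) that unfolding AA_iff by blast
  show "D r (D s f) X = scaleA ((-1) ^ (tau m r * tau m s)) (D s (D r f)) X"
  proof (cases "X \<in> MM")
    case False
    then show ?thesis by (simp add: Dop_def scaleA_def)
  next
    case M: True
    have fin: "finite u" using M X finite_snd by fastforce
    have up: "(\<alpha>(i := Suc (\<alpha> i)), v) \<in> MM" if "((\<alpha>(i := Suc (\<alpha> i)))(j := Suc ((\<alpha>(i := Suc (\<alpha> i))) j)), v) \<in> MM"
      for i j v
      unfolding MM_iff
    proof (intro conjI allI ballI impI)
      fix l assume "l \<in> Y0 m"
      moreover have "(\<alpha>(i := Suc (\<alpha> i))) l \<le> ((\<alpha>(i := Suc (\<alpha> i)))(j := Suc ((\<alpha>(i := Suc (\<alpha> i))) j))) l" by auto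
      ultimately show "(\<alpha>(i := Suc (\<alpha> i))) l < p ^ t l" using that unfolding MM_iff
        using order_le_less_trans by blast
    qed (use that in \<open>auto simp: MM_iff split: if_splits\<close>)
    have ins: "(\<beta>, insert k v) \<in> MM \<longleftrightarrow> (\<beta>, v) \<in> MM" if "k \<in> Y1 m n" for \<beta> k v
      using that by (auto simp: MM_iff)
    show ?thesis
    proof (rule Y_cases[OF assms(1)]; rule Y_cases[OF assms(2)])
      assume r: "r \<in> Y0 m" and s: "s \<in> Y0 m"
      show ?thesis
      proof (cases "r = s")
        case True then show ?thesis using r by simp
      next
        case False
        then have "\<alpha>(r := Suc (\<alpha> r), s := Suc (\<alpha> s)) = \<alpha>(s := Suc (\<alpha> s), r := Suc (\<alpha> r))" by auto
        then show ?thesis using M r s False up[of r s u] up[of s r u] f0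
          by (auto simp: Dop_def X)
      qed
    next
      assume r: "r \<in> Y0 m" and s: "s \<in> Y1 m n"
      then show ?thesis using M Y0_Y1 ins f0 by (auto simp: Dop_def X)
    next
      assume r: "r \<in> Y1 m n" and s: "s \<in> Y0 m"
      then show ?thesis using M Y0_Y1 ins f0 by (auto simp: Dop_def X)
    next
      assume r: "r \<in> Y1 m n" and s: "s \<in> Y1 m n"
      show ?thesis
      proof (cases "r = s \<or> r \<in> u \<or> s \<in> u")
        case True then show ?thesis using M r s Y0_Y1 by (auto simp: Dop_def X scaleA_def)
      next
        case False
        then have "insert r (insert s u) = insert s (insert r u)" by auto
        then show ?thesis using M r s Y0_Y1 False ins fin
          by (cases "r < s") (auto simp: Dop_def X scaleA_def card_less_insert[unfolded insert_iff])
      qed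
    qed
  qed
qed

lemma tau_less: "tau m r < 2"
  by (simp add: tau_def)

lemma homog_zero [simp]: "homog b 0"
  by (simp add: homog_iff papply)

lemma homog_add: "homog b f \<Longrightarrow> homog b g \<Longrightarrow> homog b (f + g)"
  unfolding homog_iff papply by (metis add_0)

lemma homog_scale: "homog b f \<Longrightarrow> homog b (scaleA c f)"
  unfolding homog_iff scaleA_def by auto

lemma homog_diff: "homog b f \<Longrightarrow> homog b g \<Longrightarrow> homog b (f - g)"
  using homog_add[of b f "scaleA (-1) g"] homog_scale[of b g "-1"] by simp

lemma homog_sum: "(\<And>i. i \<in> I \<Longrightarrow> homog b (f i)) \<Longrightarrow> homog b (\<Sum>i\<in>I. f i)"
  by (induction I rule: infinite_finite_induct) (simp_all add: homog_add)

lemma homog_mv [simp]: "homog b (mv X) \<longleftrightarrow> par X = b"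
  by (simp add: homog_iff monvec_def)

lemma homog_D:
  assumes "r \<in> Y m n" "homog a f" "a < 2" "b = (a + tau m r) mod 2"
  shows "homog b (D r f)"
  unfolding homog_iff
proof (intro allI impI)
  fix X assume X: "D r f X \<noteq> 0"
  then have M: "X \<in> MM" by (auto simp: Dop_def split: if_splits)
  then have fin: "finite (snd X)" by (rule finite_snd)
  show "par X = b"
    using assms(1)
  proof (rule Y_cases)
    assume r: "r \<in> Y0 m"
    then have "f ((fst X)(r := fst X r + 1), snd X) \<noteq> 0" using X M by (simp add: Dop_def)
    then have "par ((fst X)(r := fst X r + 1), snd X) = a" using assms(2)[unfolded homog_iff] by blast
    moreover have "b = a" using assms(3,4) r by simp
    ultimately show ?thesis by (simp add: par_def)
  next
    assume r: "r \<in> Y1 m n"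
    have "D r f X = (if r \<notin> snd X then (-1) ^ card {l \<in> snd X. l < r} * f (fst X, insert r (snd X)) else 0)"
      using r M Y0_Y1(2)[OF r] by (simp add: Dop_def)
    then have *: "f (fst X, insert r (snd X)) \<noteq> 0" "r \<notin> snd X"
      using X by (metis mult_zero_right)+
    then have "par (fst X, insert r (snd X)) = a" using assms(2)[unfolded homog_iff] by blast
    then have "Suc (card (snd X)) mod 2 = a" using * fin by (simp add: par_def)
    moreover have "b = (a + 1) mod 2" using assms(4) r by simp
    ultimately have "b = (Suc (card (snd X)) mod 2 + 1) mod 2" by simp
    also have "\<dots> = card (snd X) mod 2" by (simp add: mod_Suc)
    finally show ?thesis by (simp add: par_def)
  qed
qed

lemma homog_mul:
  assumes "homog a f" "homog b g" "c = (a + b) mod 2"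
  shows "homog c (f \<odot> g)"
  unfolding homog_iff
proof (intro allI impI)
  fix X assume X: "(f \<odot> g) X \<noteq> 0"
  then have "(\<Sum>(a, b)\<in>MM \<times> MM.
        if (\<lambda>i. fst a i + fst b i) = fst X \<and> snd a \<inter> snd b = {} \<and> snd a \<union> snd b = snd X
        then mcoef m a b * f a * g b else 0) \<noteq> 0"
    by (auto simp: amul_def split: if_splits)
  then obtain z where "z \<in> MM \<times> MM" "(case z of (a, b) \<Rightarrow>
      if (\<lambda>i. fst a i + fst b i) = fst X \<and> snd a \<inter> snd b = {} \<and> snd a \<union> snd b = snd X
        then mcoef m a b * f a * g b else 0) \<noteq> 0"
    by (rule sum.not_neutral_contains_not_neutral)
  then obtain x y where xy: "x \<in> MM" "y \<in> MM" "snd x \<inter> snd y = {}" "snd x \<union> snd y = snd X" "f x \<noteq> 0" "g y \<noteq> 0"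
    by (cases z) (auto split: if_splits)
  have "card (snd X) = card (snd x) + card (snd y)"
    using xy finite_snd by (metis card_Un_disjoint)
  moreover have "par x = a" "par y = b" using xy(5,6) assms(1,2) unfolding homog_iff by blast+
  ultimately show "par X = c" unfolding assms(3) par_def by (metis mod_add_eq)
qed

section \<open>Even vector fields\<close>

abbreviation WW :: "'a wvec set" where "WW \<equiv> Weven p m n t"

lemma WW_iff: "E \<in> WW \<longleftrightarrow> (\<forall>r. E r \<in> AA \<and> homog (tau m r) (E r)) \<and> (\<forall>r. r \<notin> Y m n \<longrightarrow> E r = 0)"
  by (auto simp: Weven_def Wset_def)

lemma WW_D: "E \<in> WW \<Longrightarrow> E r \<in> AA" "E \<in> WW \<Longrightarrow> homog (tau m r) (E r)" "E \<in> WW \<Longrightarrow> r \<notin> Y m n \<Longrightarrow> E r = 0"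
  by (auto simp: WW_iff)

lemma scaleW_alt: "scaleW c E r = scaleA c (E r)"
  by (simp add: scaleW_def scaleA_def)

lemma WW_closed [simp]:
  "0 \<in> WW" "E \<in> WW \<Longrightarrow> F \<in> WW \<Longrightarrow> E + F \<in> WW" "E \<in> WW \<Longrightarrow> F \<in> WW \<Longrightarrow> E - F \<in> WW"
  "E \<in> WW \<Longrightarrow> scaleW c E \<in> WW"
  by (auto simp: WW_iff papply scaleW_alt homog_add homog_diff homog_scale)

text \<open>The differential operator of the field. For even fields it satisfies the Leibniz rule
  without signs, and the bracket becomes an ordinary commutator of operators.\<close>

definition act :: "'a wvec \<Rightarrow> 'a alg \<Rightarrow> 'a alg" where
  "act E f = (\<Sum>r\<in>Y m n. E r \<odot> D r f)"

definition br :: "'a wvec \<Rightarrow> 'a wvec \<Rightarrow> 'a wvec" where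
  "br E F = (\<lambda>s. act E (F s) - act F (E s))"

lemma act_closed [simp]: "act E f \<in> AA"
  unfolding act_def by (intro AA_sum) simp

lemma act_add: "act E (f + g) = act E f + act E g"
  and act_scale: "act E (scaleA c f) = scaleA c (act E f)"
  and act_0 [simp]: "act E 0 = 0"
  and act_diff: "act E (f - g) = act E f - act E g"
  by (simp_all add: act_def D_add D_scale D_diff mul_add_right mul_diff_right mul_scale_right sum.distrib
      scaleA_sum sum_subtractf)

lemma act_sum: "act E (\<Sum>i\<in>I. f i) = (\<Sum>i\<in>I. act E (f i))"
  by (induction I rule: infinite_finite_induct) (simp_all add: act_add)

lemma act_add_left: "act (E + F) f = act E f + act F f"
  and act_scale_left: "act (scaleW c E) f = scaleA c (act E f)"
  and act_0_left [simp]: "act 0 f = 0"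
  and act_diff_left: "act (E - F) f = act E f - act F f"
  by (simp_all add: act_def papply scaleW_alt mul_add_left mul_diff_left mul_scale_left sum.distrib
      scaleA_sum sum_subtractf)

lemma homog_act:
  assumes "E \<in> WW" "homog b f" "b < 2"
  shows "homog b (act E f)"
  unfolding act_def
proof (rule homog_sum)
  fix r assume r: "r \<in> Y m n"
  have "homog ((b + tau m r) mod 2) (D r f)" using homog_D r assms by blast
  moreover have "b = (tau m r + (b + tau m r) mod 2) mod 2" using assms(3) by (auto simp: tau_def less_2_cases_iff)
  ultimately show "homog b (E r \<odot> D r f)" using homog_mul WW_D(2)[OF assms(1)] by blast
qed

lemma act_mul:
  assumes E: "E \<in> WW" and f: "f \<in> AA" "homog a f" and g: "g \<in> AA"
  shows "act E (f \<odot> g) = act E f \<odot> g + f \<odot> act E g"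
proof -
  have "E r \<odot> D r (f \<odot> g) = (E r \<odot> D r f) \<odot> g + f \<odot> (E r \<odot> D r g)" if r: "r \<in> Y m n" for r
  proof -
    have "E r \<odot> (f \<odot> D r g) = scaleA ((-1) ^ (tau m r * a)) (f \<odot> (E r \<odot> D r g))"
      using mul_comm[OF f(1) WW_D(1)[OF E, of r] f(2) WW_D(2)[OF E]] f g WW_D(1)[OF E, of r]
        mul_assoc[of "E r" f "D r g"] mul_assoc[of f "E r" "D r g"]
      by (simp add: mul_scale_left mult.commute)
    then have "E r \<odot> D r (f \<odot> g) = E r \<odot> (D r f \<odot> g) +
        scaleA ((-1) ^ (tau m r * a) * (-1) ^ (tau m r * a)) (f \<odot> (E r \<odot> D r g))"
      using D_mul[OF r f(1) g f(2)] by (simp add: mul_add_right mul_scale_right)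
    also have "(-1) ^ (tau m r * a) * (-1) ^ (tau m r * a) = (1::'a)" by (simp flip: power_add)
    finally show ?thesis using mul_assoc f g WW_D(1)[OF E] by simp
  qed
  then show ?thesis unfolding act_def by (simp add: sum.distrib mul_sum_left mul_sum_right)
qed

lemma br_closed [simp]: "E \<in> WW \<Longrightarrow> F \<in> WW \<Longrightarrow> br E F \<in> WW"
proof -
  assume E: "E \<in> WW" and F: "F \<in> WW"
  have "br E F r \<in> AA \<and> homog (tau m r) (br E F r)" for r
    unfolding br_def
    by (simp add: homog_diff homog_act[OF E WW_D(2)[OF F] tau_less] homog_act[OF F WW_D(2)[OF E] tau_less])
  moreover have "br E F r = 0" if "r \<notin> Y m n" for r
    unfolding br_def using WW_D(3)[OF E that] WW_D(3)[OF F that] by simp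
  ultimately show ?thesis unfolding WW_iff by blast
qed

text \<open>The second-order terms cancel: exchanging the coefficients E_r and F_s and exchanging
  D_r and D_s cost the same sign, because the coefficient of D_r in an even field has parity
  \<open>tau m r\<close>.\<close>

lemma act_br:
  assumes E: "E \<in> WW" and F: "F \<in> WW" and f: "f \<in> AA"
  shows "act (br E F) f = act E (act F f) - act F (act E f)"
proof -
  have *: "act E (act F f) = (\<Sum>s\<in>Y m n. act E (F s) \<odot> D s f) + (\<Sum>s\<in>Y m n. \<Sum>r\<in>Y m n. F s \<odot> (E r \<odot> D r (D s f)))"
    if E: "E \<in> WW" and F: "F \<in> WW" for E F
  proof -
    have "act E (act F f) = (\<Sum>s\<in>Y m n. act E (F s \<odot> D s f))"
      unfolding act_def[of F f] by (rule act_sum)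
    also have "\<dots> = (\<Sum>s\<in>Y m n. act E (F s) \<odot> D s f + F s \<odot> act E (D s f))"
      by (intro sum.cong refl act_mul[OF E WW_D(1)[OF F] WW_D(2)[OF F]] AA_closed(7))
    finally show ?thesis by (simp add: sum.distrib act_def[of E "D _ f"] mul_sum_right)
  qed
  have "F s \<odot> (E r \<odot> D r (D s f)) = E r \<odot> (F s \<odot> D s (D r f))" if "r \<in> Y m n" "s \<in> Y m n" for r s
  proof -
    have "F s \<odot> E r = scaleA ((-1) ^ (tau m r * tau m s)) (E r \<odot> F s)"
      by (rule mul_comm[OF WW_D(1)[OF E] WW_D(1)[OF F] WW_D(2)[OF E] WW_D(2)[OF F]])
    then have "F s \<odot> (E r \<odot> D r (D s f)) = scaleA ((-1) ^ (tau m r * tau m s)) (E r \<odot> (F s \<odot> D r (D s f)))"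
      using mul_assoc[of "F s" "E r" "D r (D s f)"] mul_assoc[of "E r" "F s" "D r (D s f)"] WW_D(1)[OF E] WW_D(1)[OF F]
      by (simp add: mul_scale_left)
    also have "\<dots> = scaleA ((-1) ^ (tau m r * tau m s) * (-1) ^ (tau m r * tau m s)) (E r \<odot> (F s \<odot> D s (D r f)))"
      using D_comm[OF that f] by (simp add: mul_scale_right)
    finally show ?thesis by (simp flip: power_add)
  qed
  then have "(\<Sum>s\<in>Y m n. \<Sum>r\<in>Y m n. F s \<odot> (E r \<odot> D r (D s f))) = (\<Sum>s\<in>Y m n. \<Sum>r\<in>Y m n. E r \<odot> (F s \<odot> D s (D r f)))"
    by (intro sum.cong refl)
  also have "\<dots> = (\<Sum>s\<in>Y m n. \<Sum>r\<in>Y m n. E s \<odot> (F r \<odot> D r (D s f)))"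
    by (rule sum.swap)
  finally have "act E (act F f) - act F (act E f) = (\<Sum>s\<in>Y m n. act E (F s) \<odot> D s f) - (\<Sum>s\<in>Y m n. act F (E s) \<odot> D s f)"
    unfolding *[OF E F] *[OF F E] by simp
  then show ?thesis
    unfolding br_def by (simp add: act_def[of "\<lambda>s. act E (F s) - act F (E s)"] mul_diff_left sum_subtractf)
qed

lemma br_add_left: "br (E + F) G = br E G + br F G"
  and br_add_right: "br E (F + G) = br E F + br E G"
  and br_diff_left: "br (E - F) G = br E G - br F G"
  and br_diff_right: "br E (F - G) = br E F - br E G"
  and br_scale_left: "br (scaleW c E) G = scaleW c (br E G)"
  and br_scale_right: "br E (scaleW c G) = scaleW c (br E G)"
  and br_0_left [simp]: "br 0 E = 0"
  and br_0_right [simp]: "br E 0 = 0"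
  and br_anti: "br E F = - br F E"
  by (rule ext, simp add: br_def papply act_add act_add_left act_diff act_diff_left act_scale act_scale_left
      scaleW_alt scaleA_diff)+

lemma jacobi:
  assumes "E \<in> WW" "F \<in> WW" "G \<in> WW"
  shows "br E (br F G) = br (br E F) G + br F (br E G)"
proof
  fix s
  have "br E (br F G) s = act E (act F (G s)) - act E (act G (F s)) - (act F (act G (E s)) - act G (act F (E s)))"
    using assms act_br[of F G "E s"] WW_D by (simp add: br_def[of E "br F G"] br_def[of F G, THEN fun_cong] act_diff)
  moreover have "br (br E F) G s = act E (act F (G s)) - act F (act E (G s)) - (act G (act E (F s)) - act G (act F (E s)))"
    using assms act_br[of E F "G s"] WW_D by (simp add: br_def[of "br E F" G] br_def[of E F, THEN fun_cong] act_diff)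
  moreover have "br F (br E G) s = act F (act E (G s)) - act F (act G (E s)) - (act E (act G (F s)) - act G (act E (F s)))"
    using assms act_br[of E G "F s"] WW_D by (simp add: br_def[of F "br E G"] br_def[of E G, THEN fun_cong] act_diff)
  ultimately show "br E (br F G) s = (br (br E F) G + br F (br E G)) s"
    by (simp add: papply)
qed

lemma part_WW: "E \<in> WW \<Longrightarrow> part b (E r) = (if b = tau m r then E r else 0)"
proof -
  assume "E \<in> WW"
  then have "homog (tau m r) (E r)" by (rule WW_D)
  then show ?thesis unfolding homog_iff by (simp add: Defs.part_def fun_eq_iff papply) metis
qed

text \<open>For even fields only the part of the r-th coefficient of parity \<open>tau m r\<close>
  survives, and then both factors in the exponent of the sign are 0.\<close>

lemma Wbr_eq:
  assumes E: "E \<in> WW" and F: "F \<in> WW"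
  shows "Wbr p m n t E F = br E F"
proof
  fix s
  have two: "{..<2::nat} = {0, 1}" by auto
  have tau01: "tau m r = 0 \<or> tau m r = 1" for r by (simp add: tau_def)
  show "Wbr p m n t E F s = br E F s"
  proof (cases "s \<in> Y m n")
    case True
    have 1: "(\<Sum>a<2. \<Sum>b<2. (part a (E r) \<odot> D r (part b (F s))) X) = (E r \<odot> D r (F s)) X" for r X
      by (rule disjE[OF tau01[of r]]; rule disjE[OF tau01[of s]])
        (simp_all add: two part_WW[OF E] part_WW[OF F] papply)
    have 2: "(\<Sum>a<2. \<Sum>b<2. (- 1) ^ ((a + tau m s) mod 2 * ((b + tau m q) mod 2)) *
        (part b (F q) \<odot> D q (part a (E s))) X) = (F q \<odot> D q (E s)) X" for q X
      by (rule disjE[OF tau01[of q]]; rule disjE[OF tau01[of s]])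
        (simp_all add: two part_WW[OF E] part_WW[OF F] papply)
    show ?thesis
    proof
      fix X
      show "Wbr p m n t E F s X = br E F s X"
        using True by (simp only: Wbr_def if_True 1 2 br_def act_def papply sum_fun_apply)
    qed
  next
    case False
    then show ?thesis using E F by (simp add: Wbr_def br_def WW_D)
  qed
qed

end

definition fld :: "nat \<Rightarrow> 'a::field alg \<Rightarrow> 'a wvec" where
  "fld s f = (\<lambda>q. if q = s then f else 0)"

lemma fld_simps: "fld s 0 = 0" "fld s (f + g) = fld s f + fld s g" "fld s (f - g) = fld s f - fld s g"
  "fld s (scaleA c f) = scaleW c (fld s f)" "fld s (- f) = - fld s f"
  by (rule ext, simp add: fld_def papply scaleW_def scaleA_def fun_eq_iff)+

definition ex :: "nat \<Rightarrow> nat \<Rightarrow> (nat \<Rightarrow> nat)" where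
  "ex i s = (\<lambda>_. 0)(i := s)"

lemma ex_apply [simp]: "ex i s j = (if j = i then s else 0)"
  by (simp add: ex_def)

context special_lie
begin

section \<open>Monomial vector fields\<close>

definition bd :: "(nat \<Rightarrow> nat) \<Rightarrow> bool" where "bd a \<longleftrightarrow> (a, {}) \<in> MM"

lemma bd_iff: "bd a \<longleftrightarrow> (\<forall>i. i \<notin> Y0 m \<longrightarrow> a i = 0) \<and> (\<forall>i\<in>Y0 m. a i < p ^ t i)"
  by (simp add: bd_def MM_iff)

lemma bd_MM: "(a, u) \<in> MM \<longleftrightarrow> bd a \<and> u \<subseteq> Y1 m n"
  by (auto simp: bd_iff MM_iff)

lemma p_pos [simp]: "p > 0"
  using p3 by simp

lemma bd_upd: "bd a \<Longrightarrow> i \<in> Y0 m \<Longrightarrow> s < p ^ t i \<Longrightarrow> bd (a(i := s))"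
  by (auto simp: bd_iff)

lemma bd_upd0: "bd a \<Longrightarrow> bd (a(i := 0))"
  by (auto simp: bd_iff)

lemma bd_zero [simp]: "bd (\<lambda>_. 0)"
  using p3 by (auto simp: bd_iff)

lemma bd_ex: "i \<in> Y0 m \<Longrightarrow> s < p ^ t i \<Longrightarrow> bd (ex i s)"
  unfolding ex_def by (rule bd_upd) simp_all

lemma p_pow_gt1: "i \<in> Y0 m \<Longrightarrow> Suc 0 < p ^ t i" "i \<in> Y0 m \<Longrightarrow> 2 < p ^ t i" "i \<in> Y0 m \<Longrightarrow> 3 < p ^ t i"
  using p_pow_gt[of i] by auto

definition xi :: "nat set \<Rightarrow> 'a alg" where "xi u = mv (\<lambda>_. 0, u)"

text \<open>The homogeneous elements of the exterior algebra in the odd variables. Describing them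
  as constants of the even derivations, rather than by their support, gives closure under products
  and odd derivatives at once.\<close>

definition lam :: "nat \<Rightarrow> 'a alg \<Rightarrow> bool" where
  "lam c \<omega> \<longleftrightarrow> \<omega> \<in> AA \<and> (\<forall>i\<in>Y0 m. D i \<omega> = 0) \<and> homog c \<omega>"

lemma lamD: "lam c \<omega> \<Longrightarrow> \<omega> \<in> AA" "lam c \<omega> \<Longrightarrow> i \<in> Y0 m \<Longrightarrow> D i \<omega> = 0" "lam c \<omega> \<Longrightarrow> homog c \<omega>"
  by (auto simp: lam_def)

lemma xi_AA: "u \<subseteq> Y1 m n \<Longrightarrow> xi u \<in> AA"
  by (simp add: xi_def bd_MM)

lemma lam_xi: "u \<subseteq> Y1 m n \<Longrightarrow> c = card u mod 2 \<Longrightarrow> lam c (xi u)"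
  unfolding lam_def by (simp add: xi_AA) (simp add: xi_def D_mv0 bd_MM par_def)

lemma lam_one: "lam 0 (xi {})"
  by (rule lam_xi) auto

lemma Y0_sub: "i \<in> Y0 m \<Longrightarrow> i \<in> Y m n" and Y1_sub: "i \<in> Y1 m n \<Longrightarrow> i \<in> Y m n"
  by (auto simp: Y_def)

lemma lam_mul:
  assumes "lam a \<omega>" "lam b \<omega>'" "c = (a + b) mod 2"
  shows "lam c (\<omega> \<odot> \<omega>')"
  using assms homog_mul[of a \<omega> b \<omega>' c] D_mul[OF Y0_sub, of _ \<omega> \<omega>' a]
  by (auto simp: lam_def)

lemma lam_D:
  assumes "k \<in> Y1 m n" "lam a \<omega>" "a < 2" "c = (a + 1) mod 2"
  shows "lam c (D k \<omega>)"
  using assms homog_D[OF Y1_sub[OF assms(1)], of a \<omega> c] D_comm[OF Y0_sub Y1_sub[OF assms(1)], of _ \<omega>]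
  by (auto simp: lam_def)

text \<open>\<open>mv\<close> is a nonzero function even at an inadmissible exponent, but products
  discard it. Therefore \<open>XO a\<close> is 0 outside the range, and the product formulas below
  need no case distinction.\<close>

lemma mul_mv_out: "x \<notin> MM \<Longrightarrow> mv x \<odot> f = 0"
proof -
  assume x: "x \<notin> MM"
  have "(mv x \<odot> f) X = 0" for X
    unfolding amul_def using x by (auto simp: monvec_def intro!: sum.neutral)
  then show ?thesis by (simp add: fun_eq_iff papply)
qed

lemma xi_one_left [simp]: "f \<in> AA \<Longrightarrow> xi {} \<odot> f = f"
proof -
  assume "f \<in> AA"
  then show ?thesis using True_all
  proof (induction f rule: AA_induct[where Q="\<lambda>_. True"])
    case (step c y f)
    have "xi {} \<odot> mv y = mv y"
      using step by (cases y) (simp add: xi_def mul_mv okm_def mplus_def mcoef_def bd_MM)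
    then show ?case using step by (simp add: mul_add_right mul_scale_right)
  qed simp
qed

lemma xi_one_right [simp]: "f \<in> AA \<Longrightarrow> f \<odot> xi {} = f"
proof -
  assume "f \<in> AA"
  then show ?thesis using True_all
  proof (induction f rule: AA_induct[where Q="\<lambda>_. True"])
    case (step c y f)
    have "mv y \<odot> xi {} = mv y"
      using step by (cases y) (simp add: xi_def mul_mv okm_def mplus_def mcoef_def bd_MM)
    then show ?case using step by (simp add: mul_add_left mul_scale_left)
  qed simp
qed

lemma xi_mult:
  assumes "u \<subseteq> Y1 m n" "v \<subseteq> Y1 m n" "u \<inter> v = {}"
  shows "xi u \<odot> xi v = scaleA ((-1) ^ inversions u v) (xi (u \<union> v))"
  using assms by (simp add: xi_def mul_mv okm_def mplus_def mcoef_inversions bd_MM)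

lemma D_xi: "k \<in> Y1 m n \<Longrightarrow> u \<subseteq> Y1 m n \<Longrightarrow> k \<notin> u \<Longrightarrow> D k (xi u) = 0"
  by (simp add: xi_def D_mv1 bd_MM)

lemma D_xi_in: "k \<in> Y1 m n \<Longrightarrow> u \<subseteq> Y1 m n \<Longrightarrow> k \<in> u \<Longrightarrow>
    D k (xi u) = scaleA ((-1) ^ card {l \<in> u. l < k}) (xi (u - {k}))"
  by (simp add: xi_def D_mv1 bd_MM)

lemma D_xi_single: "k \<in> Y1 m n \<Longrightarrow> D k (xi {k}) = xi {}"
proof -
  assume k: "k \<in> Y1 m n"
  then have "D k (xi {k}) = scaleA ((-1) ^ card {l \<in> {k}. l < k}) (xi ({k} - {k}))"
    by (intro D_xi_in) auto
  moreover have "{l \<in> {k}. l < k} = {}" by auto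
  ultimately show ?thesis by (simp only: card.empty) simp
qed

definition XO :: "(nat \<Rightarrow> nat) \<Rightarrow> 'a alg \<Rightarrow> 'a alg" where "XO a \<omega> = mv (a, {}) \<odot> \<omega>"

lemma XO_AA [simp]: "XO a \<omega> \<in> AA"
  by (simp add: XO_def)

lemma homog_XO: "homog c \<omega> \<Longrightarrow> c < 2 \<Longrightarrow> homog c (XO a \<omega>)"
  unfolding XO_def by (rule homog_mul[of 0 _ c]) (simp_all add: par_def)

lemma XO_xi: "bd a \<Longrightarrow> u \<subseteq> Y1 m n \<Longrightarrow> XO a (xi u) = mv (a, u)"
  by (simp add: XO_def xi_def mul_mv okm_def mplus_def mcoef_def bd_MM)

lemma XO_zero: "\<omega> \<in> AA \<Longrightarrow> XO (\<lambda>_. 0) \<omega> = \<omega>"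
  using xi_one_left[of \<omega>] by (simp add: XO_def xi_def)

lemma XO_scale: "XO a (scaleA c \<omega>) = scaleA c (XO a \<omega>)"
  by (simp add: XO_def mul_scale_right)

lemma XO_0 [simp]: "XO a 0 = 0"
  by (simp add: XO_def)

lemma XO_minus: "XO a (- \<omega>) = - XO a \<omega>"
  by (simp add: XO_def mul_minus_right)

lemma mx_comm:
  assumes "bd a" "lam c \<omega>"
  shows "\<omega> \<odot> mv (a, {}) = mv (a, {}) \<odot> \<omega>"
proof -
  have "mv (a, {}) \<in> AA" "homog 0 (mv (a, {}))" using assms by (simp_all add: bd_def par_def)
  from mul_comm[OF this(1) lamD(1)[OF assms(2)] this(2) lamD(3)[OF assms(2)]] show ?thesis by simp
qed

text \<open>Only \<open>i\<close> may carry exponents in both factors, so the product of binomial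
  coefficients collapses to one factor; moving \<omega> past the even monomial costs no
  sign.\<close>

lemma XM:
  assumes "bd a" "bd b" "lam c \<omega>" "lam d \<omega>'" "i \<in> Y0 m"
    and "\<And>j. j \<in> Y0 m \<Longrightarrow> j \<noteq> i \<Longrightarrow> a j = 0 \<or> b j = 0"
  shows "XO a \<omega> \<odot> XO b \<omega>' = scaleA (of_nat (a i + b i choose a i)) (XO (\<lambda>j. a j + b j) (\<omega> \<odot> \<omega>'))"
proof -
  have "(\<Prod>j\<in>Y0 m - {i}. a j + b j choose a j) = 1"
  proof (rule prod.neutral, intro ballI)
    fix j assume "j \<in> Y0 m - {i}"
    then have "a j = 0 \<or> b j = 0" using assms(6)[of j] by simp
    then show "a j + b j choose a j = 1" by auto
  qed
  moreover have "inversions {} {} = 0" by (simp add: inversions_def)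
  moreover have "mv (a, {}) \<odot> mv (b, {}) = (if (\<lambda>j. a j + b j, {} \<union> {}) \<in> MM
    then scaleA (of_nat (a i + b i choose a i) *
      (of_nat (\<Prod>j\<in>Y0 m - {i}. a j + b j choose a j) * (-1) ^ inversions {} {}))
      (mv (\<lambda>j. a j + b j, {} \<union> {})) else 0)"
    by (rule mul_mv_split[OF assms(5)]) (use assms(1,2) in \<open>simp_all add: bd_def\<close>)
  ultimately have e: "mv (a, {}) \<odot> mv (b, {}) = (if (\<lambda>j. a j + b j, {}) \<in> MM
    then scaleA (of_nat (a i + b i choose a i)) (mv (\<lambda>j. a j + b j, {})) else 0)"
    by simp
  have AA: "mv (a, {}) \<in> AA" "mv (b, {}) \<in> AA" "\<omega> \<in> AA" "\<omega>' \<in> AA"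
    using assms(1-4) by (simp_all add: bd_def lamD)
  have "XO a \<omega> \<odot> XO b \<omega>' = mv (a, {}) \<odot> ((\<omega> \<odot> mv (b, {})) \<odot> \<omega>')"
    unfolding XO_def using AA by (simp only: mul_assoc AA_closed)
  also have "\<dots> = (mv (a, {}) \<odot> mv (b, {})) \<odot> (\<omega> \<odot> \<omega>')"
    unfolding mx_comm[OF assms(2,3)] using AA by (simp only: mul_assoc AA_closed)
  also have "\<dots> = scaleA (of_nat (a i + b i choose a i)) (XO (\<lambda>j. a j + b j) (\<omega> \<odot> \<omega>'))"
    unfolding e XO_def using mul_mv_out[of "(\<lambda>j. a j + b j, {})"] by (auto simp: mul_scale_left)
  finally show ?thesis .
qed

lemma D_XO0:
  assumes "bd a" "lam c \<omega>" "i \<in> Y0 m"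
  shows "D i (XO a \<omega>) = (if a i = 0 then 0 else XO (a(i := a i - 1)) \<omega>)"
  unfolding XO_def using assms D_mul[OF Y0_sub[OF assms(3)], of "mv (a, {})" \<omega> 0]
  by (simp add: bd_def lamD par_def D_mv0)

lemma D_XO1:
  assumes "bd a" "\<omega> \<in> AA" "k \<in> Y1 m n"
  shows "D k (XO a \<omega>) = XO a (D k \<omega>)"
  unfolding XO_def using assms D_mul[OF Y1_sub[OF assms(3)], of "mv (a, {})" \<omega> 0]
  by (simp add: bd_def par_def D_mv1)

lemma XD0:
  assumes "bd b" "lam d \<omega>'" "i \<in> Y0 m" "b i = 0"
  shows "XO a \<omega> \<odot> D i (XO b \<omega>') = 0"
  using assms by (simp add: D_XO0)

text \<open>The resulting exponent \<open>e\<close> is a parameter determined pointwise, so that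
  each application can name it in the form wanted there instead of rewriting function
  updates.\<close>

lemma XD1:
  assumes "bd a" "bd b" "lam c \<omega>" "lam d \<omega>'" "i \<in> Y0 m" "b i = Suc q"
    and "\<And>j. j \<in> Y0 m \<Longrightarrow> j \<noteq> i \<Longrightarrow> a j = 0 \<or> b j = 0"
    and "\<And>j. e j = (if j = i then a i + q else a j + b j)"
  shows "XO a \<omega> \<odot> D i (XO b \<omega>') = scaleA (of_nat (a i + q choose a i)) (XO e (\<omega> \<odot> \<omega>'))"
proof -
  have "bd (b(i := q))" using assms(2,5,6) by (auto simp: bd_iff dest!: bspec[of _ _ i])
  moreover have "(\<lambda>j. a j + (b(i := q)) j) = e" using assms(8) by (auto simp: fun_eq_iff)
  ultimately show ?thesis
    using XM[of a "b(i := q)" c \<omega> d \<omega>' i] assms by (simp add: D_XO0)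
qed

section \<open>Brackets of the monomial fields x^(a) \<omega> D_s\<close>

definition P :: "nat \<Rightarrow> (nat \<Rightarrow> nat) \<Rightarrow> 'a alg \<Rightarrow> 'a wvec" where "P s a \<omega> = fld s (XO a \<omega>)"

lemma fld_WW: "s \<in> Y m n \<Longrightarrow> f \<in> AA \<Longrightarrow> homog (tau m s) f \<Longrightarrow> fld s f \<in> WW"
  unfolding WW_iff fld_def by (simp add: papply)

lemma P_WW0: "i \<in> Y0 m \<Longrightarrow> lam 0 \<omega> \<Longrightarrow> P i a \<omega> \<in> WW"
  unfolding P_def by (rule fld_WW) (simp_all add: Y0_sub homog_XO lamD)

lemma P_WW1: "k \<in> Y1 m n \<Longrightarrow> lam 1 \<omega> \<Longrightarrow> P k a \<omega> \<in> WW"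
  unfolding P_def by (rule fld_WW) (simp_all add: Y1_sub homog_XO lamD)

lemma P_scale: "P s a (scaleA c \<omega>) = scaleW c (P s a \<omega>)"
  and P_0 [simp]: "P s a 0 = 0"
  and P_minus: "P s a (- \<omega>) = - P s a \<omega>"
  by (simp_all add: P_def fld_simps XO_scale XO_minus)

lemma act_fld: "r \<in> Y m n \<Longrightarrow> act (fld r f) g = f \<odot> D r g"
proof -
  assume r: "r \<in> Y m n"
  have "act (fld r f) g = (\<Sum>q\<in>Y m n. if q = r then f \<odot> D r g else 0)"
    unfolding act_def fld_def by (rule sum.cong) auto
  also have "\<dots> = f \<odot> D r g" using r by (subst sum.delta) auto
  finally show ?thesis .
qed

lemma br_fld:
  assumes "r \<in> Y m n" "s \<in> Y m n"
  shows "br (fld r f) (fld s g) = fld s (f \<odot> D r g) - fld r (g \<odot> D s f)"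
  by (rule ext) (simp add: br_def act_fld assms papply, simp add: fld_def)

lemma brP:
  assumes "r \<in> Y m n" "s \<in> Y m n"
  shows "br (P r a \<omega>) (P s b \<omega>') = fld s (XO a \<omega> \<odot> D r (XO b \<omega>')) - fld r (XO b \<omega>' \<odot> D s (XO a \<omega>))"
  unfolding P_def by (rule br_fld[OF assms])

lemma XD2:
  assumes "bd a" "bd b" "lam c \<omega>" "lam d \<omega>'" "d < 2" "k \<in> Y1 m n" "i \<in> Y0 m"
    and "\<And>j. j \<in> Y0 m \<Longrightarrow> j \<noteq> i \<Longrightarrow> a j = 0 \<or> b j = 0" and "\<And>j. e j = a j + b j"
  shows "XO a \<omega> \<odot> D k (XO b \<omega>') = scaleA (of_nat (a i + b i choose a i)) (XO e (\<omega> \<odot> D k \<omega>'))"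
proof -
  have "(\<lambda>j. a j + b j) = e" using assms(9) by auto
  then show ?thesis
    using XM[OF assms(1,2,3) lam_D[OF assms(6,4,5) refl] assms(7,8)] assms by (simp add: D_XO1 lamD)
qed

lemma XD20:
  assumes "bd b" "\<omega>' \<in> AA" "k \<in> Y1 m n" "D k \<omega>' = 0"
  shows "XO a \<omega> \<odot> D k (XO b \<omega>') = 0"
  using assms by (simp add: D_XO1)

end

lemma ex_same: "ex i s i = s"
  by simp

lemma ex_zero [simp]: "ex i 0 = (\<lambda>_. 0)"
  by (auto simp: ex_def)

context special_lie
begin

text \<open>The condition \<open>a j = 0\<close> removes the term in which D_j differentiates the
  first coefficient, so a single monomial field is left.\<close>

lemma brA:
  assumes "i \<in> Y0 m" "j \<in> Y0 m" "bd a" "bd b" "lam 0 \<omega>" "lam 0 \<omega>'" "a j = 0" "b i = Suc q"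
    and "\<And>l. l \<in> Y0 m \<Longrightarrow> l \<noteq> i \<Longrightarrow> a l = 0 \<or> b l = 0"
    and "\<And>l. e l = (if l = i then a i + q else a l + b l)"
  shows "br (P i a \<omega>) (P j b \<omega>') = scaleW (of_nat (a i + q choose a i)) (P j e (\<omega> \<odot> \<omega>'))"
proof -
  have "XO a \<omega> \<odot> D i (XO b \<omega>') = scaleA (of_nat (a i + q choose a i)) (XO e (\<omega> \<odot> \<omega>'))"
    by (rule XD1[OF assms(3-6,1,8)]) (fact assms(9,10))+
  then show ?thesis
    unfolding brP[OF Y0_sub[OF assms(1)] Y0_sub[OF assms(2)]] XD0[OF assms(3,5,2,7)]
    by (simp add: P_def fld_simps)
qed

lemma brB:
  assumes "i \<in> Y0 m" "k \<in> Y1 m n" "bd a" "bd b" "lam 0 \<omega>" "lam 1 \<omega>'" "D k \<omega> = 0" "b i = Suc q"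
    and "\<And>l. l \<in> Y0 m \<Longrightarrow> l \<noteq> i \<Longrightarrow> a l = 0 \<or> b l = 0"
    and "\<And>l. e l = (if l = i then a i + q else a l + b l)"
  shows "br (P i a \<omega>) (P k b \<omega>') = scaleW (of_nat (a i + q choose a i)) (P k e (\<omega> \<odot> \<omega>'))"
proof -
  have "XO a \<omega> \<odot> D i (XO b \<omega>') = scaleA (of_nat (a i + q choose a i)) (XO e (\<omega> \<odot> \<omega>'))"
    by (rule XD1[OF assms(3-6,1,8)]) (fact assms(9,10))+
  then show ?thesis
    unfolding brP[OF Y0_sub[OF assms(1)] Y1_sub[OF assms(2)]] XD20[OF assms(3) lamD(1)[OF assms(5)] assms(2,7)]
    by (simp add: P_def fld_simps)
qed

lemma brB_zero:
  assumes "i \<in> Y0 m" "k \<in> Y1 m n" "bd a" "bd b" "lam 0 \<omega>" "lam 1 \<omega>'" "D k \<omega> = 0" "b i = 0"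
  shows "br (P i a \<omega>) (P k b \<omega>') = 0" "br (P k b \<omega>') (P i a \<omega>) = 0"
proof -
  show "br (P i a \<omega>) (P k b \<omega>') = 0"
    unfolding brP[OF Y0_sub[OF assms(1)] Y1_sub[OF assms(2)]]
      XD0[OF assms(4,6,1,8)] XD20[OF assms(3) lamD(1)[OF assms(5)] assms(2,7)]
    by (simp add: fld_simps)
  then show "br (P k b \<omega>') (P i a \<omega>) = 0" using br_anti[of "P k b \<omega>'"] by simp
qed

lemma D_one [simp]: "k \<in> Y1 m n \<Longrightarrow> D k (xi {}) = 0"
  by (rule D_xi) auto

lemma lam_xi1: "k \<in> Y1 m n \<Longrightarrow> lam 1 (xi {k})"
  by (rule lam_xi) auto

lemma lam_xi2: "k \<in> Y1 m n \<Longrightarrow> l \<in> Y1 m n \<Longrightarrow> lam 0 (xi {k} \<odot> xi {l})"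
  by (rule lam_mul[OF lam_xi1 lam_xi1]) auto

lemma Y0_third: "\<exists>l\<in>Y0 m. l \<noteq> i \<and> l \<noteq> j"
proof -
  have "1 \<in> Y0 m" "2 \<in> Y0 m" "3 \<in> Y0 m" using m3 by (auto simp: Y0_def)
  moreover have "\<exists>l\<in>{1, 2, 3}. l \<noteq> i \<and> l \<noteq> j" by auto
  ultimately show ?thesis by auto
qed

lemma Y1_third: "\<exists>l\<in>Y1 m n. l \<noteq> i \<and> l \<noteq> j"
proof -
  have "m + 1 \<in> Y1 m n" "m + 2 \<in> Y1 m n" "m + 3 \<in> Y1 m n" using n3 by (auto simp: Y1_def)
  moreover have "\<exists>l\<in>{m + 1, m + 2, m + 3}. l \<noteq> i \<and> l \<noteq> j" by auto
  ultimately show ?thesis by auto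
qed

lemma scaleW_simps [simp]: "scaleW 1 E = (E :: 'a wvec)" "scaleW c (scaleW d E) = scaleW (c * d) (E :: 'a wvec)"
  "scaleW (-1) E = (- E :: 'a wvec)" "scaleW 0 E = (0 :: 'a wvec)" "scaleW c 0 = (0 :: 'a wvec)"
  by (auto simp: scaleW_def fun_eq_iff papply)

lemma scaleW_add: "scaleW c (E + F) = scaleW c E + (scaleW c F :: 'a wvec)"
  and scaleW_left_add: "scaleW (c + d) E = scaleW c E + (scaleW d E :: 'a wvec)"
  and scaleW_left_diff: "scaleW (c - d) E = scaleW c E - (scaleW d E :: 'a wvec)"
  and scaleW_diff: "scaleW c (E - F) = scaleW c E - (scaleW c F :: 'a wvec)"
  and scaleW_left_minus: "scaleW (- c) E = - (scaleW c E :: 'a wvec)"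
  by (rule ext, rule ext, simp add: scaleW_def papply algebra_simps)+

lemma of_nat_pred_pow: "i \<in> Y0 m \<Longrightarrow> q + s = p ^ t i \<Longrightarrow> of_nat q = (- of_nat s :: 'a)"
proof -
  assume i: "i \<in> Y0 m" and q: "q + s = p ^ t i"
  have "p dvd p ^ t i" using t_pos[OF i] by (simp add: dvd_power)
  then have "of_nat (q + s) = (0::'a)" using q of_nat_0_iff by metis
  then show ?thesis by (simp add: eq_neg_iff_add_eq_0)
qed

lemma two_nz: "(2::'a) \<noteq> 0"
proof -
  have "\<not> p dvd 2" using p3 by (auto dest: dvd_imp_le)
  then show ?thesis using of_nat_0_iff[of 2] by simp
qed

lemma of_nat_choose_two: "(2::'a) * of_nat (q choose 2) = of_nat q * (of_nat q - 1)"
proof (cases q)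
  case (Suc r)
  have "2 * (q choose 2) = q * (q - 1)"
    using choose_two[of q] by (simp add: Suc)
  then have "of_nat (2 * (q choose 2)) = (of_nat (q * (q - 1)) :: 'a)" by simp
  then show ?thesis by (simp add: Suc algebra_simps)
qed (simp add: binomial_eq_0)

text \<open>Here \<open>q\<close> is -1 in the field, and (-1)(-2) = 2. The companion value 3 comes
  from (-2)(-3) = 6. Both occur when a maximal exponent is reached by multiplying with
  x_i^(2).\<close>

lemma choose_two_pred: "i \<in> Y0 m \<Longrightarrow> Suc q = p ^ t i \<Longrightarrow> of_nat (q choose 2) = (1::'a)"
  using of_nat_choose_two[of q] of_nat_pred_pow[of i q 1] two_nz by (simp add: mult_eq_0_iff)

lemma choose_two_pred2: "i \<in> Y0 m \<Longrightarrow> Suc (Suc q) = p ^ t i \<Longrightarrow> of_nat (q choose 2) = (3::'a)"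
proof -
  assume "i \<in> Y0 m" "Suc (Suc q) = p ^ t i"
  then have "(2::'a) * of_nat (q choose 2) = 2 * 3"
    using of_nat_choose_two[of q] of_nat_pred_pow[of i q 2] by simp
  then show ?thesis using two_nz by (simp only: mult_cancel_left) simp
qed

end

section \<open>Subalgebras containing the generators\<close>

text \<open>\<open>K\<close> is kept abstract because it will be the kernel of a normalized
  derivation, which is closed under linear combinations and brackets and about which nothing else is
  known.\<close>

locale gen_subalg0 = special_lie p m n t ty for p m n :: nat and t :: "nat \<Rightarrow> nat" and ty :: "'a::field itself" +
  fixes K :: "'a wvec set" and R :: nat
  assumes R1: "R \<ge> 1" and K_0: "0 \<in> K" and K_add: "E \<in> K \<Longrightarrow> F \<in> K \<Longrightarrow> E + F \<in> K"
    and K_scale: "E \<in> K \<Longrightarrow> scaleW c E \<in> K" and K_br: "E \<in> K \<Longrightarrow> F \<in> K \<Longrightarrow> br E F \<in> K"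
    and g0: "i \<in> Y0 m \<Longrightarrow> P i (\<lambda>_. 0) (xi {}) \<in> K"
    and g1: "i \<in> Y0 m \<Longrightarrow> j \<in> Y0 m \<Longrightarrow> i \<noteq> j \<Longrightarrow> p ^ r < p ^ t i \<Longrightarrow> r < R \<Longrightarrow> P j (ex i (p ^ r)) (xi {}) \<in> K"
    and g2: "k \<in> Y1 m n \<Longrightarrow> l \<in> Y1 m n \<Longrightarrow> k \<noteq> l \<Longrightarrow> P l (\<lambda>_. 0) (xi {k}) \<in> K"
    and g3: "k \<in> Y1 m n \<Longrightarrow> l \<in> Y1 m n \<Longrightarrow> k \<noteq> l \<Longrightarrow> i \<in> Y0 m \<Longrightarrow> P i (\<lambda>_. 0) (xi {k} \<odot> xi {l}) \<in> K"
    and g4: "i \<in> Y0 m \<Longrightarrow> k \<in> Y1 m n \<Longrightarrow> P i (ex i 2) (xi {}) + P k (ex i 1) (xi {k}) \<in> K"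
begin

lemma K_minus: "E \<in> K \<Longrightarrow> - E \<in> K"
  using K_scale[of E "-1"] by simp

lemma K_diff: "E \<in> K \<Longrightarrow> F \<in> K \<Longrightarrow> E - F \<in> K"
  using K_add[of E "- F"] K_minus[of F] by simp

lemma K_scale_cancel: "scaleW c E \<in> K \<Longrightarrow> c \<noteq> 0 \<Longrightarrow> E \<in> K"
  using K_scale[of "scaleW c E" "inverse c"] by simp

text \<open>Bracketing x_i^(2) D_i + x_i \<xi>_k D_k with x_i D_j gives x_i^(2) D_j; the odd summand
  commutes with x_i D_j.\<close>

lemma x2D:
  assumes "i \<in> Y0 m" "j \<in> Y0 m" "i \<noteq> j"
  shows "P j (ex i 2) (xi {}) \<in> K"
proof -
  obtain k where k: "k \<in> Y1 m n" using Y1_third by blast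
  have x1: "P j (ex i 1) (xi {}) \<in> K"
    using g1[OF assms, of 0] p_pow_gt1(1)[OF assms(1)] R1 by simp
  have b: "bd (ex i 2)" "bd (ex i 1)" using bd_ex[OF assms(1)] p_pow_gt1[OF assms(1)] by simp_all
  have "br (P i (ex i 2) (xi {})) (P j (ex i 1) (xi {})) = scaleW (of_nat (ex i 2 i + 0 choose ex i 2 i)) (P j (ex i 2) (xi {} \<odot> xi {}))"
    by (rule brA) (use assms b lam_one in auto)
  moreover have "br (P k (ex i 1) (xi {k})) (P j (ex i 1) (xi {})) = 0"
    by (rule brB_zero(2)) (use assms b k lam_one lam_xi1 in auto)
  ultimately have "br (P i (ex i 2) (xi {}) + P k (ex i 1) (xi {k})) (P j (ex i 1) (xi {})) = P j (ex i 2) (xi {})"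
    by (simp add: br_add_left xi_AA)
  then show ?thesis using K_br[OF g4[OF assms(1) k] x1] by simp
qed

text \<open>Subtracting [x_l^(2) D_j, x_j D_l] = x_l^(2) D_l - x_l x_j D_j from the generator
  \<open>g4\<close> cancels x_l^(2) D_l. The field obtained serves as multiplication by x_l on
  fields f D_j in which x_j does not occur in f.\<close>

lemma ZK:
  assumes "l \<in> Y0 m" "j \<in> Y0 m" "l \<noteq> j" "k \<in> Y1 m n"
  shows "P j ((ex l 1)(j := 1)) (xi {}) + P k (ex l 1) (xi {k}) \<in> K"
proof -
  have b: "bd (ex l 2)" "bd (ex j 1)"
    using bd_ex[OF assms(1)] p_pow_gt1[OF assms(1)] bd_ex[OF assms(2)] p_pow_gt1[OF assms(2)] by simp_all
  have x1: "P l (ex j 1) (xi {}) \<in> K"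
    using g1[OF assms(2,1), of 0] p_pow_gt1(1)[OF assms(2)] assms(3) R1 by simp
  have 1: "XO (ex l 2) (xi {}) \<odot> D j (XO (ex j 1) (xi {})) = scaleA (of_nat (ex l 2 j + 0 choose ex l 2 j)) (XO (ex l 2) (xi {} \<odot> xi {}))"
    by (rule XD1) (use b assms lam_one in auto)
  have 2: "XO (ex j 1) (xi {}) \<odot> D l (XO (ex l 2) (xi {})) = scaleA (of_nat (ex j 1 l + 1 choose ex j 1 l)) (XO ((ex l 1)(j := 1)) (xi {} \<odot> xi {}))"
    by (rule XD1) (use b assms lam_one in auto)
  have "br (P j (ex l 2) (xi {})) (P l (ex j 1) (xi {})) = P l (ex l 2) (xi {}) - P j ((ex l 1)(j := 1)) (xi {})"
    unfolding brP[OF Y0_sub[OF assms(2)] Y0_sub[OF assms(1)]] 1 2 using assms by (simp add: P_def xi_AA)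
  then have "P l (ex l 2) (xi {}) - P j ((ex l 1)(j := 1)) (xi {}) \<in> K"
    using K_br[OF x2D[OF assms(1,2,3)] x1] by simp
  from K_diff[OF g4[OF assms(1,4)] this] show ?thesis by (simp add: add.commute)
qed

lemma xxsD:
  assumes "i \<in> Y0 m" "j \<in> Y0 m" "l \<in> Y0 m" "i \<noteq> j" "l \<noteq> i" "l \<noteq> j" "s < p ^ t i"
    and "P j (ex i s) (xi {}) \<in> K"
  shows "P j ((ex i s)(l := 1)) (xi {}) \<in> K"
proof -
  obtain k where k: "k \<in> Y1 m n" using Y1_third by blast
  have b: "bd (ex i s)" "bd ((ex l 1)(j := 1))" "bd (ex l 1)"
    using bd_ex[OF assms(1,7)] p_pow_gt1 bd_ex assms by (auto intro!: bd_upd)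
  have "br (P j (ex i s) (xi {})) (P j ((ex l 1)(j := 1)) (xi {})) =
      scaleW (of_nat (ex i s j + 0 choose ex i s j)) (P j ((ex i s)(l := 1)) (xi {} \<odot> xi {}))"
    by (rule brA) (use b assms lam_one in auto)
  moreover have "br (P j (ex i s) (xi {})) (P k (ex l 1) (xi {k})) = 0"
    by (rule brB_zero(1)) (use b assms k lam_one lam_xi1 in auto)
  ultimately have "br (P j (ex i s) (xi {})) (P j ((ex l 1)(j := 1)) (xi {}) + P k (ex l 1) (xi {k})) =
      P j ((ex i s)(l := 1)) (xi {})"
    using assms by (simp add: br_add_right xi_AA)
  then show ?thesis using K_br[OF assms(8) ZK[OF assms(3,2,6) k]] by simp
qed

text \<open>For s not a power of p one has [x_i^(a) D_l, x_i^(s-a) x_l D_j] = C(s, a) x_i^(s) D_j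
  with some a making the coefficient nonzero. This needs a third even index. The bound on s ensures
  that only generators with exponent p^r, r < R, are called upon.\<close>

lemma xsD_bounded:
  assumes "i \<in> Y0 m" "j \<in> Y0 m" "i \<noteq> j" "s < p ^ t i" "s < p ^ R"
  shows "P j (ex i s) (xi {}) \<in> K"
  using assms(2-5)
proof (induction s arbitrary: j rule: less_induct)
  case (less s)
  show ?case
  proof (cases "s = 0 \<or> (\<exists>r. s = p ^ r)")
    case True
    then show ?thesis
    proof
      assume "s = 0"
      then show ?thesis using g0[OF less.prems(1)] by simp
    next
      assume "\<exists>r. s = p ^ r"
      then obtain r where r: "s = p ^ r" by blast
      have "p ^ r < p ^ t i" "p ^ r < p ^ R" using less.prems(3,4) r by metis+
      then have "r < R" using p3 by (simp add: power_strict_increasing_iff)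
      show ?thesis unfolding r by (rule g1[OF assms(1) less.prems(1,2)]) fact+
    qed
  next
    case False
    then obtain a where a: "0 < a" "a < s" "\<not> p dvd (s choose a)"
      using choose_not_dvd_if_not_prime_power[OF prime_p, of s] by blast
    obtain l where l: "l \<in> Y0 m" "l \<noteq> i" "l \<noteq> j" using Y0_third by blast
    have "a < p ^ t i" "s - a < p ^ t i" using a less.prems by simp_all
    have K: "P l (ex i a) (xi {}) \<in> K"
      by (rule less.IH) (use a l less.prems in auto)
    have K': "P j (ex i (s - a)) (xi {}) \<in> K"
      by (rule less.IH) (use a l less.prems in auto)
    have "P j ((ex i (s - a))(l := 1)) (xi {}) \<in> K"
      by (rule xxsD) (use assms less.prems l \<open>s - a < p ^ t i\<close> in \<open>simp_all add: K'\<close>)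
    have b: "bd (ex i a)" "bd ((ex i (s - a))(l := 1))"
      using bd_ex[OF assms(1)] \<open>a < p ^ t i\<close> \<open>s - a < p ^ t i\<close> l p_pow_gt1 by (auto intro!: bd_upd)
    have 1: "XO (ex i a) (xi {}) \<odot> D l (XO ((ex i (s - a))(l := 1)) (xi {})) =
        scaleA (of_nat (s choose a)) (XO (ex i s) (xi {}))"
    proof -
      have d: "D l (XO ((ex i (s - a))(l := 1)) (xi {})) = XO (ex i (s - a)) (xi {})"
        using D_XO0[OF b(2) lam_one l(1)] l by (simp add: ex_def fun_upd_twist fun_upd_idem)
      have x: "XO (ex i a) (xi {}) \<odot> XO (ex i (s - a)) (xi {}) = scaleA (of_nat (ex i a i + ex i (s - a) i choose ex i a i))
          (XO (\<lambda>j. ex i a j + ex i (s - a) j) (xi {} \<odot> xi {}))"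
        by (rule XM) (use b bd_ex[OF assms(1)] \<open>s - a < p ^ t i\<close> lam_one assms(1) in auto)
      have e: "(\<lambda>j. ex i a j + ex i (s - a) j) = ex i s" using a by (auto simp: fun_eq_iff)
      show ?thesis unfolding d x e using a by (simp only: ex_same xi_one_left xi_AA empty_subsetI) simp
    qed
    have 2: "XO ((ex i (s - a))(l := 1)) (xi {}) \<odot> D j (XO (ex i a) (xi {})) = 0"
      by (rule XD0) (use b lam_one less.prems assms in auto)
    have "br (P l (ex i a) (xi {})) (P j ((ex i (s - a))(l := 1)) (xi {})) = scaleW (of_nat (s choose a)) (P j (ex i s) (xi {}))"
      unfolding brP[OF Y0_sub[OF l(1)] Y0_sub[OF less.prems(1)]] 1 2 by (simp add: P_def fld_simps)
    then have "scaleW (of_nat (s choose a)) (P j (ex i s) (xi {})) \<in> K"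
      using K_br[OF K \<open>P j ((ex i (s - a))(l := 1)) (xi {}) \<in> K\<close>] by simp
    then show ?thesis by (rule K_scale_cancel) (use a of_nat_0_iff in blast)
  qed
qed

end

text \<open>The bound \<open>R\<close> restricts the exponents of the generators, so that a derivation known to vanish up to one
  exponent vanishes on the subalgebra generated so far.\<close>
locale gen_subalg = gen_subalg0 +
  assumes t_le_R: "i \<in> Y0 m \<Longrightarrow> t i \<le> R"
begin

lemma xsD:
  assumes "i \<in> Y0 m" "j \<in> Y0 m" "i \<noteq> j" "s < p ^ t i"
  shows "P j (ex i s) (xi {}) \<in> K"
proof -
  have "p ^ t i \<le> p ^ R" using t_le_R[OF assms(1)] p3 by (intro power_increasing) auto
  then show ?thesis using xsD_bounded[OF assms] assms(4) by simp
qed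

text \<open>Two odd variables are added at a time: [\<xi>_w D_q, x_i x_q D_j] = x_i \<xi>_w D_j
  attaches a factor x_i, and the bracket with \<xi>_k \<xi>_l D_i replaces that factor by \<xi>_k
  \<xi>_l.\<close>

lemma xi_even_D:
  assumes "u \<subseteq> Y1 m n" "even (card u)" "j \<in> Y0 m"
  shows "P j (\<lambda>_. 0) (xi u) \<in> K"
  using assms
proof (induction "card u" arbitrary: u j rule: less_induct)
  case less
  have fin: "finite u" using less.prems(1) finite_subset finite_Y(3) by blast
  show ?case
  proof (cases "u = {}")
    case True
    then show ?thesis using g0 less.prems by simp
  next
    case False
    then obtain k where k: "k \<in> u" by blast
    have "u \<noteq> {k}" using less.prems(2) by auto
    then obtain l where l: "l \<in> u" "l \<noteq> k" using k by blast
    define w where "w = u - {k, l}"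
    have u: "u = {k, l} \<union> w" and dj: "{k, l} \<inter> w = {}" using k l by (auto simp: w_def)
    have w: "w \<subseteq> Y1 m n" "card u = 2 + card w"
      using fin k l less.prems(1) card_mono[of u "{k, l}"] by (auto simp: w_def card_Diff_subset)
    have Y: "k \<in> Y1 m n" "l \<in> Y1 m n" using k l less.prems(1) by auto
    have IH: "P q (\<lambda>_. 0) (xi w) \<in> K" if "q \<in> Y0 m" for q
      using less.hyps[of w q] w less.prems(2) that by simp
    obtain i where i: "i \<in> Y0 m" "i \<noteq> j" using Y0_third by blast
    obtain q where q: "q \<in> Y0 m" "q \<noteq> j" "q \<noteq> i" using Y0_third by blast
    have lw: "lam 0 (xi w)" by (rule lam_xi) (use w less.prems(2) in auto)
    have b: "bd ((ex i 1)(q := 1))" "bd (ex i 1)" using bd_ex[OF i(1)] p_pow_gt1 i q by (auto intro!: bd_upd)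
    have "br (P q (\<lambda>_. 0) (xi w)) (P j ((ex i 1)(q := 1)) (xi {})) =
      scaleW (of_nat ((\<lambda>_. 0) q + 0 choose (\<lambda>_. 0) q)) (P j (ex i 1) (xi w \<odot> xi {}))"
      by (rule brA) (use b q i lam_one lw less.prems in auto)
    moreover have "P j ((ex i 1)(q := 1)) (xi {}) \<in> K"
      by (rule xxsD) (use i q less.prems p_pow_gt1 xsD[of i j 1] in auto)
    ultimately have xw: "P j (ex i 1) (xi w) \<in> K"
      using K_br[OF IH[OF q(1)]] w by (metis (no_types, lifting) add_0 binomial_n_0 of_nat_1 scaleW_simps(1) xi_AA xi_one_right)
    have "br (P i (\<lambda>_. 0) (xi {k} \<odot> xi {l})) (P j (ex i 1) (xi w)) =
      scaleW (of_nat ((\<lambda>_. 0) i + 0 choose (\<lambda>_. 0) i)) (P j (\<lambda>_. 0) ((xi {k} \<odot> xi {l}) \<odot> xi w))"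
      by (rule brA) (use b i lw less.prems lam_xi2 Y in auto)
    then have "P j (\<lambda>_. 0) ((xi {k} \<odot> xi {l}) \<odot> xi w) \<in> K"
      using K_br[OF g3[OF Y _ i(1)] xw] l(2) by (metis add_0 binomial_n_0 of_nat_1 scaleW_simps(1))
    moreover have "\<exists>c. c \<noteq> 0 \<and> (xi {k} \<odot> xi {l}) \<odot> xi w = scaleA c (xi u)"
    proof -
      have "xi {k} \<odot> xi {l} = scaleA ((-1) ^ inversions {k} {l}) (xi {k, l})"
        using xi_mult[of "{k}" "{l}"] Y l(2) by (simp add: insert_commute)
      moreover have "xi {k, l} \<odot> xi w = scaleA ((-1) ^ inversions {k, l} w) (xi u)"
        using xi_mult[of "{k, l}" w] Y w dj u by simp
      ultimately show ?thesis
        by (intro exI[of _ "(-1) ^ inversions {k} {l} * (-1) ^ inversions {k, l} w"]) (simp add: mul_scale_left)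
    qed
    ultimately obtain c where "c \<noteq> 0" "scaleW c (P j (\<lambda>_. 0) (xi u)) \<in> K" by (auto simp: P_scale)
    then show ?thesis using K_scale_cancel by blast
  qed
qed

end

context gen_subalg
begin

lemma br_one_coef: "br E F = scaleW (of_nat (q choose 0)) G \<Longrightarrow> E \<in> K \<Longrightarrow> F \<in> K \<Longrightarrow> G \<in> K"
  using K_br[of E F] by simp

text \<open>Induction on the number of even variables present. If some x_l with l distinct from j is
  absent, it acts as a carrier: x_i^(b_i) x_l D_j is bracketed with the field along D_l having the
  x_i-part removed. If none is absent, a variable x_i with spare room is carried as x_i^(b_i + 1)
  D_j and lowered by D_i. Both brackets have coefficient 1.\<close>

lemma type1_aux:
  assumes "bd b" "j \<in> Y0 m" "b j = 0" "u \<subseteq> Y1 m n" "even (card u)"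
    and "\<exists>l\<in>Y0 m. l \<noteq> j \<and> Suc (b l) < p ^ t l"
  shows "P j b (xi u) \<in> K"
  using assms(1-3,6)
proof (induction "card {l \<in> Y0 m. b l \<noteq> 0}" arbitrary: b j rule: less_induct)
  case less
  have lu: "lam 0 (xi u)" by (rule lam_xi) (use assms in auto)
  have xu: "xi u \<odot> xi {} = xi u" using assms(4) by (simp add: xi_AA)
  show ?case
  proof (cases "\<forall>i\<in>Y0 m. b i = 0")
    case True
    then have "b = (\<lambda>_. 0)" using less.prems(1) by (auto simp: bd_iff fun_eq_iff)
    then show ?thesis using xi_even_D assms(4,5) less.prems(2) by simp
  next
    case nz: False
    have smaller: "card {l \<in> Y0 m. (b(i := 0)) l \<noteq> 0} < card {l \<in> Y0 m. b l \<noteq> 0}"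
      if "i \<in> Y0 m" "b i \<noteq> 0" for i
      by (rule psubset_card_mono) (use that in auto)
    have bd0: "bd (b(i := 0))" for i using less.prems(1) by (rule bd_upd0)
    show ?thesis
    proof (cases "\<exists>l\<in>Y0 m. l \<noteq> j \<and> b l = 0")
      case True
      then obtain l where l: "l \<in> Y0 m" "l \<noteq> j" "b l = 0" by blast
      obtain i where i: "i \<in> Y0 m" "b i \<noteq> 0" using nz by blast
      have il: "i \<noteq> l" "i \<noteq> j" using i l less.prems(3) by auto
      have bi: "b i < p ^ t i" using less.prems(1) i by (auto simp: bd_iff)
      have 1: "P l (b(i := 0)) (xi u) \<in> K"
        by (rule less.hyps) (use smaller[OF i] bd0 i il l p_pow_gt1 in auto)
      have "P j (ex i (b i)) (xi {}) \<in> K" by (rule xsD) (use i il bi less.prems in auto)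
      then have 2: "P j ((ex i (b i))(l := 1)) (xi {}) \<in> K"
        by (intro xxsD) (use i il l bi less.prems in auto)
      have b2: "bd ((ex i (b i))(l := 1))" using bd_ex[OF i(1) bi] l p_pow_gt1 by (auto intro!: bd_upd)
      have "br (P l (b(i := 0)) (xi u)) (P j ((ex i (b i))(l := 1)) (xi {})) =
        scaleW (of_nat ((b(i := 0)) l + 0 choose (b(i := 0)) l)) (P j b (xi u \<odot> xi {}))"
        by (rule brA) (use l il i b2 bd0 lu lam_one less.prems in auto)
      then show ?thesis using br_one_coef[OF _ 1 2, of 0] l il unfolding xu by simp
    next
      case nol: False
      obtain i where i: "i \<in> Y0 m" "i \<noteq> j" "Suc (b i) < p ^ t i" using less.prems(4) by blast
      have bi: "b i \<noteq> 0" using nol i by auto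
      have 1: "P i (b(i := 0)) (xi u) \<in> K"
      proof (rule less.hyps)
        show "\<exists>l\<in>Y0 m. l \<noteq> i \<and> Suc ((b(i := 0)) l) < p ^ t l"
          using i less.prems p_pow_gt1 by (intro bexI[of _ j]) auto
      qed (use smaller[OF i(1) bi] bd0 i less.prems in auto)
      have 2: "P j (ex i (Suc (b i))) (xi {}) \<in> K" by (rule xsD) (use i less.prems in auto)
      have "br (P i (b(i := 0)) (xi u)) (P j (ex i (Suc (b i))) (xi {})) =
        scaleW (of_nat ((b(i := 0)) i + b i choose (b(i := 0)) i)) (P j b (xi u \<odot> xi {}))"
        by (rule brA) (use i bd0 bd_ex lu lam_one less.prems in auto)
      then show ?thesis using br_one_coef[OF _ 1 2, of "b i"] unfolding xu by simp
    qed
  qed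
qed

text \<open>If every exponent away from \<open>j\<close> is maximal, no variable has room. Then one
  exponent is raised from p^t_l - 2 to p^t_l - 1 by x_l^(2) D_l, with coefficient C(-1, 2) = 1. A
  variable \<xi>_k outside \<open>u\<close> is required so that the summand x_l \<xi>_k D_k of the
  generator acts as 0.\<close>

lemma type1:
  assumes "bd b" "j \<in> Y0 m" "b j = 0" "u \<subset> Y1 m n" "even (card u)"
  shows "P j b (xi u) \<in> K"
proof (cases "\<exists>l\<in>Y0 m. l \<noteq> j \<and> Suc (b l) < p ^ t l")
  case True
  then show ?thesis using type1_aux assms by blast
next
  case False
  obtain k where k: "k \<in> Y1 m n" "k \<notin> u" using assms(4) by blast
  obtain l where l: "l \<in> Y0 m" "l \<noteq> j" using Y0_third by blast
  have u: "u \<subseteq> Y1 m n" using assms(4) by auto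
  have lu: "lam 0 (xi u)" by (rule lam_xi) (use assms u in auto)
  have Dk: "D k (xi u) = 0" by (rule D_xi) (use k u in auto)
  have "b l < p ^ t l" using assms(1) l by (auto simp: bd_iff)
  then have bl: "Suc (b l) = p ^ t l" using False l by force
  then obtain q where q: "b l = Suc (Suc q)" using p_pow_gt1(3)[OF l(1)] by (cases "b l"; cases "b l - 1") auto
  have b': "bd (b(l := Suc q))" by (rule bd_upd) (use assms l q bl in auto)
  have 1: "P j (b(l := Suc q)) (xi u) \<in> K"
    by (rule type1_aux) (use b' assms u l q bl in auto)
  have bx: "bd (ex l 2)" "bd (ex l 1)" using bd_ex l p_pow_gt1 by auto
  have "br (P l (ex l 2) (xi {})) (P j (b(l := Suc q)) (xi u)) =
      scaleW (of_nat (ex l 2 l + q choose ex l 2 l)) (P j b (xi {} \<odot> xi u))"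
    by (rule brA) (use l q bx b' lam_one lu assms in auto)
  moreover have "br (P k (ex l 1) (xi {k})) (P j (b(l := Suc q)) (xi u)) = 0"
    by (rule brB_zero(2)) (use l k bx b' lu Dk assms lam_xi1 in auto)
  moreover have "of_nat (2 + q choose 2) = (1::'a)"
    using choose_two_pred[OF l(1) bl] q by simp
  ultimately have "br (P l (ex l 2) (xi {}) + P k (ex l 1) (xi {k})) (P j (b(l := Suc q)) (xi u)) = P j b (xi u)"
    using u by (simp add: br_add_left xi_AA)
  then show ?thesis using K_br[OF g4[OF l(1) k(1)] 1] by simp
qed

lemma one_psub: "{} \<subset> Y1 m n"
  using Y1_third by blast

section \<open>Images of the D_rs obtained as brackets\<close>

text \<open>The D_ij-image of x^(a) \<xi>_u. Distributing x^(a) as x_i^(a_i) in one factor and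
  everything else in the other gives coefficient 1 in both terms of the bracket.\<close>

lemma type2:
  assumes "bd a" "i \<in> Y0 m" "j \<in> Y0 m" "i \<noteq> j" "a i = Suc x" "a j = Suc y" "u \<subseteq> Y1 m n" "even (card u)"
  shows "P j (a(i := x)) (xi u) - P i (a(j := y)) (xi u) \<in> K"
proof -
  obtain l where l: "l \<in> Y0 m" "l \<noteq> i" "l \<noteq> j" using Y0_third by blast
  have lu: "lam 0 (xi u)" by (rule lam_xi) (use assms in auto)
  have ai: "a i < p ^ t i" using assms(1,2) by (auto simp: bd_iff)
  have b: "bd (ex i (a i))" "bd (a(i := 0))" using bd_ex ai assms bd_upd0 by auto
  have 1: "P j (ex i (a i)) (xi u) \<in> K"
  proof (rule type1_aux)
    show "\<exists>l\<in>Y0 m. l \<noteq> j \<and> Suc (ex i (a i) l) < p ^ t l"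
      using l p_pow_gt1 by (intro bexI[of _ l]) auto
  qed (use b assms in auto)
  have 2: "P i (a(i := 0)) (xi {}) \<in> K"
    by (rule type1) (use b assms one_psub in auto)
  have A: "XO (ex i (a i)) (xi u) \<odot> D j (XO (a(i := 0)) (xi {})) =
      scaleA (of_nat (ex i (a i) j + y choose ex i (a i) j)) (XO (a(j := y)) (xi u \<odot> xi {}))"
    by (rule XD1) (use b assms lu lam_one in auto)
  have B: "XO (a(i := 0)) (xi {}) \<odot> D i (XO (ex i (a i)) (xi u)) =
      scaleA (of_nat ((a(i := 0)) i + x choose (a(i := 0)) i)) (XO (a(i := x)) (xi {} \<odot> xi u))"
    by (rule XD1) (use b assms lu lam_one in auto)
  have "br (P j (ex i (a i)) (xi u)) (P i (a(i := 0)) (xi {})) = P i (a(j := y)) (xi u) - P j (a(i := x)) (xi u)"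
    unfolding brP[OF Y0_sub[OF assms(3)] Y0_sub[OF assms(2)]] A B using assms by (simp add: P_def xi_AA)
  then have "P i (a(j := y)) (xi u) - P j (a(i := x)) (xi u) \<in> K" using K_br[OF 1 2] by simp
  from K_minus[OF this] show ?thesis by simp
qed

lemma xi_D_odd:
  assumes "i \<in> Y0 m" "k \<in> Y1 m n" "l \<in> Y1 m n" "l \<noteq> k" "s < p ^ t i"
  shows "P k (ex i s) (xi {l}) \<in> K"
proof -
  obtain j where j: "j \<in> Y0 m" "j \<noteq> i" using Y0_third by blast
  have b: "bd (ex j 2)" "bd (ex j 1)" "bd (ex i s)" using bd_ex j p_pow_gt1 assms by auto
  have Dk: "D k (xi {l}) = 0" by (rule D_xi) (use assms in auto)
  have "br (P j (ex j 2) (xi {})) (P k (\<lambda>_. 0) (xi {l})) = 0"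
    by (rule brB_zero(1)) (use j b assms lam_one lam_xi1 in auto)
  moreover have "br (P l (ex j 1) (xi {l})) (P k (\<lambda>_. 0) (xi {l})) = P k (ex j 1) (xi {l})"
  proof -
    have A: "XO (ex j 1) (xi {l}) \<odot> D l (XO (\<lambda>_. 0) (xi {l})) =
      scaleA (of_nat (ex j 1 j + (\<lambda>_. 0) j choose ex j 1 j)) (XO (ex j 1) (xi {l} \<odot> D l (xi {l})))"
      by (rule XD2) (use j b assms lam_xi1 in auto)
    have B: "XO (\<lambda>_. 0) (xi {l}) \<odot> D k (XO (ex j 1) (xi {l})) = 0"
      by (rule XD20) (use b assms Dk xi_AA in auto)
    show ?thesis unfolding brP[OF Y1_sub[OF assms(3)] Y1_sub[OF assms(2)]] A B
      using assms by (simp add: D_xi_single xi_AA fld_simps P_def)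
  qed
  ultimately have "br (P j (ex j 2) (xi {}) + P l (ex j 1) (xi {l})) (P k (\<lambda>_. 0) (xi {l})) = P k (ex j 1) (xi {l})"
    by (simp add: br_add_left)
  then have 1: "P k (ex j 1) (xi {l}) \<in> K" using K_br[OF g4[OF j(1) assms(3)] g2[OF assms(3,2,4)]] by simp
  have 2: "P j (ex i s) (xi {}) \<in> K" by (rule xsD) (use assms j in auto)
  have "br (P j (ex i s) (xi {})) (P k (ex j 1) (xi {l})) =
      scaleW (of_nat (ex i s j + 0 choose ex i s j)) (P k (ex i s) (xi {} \<odot> xi {l}))"
    by (rule brB) (use j b assms lam_one lam_xi1 in auto)
  then show ?thesis using br_one_coef[OF _ 2 1, of 0] j assms by (simp add: xi_AA)
qed

text \<open>The D_ik-image of x^(a) \<xi>_w \<xi>_l. A second odd variable \<xi>_l can travel with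
  D_k in x_i^(a_i) \<xi>_l D_k while \<xi>_w stays with D_i; anticommuting \<xi>_l with the odd
  element \<open>D k (xi w)\<close> turns the minus sign of the bracket into a plus.\<close>

lemma type3:
  assumes "bd a" "i \<in> Y0 m" "k \<in> Y1 m n" "a i = Suc x" "l \<in> Y1 m n" "l \<noteq> k" "w \<subseteq> Y1 m n" "l \<notin> w" "even (card w)"
  shows "P k (a(i := x)) (xi w \<odot> xi {l}) + P i a (D k (xi w \<odot> xi {l})) \<in> K"
proof -
  have lw: "lam 0 (xi w)" by (rule lam_xi) (use assms in auto)
  have ai: "a i < p ^ t i" using assms(1,2) by (auto simp: bd_iff)
  have b: "bd (ex i (a i))" "bd (a(i := 0))" using bd_ex ai assms bd_upd0 by auto
  have 1: "P i (a(i := 0)) (xi w) \<in> K"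
    by (rule type1) (use b assms in auto)
  have 2: "P k (ex i (a i)) (xi {l}) \<in> K" by (rule xi_D_odd) (use assms ai in auto)
  have A: "XO (a(i := 0)) (xi w) \<odot> D i (XO (ex i (a i)) (xi {l})) =
      scaleA (of_nat ((a(i := 0)) i + x choose (a(i := 0)) i)) (XO (a(i := x)) (xi w \<odot> xi {l}))"
    by (rule XD1) (use b assms lw lam_xi1 in auto)
  have B: "XO (ex i (a i)) (xi {l}) \<odot> D k (XO (a(i := 0)) (xi w)) =
      scaleA (of_nat (ex i (a i) i + (a(i := 0)) i choose ex i (a i) i)) (XO a (xi {l} \<odot> D k (xi w)))"
    by (rule XD2) (use b assms lw lam_xi1 in auto)
  have "lam 1 (D k (xi w))" by (rule lam_D) (use assms lw in auto)
  then have "xi {l} \<odot> D k (xi w) = - (D k (xi w) \<odot> xi {l})"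
    using mul_comm[of "D k (xi w)" "xi {l}" 1 1] lamD lam_xi1[OF assms(5)] by simp
  moreover have "D k (xi w \<odot> xi {l}) = D k (xi w) \<odot> xi {l}"
    using D_mul[OF Y1_sub[OF assms(3)], of "xi w" "xi {l}" 0] lamD[OF lw] lamD[OF lam_xi1[OF assms(5)]]
      D_xi[OF assms(3), of "{l}"] assms(5,6) by simp
  ultimately have C: "xi {l} \<odot> D k (xi w) = - D k (xi w \<odot> xi {l})" by simp
  have "br (P i (a(i := 0)) (xi w)) (P k (ex i (a i)) (xi {l})) =
      P k (a(i := x)) (xi w \<odot> xi {l}) + P i a (D k (xi w \<odot> xi {l}))"
    unfolding brP[OF Y0_sub[OF assms(2)] Y1_sub[OF assms(3)]] A B C by (simp add: P_def XO_minus fld_simps)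
  then show ?thesis using K_br[OF 1 2] by simp
qed

text \<open>The D_ik-image of x_i^(s+1) \<xi>_k, not covered by \<open>type3\<close> because \<xi>_k
  is the only odd variable. Bracketing x_i^(s) D_j with the field of \<open>ZK\<close> yields
  x_i^(s) x_q D_q + x_i^(s) \<xi>_k D_k, and \<open>type2\<close> trades the first summand for
  x_i^(s+1) D_i.\<close>

lemma sigma_single:
  assumes "i \<in> Y0 m" "k \<in> Y1 m n" "Suc s < p ^ t i"
  shows "P k (ex i s) (xi {k}) + P i (ex i (Suc s)) (xi {}) \<in> K"
proof -
  obtain q where q: "q \<in> Y0 m" "q \<noteq> i" using Y0_third by blast
  obtain j where j: "j \<in> Y0 m" "j \<noteq> i" "j \<noteq> q" using Y0_third by blast
  have b: "bd (ex i s)" "bd ((ex j 1)(q := 1))" "bd (ex j 1)" "bd ((ex i (Suc s))(q := 1))"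
    using bd_ex j p_pow_gt1 assms q by (auto intro!: bd_upd)
  have 1: "P j (ex i s) (xi {}) \<in> K" by (rule xsD) (use assms j in auto)
  have "br (P j (ex i s) (xi {})) (P q ((ex j 1)(q := 1)) (xi {})) =
      scaleW (of_nat (ex i s j + 0 choose ex i s j)) (P q ((ex i s)(q := 1)) (xi {} \<odot> xi {}))"
    by (rule brA) (use b assms lam_one q j in auto)
  moreover have "br (P j (ex i s) (xi {})) (P k (ex j 1) (xi {k})) =
      scaleW (of_nat (ex i s j + 0 choose ex i s j)) (P k (ex i s) (xi {} \<odot> xi {k}))"
    by (rule brB) (use b assms lam_one q j lam_xi1 in auto)
  ultimately have "br (P j (ex i s) (xi {})) (P q ((ex j 1)(q := 1)) (xi {}) + P k (ex j 1) (xi {k})) =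
      P q ((ex i s)(q := 1)) (xi {}) + P k (ex i s) (xi {k})"
    using j assms by (simp add: br_add_right xi_AA)
  then have "P q ((ex i s)(q := 1)) (xi {}) + P k (ex i s) (xi {k}) \<in> K"
    using K_br[OF 1 ZK[OF j(1) q(1) j(3) assms(2)]] by simp
  moreover have "P q (((ex i (Suc s))(q := 1))(i := s)) (xi {}) - P i (((ex i (Suc s))(q := 1))(q := 0)) (xi {}) \<in> K"
    by (rule type2) (use b assms q in auto)
  moreover have "((ex i (Suc s))(q := 1))(i := s) = (ex i s)(q := 1)" "((ex i (Suc s))(q := 1))(q := 0) = ex i (Suc s)"
    using q by (auto simp: fun_eq_iff)
  ultimately have "(P q ((ex i s)(q := 1)) (xi {}) + P k (ex i s) (xi {k})) -
      (P q ((ex i s)(q := 1)) (xi {}) - P i (ex i (Suc s)) (xi {})) \<in> K"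
    using K_diff by metis
  then show ?thesis by (simp add: algebra_simps)
qed

lemma sigma_aux:
  assumes "bd a" "i \<in> Y0 m" "k \<in> Y1 m n" "a i = Suc x" "Suc (a i) < p ^ t i"
  shows "P k (a(i := x)) (xi {k}) + P i a (xi {}) \<in> K"
proof -
  have b: "bd (a(i := 0))" "bd (ex i (Suc x))" "bd (ex i (Suc (Suc x)))" using bd_upd0 bd_ex assms by auto
  have 1: "P i (a(i := 0)) (xi {}) \<in> K" by (rule type1) (use b assms one_psub in auto)
  have 2: "P k (ex i (Suc x)) (xi {k}) + P i (ex i (Suc (Suc x))) (xi {}) \<in> K"
    by (rule sigma_single) (use assms in auto)
  have "br (P i (a(i := 0)) (xi {})) (P k (ex i (Suc x)) (xi {k})) =
      scaleW (of_nat ((a(i := 0)) i + x choose (a(i := 0)) i)) (P k (a(i := x)) (xi {} \<odot> xi {k}))"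
    by (rule brB) (use b assms lam_one lam_xi1 in auto)
  moreover have "br (P i (a(i := 0)) (xi {})) (P i (ex i (Suc (Suc x))) (xi {})) =
      scaleW (of_nat ((a(i := 0)) i + Suc x choose (a(i := 0)) i)) (P i a (xi {} \<odot> xi {}))"
    by (rule brA) (use b assms lam_one in auto)
  ultimately have "br (P i (a(i := 0)) (xi {})) (P k (ex i (Suc x)) (xi {k}) + P i (ex i (Suc (Suc x))) (xi {})) =
     P k (a(i := x)) (xi {k}) + P i a (xi {})"
    using assms by (simp add: br_add_right xi_AA)
  then show ?thesis using K_br[OF 1 2] by simp
qed

text \<open>The argument of \<open>sigma_aux\<close> passes through the exponent a_i + 1 and so
  fails when a_i is maximal. In that case the field one step lower is raised by x_i^(2) D_i + x_i
  \<xi>_k D_k. The coefficients are 3 - 1 at \<xi>_k D_k and 1 - (-1) at D_i, so twice the desired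
  field lies in \<open>K\<close>.\<close>

lemma sigma:
  assumes "bd a" "i \<in> Y0 m" "k \<in> Y1 m n" "a i = Suc x"
  shows "P k (a(i := x)) (xi {k}) + P i a (xi {}) \<in> K"
proof (cases "Suc (a i) < p ^ t i")
  case True
  then show ?thesis using sigma_aux assms by blast
next
  case False
  have "a i < p ^ t i" using assms(1,2) by (auto simp: bd_iff)
  then have ai: "Suc (a i) = p ^ t i" using False by simp
  then obtain y where y: "x = Suc (Suc y)" using p_pow_gt1(3)[OF assms(2)] assms(4)
    by (cases x; cases "x - 1") auto
  define a' where "a' = a(i := x)"
  define a'' where "a'' = a(i := Suc y)"
  have b: "bd a'" "bd a''" "bd (ex i 2)" "bd (ex i 1)" "bd (a(i := x))"
    unfolding a'_def a''_def using assms ai y p_pow_gt1 by (auto intro!: bd_upd bd_ex)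
  have 1: "P k a'' (xi {k}) + P i a' (xi {}) \<in> K"
    using sigma_aux[of a' i k "Suc y"] b assms ai y by (simp add: a'_def a''_def)
  have B1: "br (P i (ex i 2) (xi {})) (P k a'' (xi {k})) =
      scaleW (of_nat (ex i 2 i + y choose ex i 2 i)) (P k (a(i := x)) (xi {} \<odot> xi {k}))"
    by (rule brB) (use b assms lam_one lam_xi1 y in \<open>auto simp: a''_def\<close>)
  have A2: "XO (ex i 2) (xi {}) \<odot> D i (XO a' (xi {})) =
      scaleA (of_nat (ex i 2 i + Suc y choose ex i 2 i)) (XO a (xi {} \<odot> xi {}))"
    by (rule XD1) (use b assms lam_one y in \<open>auto simp: a'_def\<close>)
  have A2': "XO a' (xi {}) \<odot> D i (XO (ex i 2) (xi {})) =
      scaleA (of_nat (a' i + 1 choose a' i)) (XO a (xi {} \<odot> xi {}))"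
    by (rule XD1) (use b assms lam_one y in \<open>auto simp: a'_def\<close>)
  have B2: "br (P i (ex i 2) (xi {})) (P i a' (xi {})) =
      scaleW (of_nat (2 + Suc y choose 2) - of_nat (x + 1 choose x)) (P i a (xi {}))"
    unfolding brP[OF Y0_sub[OF assms(2)] Y0_sub[OF assms(2)]] A2 A2'
    by (simp add: P_def fld_simps a'_def xi_AA scaleW_left_diff)
  have A3: "XO (ex i 1) (xi {k}) \<odot> D k (XO a'' (xi {k})) =
      scaleA (of_nat (ex i 1 i + a'' i choose ex i 1 i)) (XO (a(i := x)) (xi {k} \<odot> D k (xi {k})))"
    by (rule XD2) (use b assms lam_xi1 y in \<open>auto simp: a''_def\<close>)
  have A3': "XO a'' (xi {k}) \<odot> D k (XO (ex i 1) (xi {k})) =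
      scaleA (of_nat (a'' i + ex i 1 i choose a'' i)) (XO (a(i := x)) (xi {k} \<odot> D k (xi {k})))"
    by (rule XD2) (use b assms lam_xi1 y in \<open>auto simp: a''_def\<close>)
  have "a'' i + ex i 1 i choose a'' i = (ex i 1 i + a'' i choose ex i 1 i)"
    using binomial_symmetric[of "a'' i" "a'' i + ex i 1 i"] by (simp add: add.commute)
  then have B3: "br (P k (ex i 1) (xi {k})) (P k a'' (xi {k})) = 0"
    unfolding brP[OF Y1_sub[OF assms(3)] Y1_sub[OF assms(3)]] A3 A3' by simp
  have A4: "XO (ex i 1) (xi {k}) \<odot> D k (XO a' (xi {})) = 0"
    by (rule XD20) (use b assms xi_AA in auto)
  have A4': "XO a' (xi {}) \<odot> D i (XO (ex i 1) (xi {k})) =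
      scaleA (of_nat (a' i + 0 choose a' i)) (XO (a(i := x)) (xi {} \<odot> xi {k}))"
    by (rule XD1) (use b assms lam_xi1 lam_one y in \<open>auto simp: a'_def\<close>)
  have B4: "br (P k (ex i 1) (xi {k})) (P i a' (xi {})) = - P k (a(i := x)) (xi {k})"
    unfolding brP[OF Y1_sub[OF assms(3)] Y0_sub[OF assms(2)]] A4 A4'
    using assms by (simp add: P_def fld_simps xi_AA)
  have c: "of_nat (2 + y choose 2) = (3::'a)" "of_nat (2 + Suc y choose 2) = (1::'a)" "of_nat (x + 1 choose x) = (-1::'a)"
    using choose_two_pred2[OF assms(2), of "2 + y"] choose_two_pred[OF assms(2), of "2 + Suc y"] y ai assms(4)
      of_nat_pred_pow[OF assms(2), of "Suc x" 1] by simp_all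
  have "br (P i (ex i 2) (xi {}) + P k (ex i 1) (xi {k})) (P k a'' (xi {k}) + P i a' (xi {})) =
      scaleW 3 (P k (a(i := x)) (xi {k})) + scaleW 2 (P i a (xi {})) - P k (a(i := x)) (xi {k})"
    unfolding br_add_left br_add_right B1 B2 B3 B4 ex_same c using assms(3) by (simp add: xi_AA)
  also have "\<dots> = scaleW 2 (P k (a(i := x)) (xi {k}) + P i a (xi {}))"
    using scaleW_left_add[of 2 1 "P k (a(i := x)) (xi {k})"] by (simp add: scaleW_add)
  finally have "scaleW 2 (P k (a(i := x)) (xi {k}) + P i a (xi {})) \<in> K"
    using K_br[OF g4[OF assms(2,3)] 1] by simp
  then show ?thesis using K_scale_cancel two_nz by blast
qed

end

section \<open>Reduction of S to monomial spanning fields\<close>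

interpretation W: module "scaleW :: 'a::field \<Rightarrow> 'a wvec \<Rightarrow> 'a wvec"
  by standard (rule ext, rule ext, simp add: scaleW_def papply algebra_simps)+

context special_lie
begin

lemma Drs_fld: "Drs p m n t r s b f =
    fld s (scaleA ((-1) ^ (tau m r * tau m s)) (D r f)) - fld r (scaleA ((-1) ^ ((tau m r + tau m s) * b)) (D s f))"
  by (rule ext, rule ext) (simp add: Drs_def fld_def papply scaleA_def)

lemma Drs_add: "Drs p m n t r s b (f + g) = Drs p m n t r s b f + (Drs p m n t r s b g :: 'a wvec)"
  and Drs_scale: "Drs p m n t r s b (scaleA c f) = scaleW c (Drs p m n t r s b f :: 'a wvec)"
  by (simp_all add: Drs_fld D_add D_scale scaleA_add fld_simps scaleW_diff mult.commute)

lemma Drs_0 [simp]: "Drs p m n t r s b 0 = (0 :: 'a wvec)"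
  using Drs_scale[of r s b 0 0] by simp

lemma Drs_even:
  assumes "r \<in> Y m n" "s \<in> Y m n" "b < 2" "f \<in> AA" "homog b f" "b = (tau m r + tau m s) mod 2"
  shows "Drs p m n t r s b f \<in> WW"
proof -
  have b: "tau m s = (b + tau m r) mod 2" "tau m r = (b + tau m s) mod 2"
    using assms(6) by (auto simp: tau_def)
  show ?thesis unfolding Drs_fld
    by (intro WW_closed(3) fld_WW assms(1,2) AA_closed homog_scale homog_D[OF assms(1,5,3)] homog_D[OF assms(2,5,3)] b)
qed

text \<open>The projection onto even fields. An even element of S comes as a combination of
  \<open>Drs\<close> fields of both parities, and projecting the combination discards the odd
  ones.\<close>

definition evp :: "'a wvec \<Rightarrow> 'a wvec" where "evp E = (\<lambda>r. part (tau m r) (E r))"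

lemma evp_linear: "evp (E + F) = evp E + evp F" "evp (scaleW c E) = scaleW c (evp E)" "evp 0 = 0"
  by (rule ext, rule ext, simp add: evp_def Defs.part_def papply scaleW_def)+

lemma evp_WW: "E \<in> WW \<Longrightarrow> evp E = E"
  by (rule ext) (simp add: evp_def part_WW)

lemma part_other: "homog c f \<Longrightarrow> c \<noteq> d \<Longrightarrow> part d f = (0 :: 'a alg)"
  unfolding homog_iff by (simp add: Defs.part_def fun_eq_iff papply) metis

lemma evp_Drs_odd:
  assumes "r \<in> Y m n" "s \<in> Y m n" "b < 2" "f \<in> AA" "homog b f" "b \<noteq> (tau m r + tau m s) mod 2"
  shows "evp (Drs p m n t r s b f) = 0"
proof -
  have b: "(b + tau m r) mod 2 \<noteq> tau m s" "(b + tau m s) mod 2 \<noteq> tau m r"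
    using assms(3,6) by (auto simp: tau_def less_2_cases_iff split: if_splits)
  have 1: "tau m q = tau m s \<Longrightarrow> part (tau m q) (scaleA c (D r f)) = 0" for c q
    using homog_scale[OF homog_D[OF assms(1,5,3) refl]] b by (intro part_other) auto
  have 2: "tau m q = tau m r \<Longrightarrow> part (tau m q) (scaleA c (D s f)) = 0" for c q
    using homog_scale[OF homog_D[OF assms(2,5,3) refl]] b by (intro part_other) auto
  have 3: "part d (E - F) = part d E - part d F" "part d 0 = (0 :: 'a alg)" for d and E F :: "'a alg"
    by (rule ext, simp add: Defs.part_def papply)+
  show ?thesis
  proof
    fix q
    show "evp (Drs p m n t r s b f) q = 0 q"
      unfolding Drs_fld evp_def papply 3 using 1[of q] 2[of q] 3 by (auto simp: fld_def papply)
  qed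
qed

lemma calS_WW: "calS p m n t \<subseteq> WW"
  by (auto simp: calS_def)

lemma calS_subspace: "W.subspace (calS p m n t :: 'a wvec set)"
  unfolding calS_def Sset_def
  by (intro W.subspace_inter W.subspace_span) (simp add: W.subspace_def)

text \<open>Homogeneous components reduce the span defining \<open>Sset\<close> to monomial coefficients of matching parity.\<close>
lemma calS_induct:
  assumes "E \<in> calS p m n t" and "W.subspace V"
    and "\<And>r s b a u. r \<in> Y m n \<Longrightarrow> s \<in> Y m n \<Longrightarrow> b = (tau m r + tau m s) mod 2 \<Longrightarrow> bd a \<Longrightarrow> u \<subseteq> Y1 m n
      \<Longrightarrow> card u mod 2 = b \<Longrightarrow> Drs p m n t r s b (mv (a, u)) \<in> V"
  shows "(E :: 'a wvec) \<in> V"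
proof -
  have "E \<in> module.span scaleW {Drs p m n t r s b f | r s b f. r \<in> Y m n \<and> s \<in> Y m n \<and> b < 2 \<and>
        f \<in> algA p m n t \<and> homog b f}"
    using assms(1) by (simp add: calS_def Sset_def)
  then have "evp E \<in> V"
  proof (induction rule: W.span_induct_alt)
    case base
    then show ?case using assms(2) by (simp add: evp_linear W.subspace_0)
  next
    case (step c G H)
    then obtain r s b f where G: "G = Drs p m n t r s b f" and
      rs: "r \<in> Y m n" "s \<in> Y m n" "b < 2" "f \<in> AA" "homog b f" by blast
    have "evp G \<in> V"
    proof (cases "b = (tau m r + tau m s) mod 2")
      case False
      then show ?thesis using evp_Drs_odd[OF rs] assms(2) by (simp add: G W.subspace_0)
    next
      case True
      have "Drs p m n t r s b f \<in> V"
        using rs(4) rs(5)[unfolded homog_iff]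
      proof (induction f rule: AA_induct[where Q="\<lambda>X. par X = b"])
        case zero
        then show ?case using assms(2) by (simp add: W.subspace_0)
      next
        case (step c y f)
        have "Drs p m n t r s b (mv y) \<in> V"
          using assms(3)[OF rs(1,2) True, of "fst y" "snd y"] step(1,2) by (cases y) (simp add: bd_MM par_def)
        then show ?case using step assms(2) by (simp add: Drs_add Drs_scale W.subspace_add W.subspace_scale)
      qed
      then show ?thesis unfolding G using evp_WW[OF Drs_even[OF rs True]] by simp
    qed
    then show ?case using step assms(2) by (simp add: evp_linear W.subspace_add W.subspace_scale)
  qed
  then show ?thesis using evp_WW assms(1) calS_WW by force
qed

lemma xi_split:
  assumes "u \<subseteq> Y1 m n" "l \<in> u"
  shows "\<exists>c. c \<noteq> 0 \<and> xi u = scaleA c (xi (u - {l}) \<odot> xi {l})"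
proof -
  have "xi (u - {l}) \<odot> xi {l} = scaleA ((-1) ^ inversions (u - {l}) {l}) (xi (u - {l} \<union> {l}))"
    by (rule xi_mult) (use assms in auto)
  moreover have "u - {l} \<union> {l} = u" using assms by auto
  ultimately have "scaleA ((-1) ^ inversions (u - {l}) {l}) (xi (u - {l}) \<odot> xi {l}) = xi u"
    by (simp flip: power_mult_distrib)
  then show ?thesis by (intro exI[of _ "(-1) ^ inversions (u - {l}) {l}"]) simp
qed

lemma D_mv_P0:
  assumes "bd a" "u \<subseteq> Y1 m n" "i \<in> Y0 m"
  shows "fld s (D i (mv (a, u))) = (if a i = 0 then 0 else P s (a(i := a i - 1)) (xi u))"
  using D_XO0[OF assms(1) lam_xi[OF assms(2) refl] assms(3)] XO_xi[OF assms(1,2)]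
  by (simp add: P_def fld_simps)

lemma D_mv_P1:
  assumes "bd a" "u \<subseteq> Y1 m n" "k \<in> Y1 m n"
  shows "fld s (D k (mv (a, u))) = P s a (D k (xi u))"
  using D_XO1[OF assms(1) xi_AA[OF assms(2)] assms(3)] XO_xi[OF assms(1,2)]
  by (simp add: P_def)

end

section \<open>The generators generate S\<close>

context gen_subalg
begin

lemma K_subspace: "W.subspace K"
  using K_0 K_add K_scale by (simp add: W.subspace_def)

text \<open>As \<xi>_k does not occur in \<open>v\<close>, the second summand in
  \<open>type3\<close> is 0 and the field itself appears, provided some exponent can be raised by
  one. If all are maximal, the generator raises one from below; its two summands contribute 1 and
  -(-1), hence the factor 2.\<close>

lemma type4:
  assumes "bd a" "v \<subseteq> Y1 m n" "odd (card v)" "k \<in> Y1 m n" "k \<notin> v"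
  shows "P k a (xi v) \<in> K"
proof -
  have lv: "lam 1 (xi v)" by (rule lam_xi) (use assms in \<open>simp_all add: odd_iff_mod_2_eq_one\<close>)
  have fin: "finite v" using assms(2) finite_subset finite_Y(3) by blast
  have Dk: "D k (xi v) = 0" by (rule D_xi) (use assms in auto)
  obtain l where l: "l \<in> v" using assms(3) by fastforce
  define w where "w = v - {l}"
  have w: "w \<subseteq> Y1 m n" "l \<in> Y1 m n" "l \<noteq> k" "l \<notin> w" "even (card w)"
    using assms l fin by (auto simp: w_def card_Diff_singleton)
  obtain c where c: "c \<noteq> 0" "xi v = scaleA c (xi w \<odot> xi {l})"
    using xi_split[OF assms(2) l] w_def by blast
  have nonmax: "P k b (xi v) \<in> K" if b: "bd b" and i: "i \<in> Y0 m" "Suc (b i) < p ^ t i" for b i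
  proof -
    have "bd (b(i := Suc (b i)))" using bd_upd b i by blast
    then have "P k ((b(i := Suc (b i)))(i := b i)) (xi w \<odot> xi {l}) + P i (b(i := Suc (b i))) (D k (xi w \<odot> xi {l})) \<in> K"
      by (rule type3) (use i assms w in auto)
    moreover have "(b(i := Suc (b i)))(i := b i) = b" by simp
    moreover have "D k (xi w \<odot> xi {l}) = 0" using Dk c by (simp add: D_scale) (metis scaleA_simps(3,4) left_inverse scaleA_simps(1))
    ultimately have "P k b (xi w \<odot> xi {l}) \<in> K" by (simp only: P_0 add_0_right)
    then show ?thesis unfolding c(2) P_scale by (rule K_scale)
  qed
  show ?thesis
  proof (cases "\<exists>i\<in>Y0 m. Suc (a i) < p ^ t i")
    case True
    then show ?thesis using nonmax assms(1) by blast
  next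
    case False
    obtain i where i: "i \<in> Y0 m" using Y0_third by blast
    have "a i < p ^ t i" using assms(1) i by (auto simp: bd_iff)
    then have ai: "Suc (a i) = p ^ t i" using False i by force
    then obtain x where x: "a i = Suc (Suc x)" using p_pow_gt1(3)[OF i]
      by (cases "a i"; cases "a i - 1") auto
    define a' where "a' = a(i := Suc x)"
    have b: "bd a'" "bd (ex i 2)" "bd (ex i 1)"
      unfolding a'_def using assms ai x p_pow_gt1 i by (auto intro!: bd_upd bd_ex)
    have 1: "P k a' (xi v) \<in> K" using nonmax[OF b(1) i] ai x by (simp add: a'_def)
    have B1: "br (P i (ex i 2) (xi {})) (P k a' (xi v)) =
        scaleW (of_nat (ex i 2 i + x choose ex i 2 i)) (P k a (xi {} \<odot> xi v))"
      by (rule brB) (use b assms lam_one lv i x in \<open>auto simp: a'_def\<close>)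
    have A2: "XO (ex i 1) (xi {k}) \<odot> D k (XO a' (xi v)) = 0"
      by (rule XD20) (use b assms xi_AA Dk in auto)
    have A2': "XO a' (xi v) \<odot> D k (XO (ex i 1) (xi {k})) =
        scaleA (of_nat (a' i + ex i 1 i choose a' i)) (XO a (xi v \<odot> D k (xi {k})))"
      by (rule XD2) (use b assms lam_xi1 lv i x in \<open>auto simp: a'_def\<close>)
    have a'i: "a' i = Suc x" by (simp add: a'_def)
    have B2: "br (P k (ex i 1) (xi {k})) (P k a' (xi v)) = - scaleW (of_nat (Suc x + 1 choose Suc x)) (P k a (xi v))"
      unfolding brP[OF Y1_sub[OF assms(4)] Y1_sub[OF assms(4)]] A2 A2' ex_same a'i D_xi_single[OF assms(4)]
      using assms(2) by (simp add: P_def fld_simps xi_AA)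
    have c: "of_nat (2 + x choose 2) = (1::'a)" "of_nat (Suc x + 1 choose Suc x) = (-1::'a)"
      using choose_two_pred[OF i, of "2 + x"] x ai of_nat_pred_pow[OF i, of "2 + x" 1] by simp_all
    have "br (P i (ex i 2) (xi {}) + P k (ex i 1) (xi {k})) (P k a' (xi v)) = P k a (xi v) + P k a (xi v)"
      unfolding br_add_left B1 B2 ex_same c using assms(2) by (simp add: xi_AA)
    also have "\<dots> = scaleW 2 (P k a (xi v))" using scaleW_left_add[of 1 1 "P k a (xi v)"] by simp
    finally have "scaleW 2 (P k a (xi v)) \<in> K" using K_br[OF g4[OF i assms(4)] 1] by simp
    then show ?thesis using K_scale_cancel two_nz by blast
  qed
qed

lemma type1_D:
  assumes "bd a" "a i = 0" "i \<in> Y0 m" "k \<in> Y1 m n" "u \<subseteq> Y1 m n" "odd (card u)"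
  shows "P i a (D k (xi u)) \<in> K"
proof (cases "k \<in> u")
  case True
  have "finite u" using assms(5) finite_subset finite_Y(3) by blast
  then have "P i a (xi (u - {k})) \<in> K"
    by (intro type1) (use assms True in \<open>auto simp: card_Diff_singleton\<close>)
  then show ?thesis using D_xi_in[OF assms(4,5) True] by (simp add: P_scale K_scale)
next
  case False
  then show ?thesis using D_xi assms by (simp add: K_0)
qed

lemma Drs01:
  assumes "bd a" "i \<in> Y0 m" "k \<in> Y1 m n" "u \<subseteq> Y1 m n" "odd (card u)"
  shows "fld k (D i (mv (a, u))) + fld i (D k (mv (a, u))) \<in> K"
proof (cases "a i")
  case 0
  then show ?thesis using type1_D assms by (simp add: D_mv_P0 D_mv_P1)
next
  case (Suc x)
  have fin: "finite u" using assms(4) finite_subset finite_Y(3) by blast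
  show ?thesis
  proof (cases "u = {k}")
    case True
    then show ?thesis using sigma[OF assms(1-3) Suc] assms Suc by (simp add: D_mv_P0 D_mv_P1 D_xi_single)
  next
    case False
    then obtain l where l: "l \<in> u" "l \<noteq> k" using assms(5) by (metis card.empty even_zero is_singletonI' is_singleton_def singletonD subset_eq subset_singletonD insertE emptyE)
    define w where "w = u - {l}"
    have w: "w \<subseteq> Y1 m n" "l \<in> Y1 m n" "l \<notin> w" "even (card w)"
      using assms l fin by (auto simp: w_def card_Diff_singleton)
    obtain c where c: "c \<noteq> 0" "xi u = scaleA c (xi w \<odot> xi {l})"
      using xi_split[OF assms(4) l(1)] w_def by blast
    have "P k (a(i := x)) (xi w \<odot> xi {l}) + P i a (D k (xi w \<odot> xi {l})) \<in> K"
      by (rule type3) (use assms w l Suc in auto)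
    then have "scaleW c (P k (a(i := x)) (xi w \<odot> xi {l}) + P i a (D k (xi w \<odot> xi {l}))) \<in> K" by (rule K_scale)
    then show ?thesis using assms Suc by (simp add: D_mv_P0 D_mv_P1 c(2) D_scale P_scale scaleW_add)
  qed
qed

lemma P_D_odd:
  assumes "bd a" "k \<in> Y1 m n" "u \<subseteq> Y1 m n" "even (card u)"
  shows "P k a (D k (xi u)) \<in> K"
proof (cases "k \<in> u")
  case True
  have "finite u" using assms(3) finite_subset finite_Y(3) by blast
  moreover have "card u \<noteq> 0" using True \<open>finite u\<close> by auto
  ultimately have "P k a (xi (u - {k})) \<in> K"
    by (intro type4) (use assms True in \<open>auto simp: card_Diff_singleton\<close>)
  then show ?thesis using D_xi_in[OF assms(2,3) True] by (simp add: P_scale K_scale)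
next
  case False
  then show ?thesis using D_xi assms by (simp add: K_0)
qed

lemma P_D_odd2:
  assumes "bd a" "k \<in> Y1 m n" "l \<in> Y1 m n" "l \<notin> u" "k \<noteq> l" "u \<subseteq> Y1 m n" "even (card u)"
  shows "P l a (D k (xi u)) \<in> K"
proof (cases "k \<in> u")
  case True
  have "finite u" using assms(6) finite_subset finite_Y(3) by blast
  moreover have "card u \<noteq> 0" using True \<open>finite u\<close> by auto
  ultimately have "P l a (xi (u - {k})) \<in> K"
    by (intro type4) (use assms True in \<open>auto simp: card_Diff_singleton\<close>)
  then show ?thesis using D_xi_in[OF assms(2,6) True] by (simp add: P_scale K_scale)
next
  case False
  then show ?thesis using D_xi assms by (simp add: K_0)
qed

text \<open>Unless both odd variables occur in \<open>u\<close>, at least one summand vanishes or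
  the two coincide, and the earlier families apply. If both occur, write \<xi>_u as a multiple of
  \<xi>_k \<xi>_l \<xi>_w; the sum is then a multiple of
  [x^(a) \<xi>_k \<xi>_w D_l, \<xi>_l D_k].\<close>

lemma Drs11:
  assumes "bd a" "k \<in> Y1 m n" "l \<in> Y1 m n" "u \<subseteq> Y1 m n" "even (card u)"
  shows "P l a (D k (xi u)) + P k a (D l (xi u)) \<in> K"
proof -
  consider "k = l" | "k \<noteq> l" "l \<notin> u" | "k \<noteq> l" "k \<notin> u" | "k \<noteq> l" "k \<in> u" "l \<in> u" by blast
  then show ?thesis
  proof cases
    case 1
    show ?thesis unfolding 1 by (rule K_add; rule P_D_odd[OF assms(1,3,4,5)])
  next
    case 2
    then show ?thesis using P_D_odd2[of a k l u] D_xi assms by simp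
  next
    case 3
    then show ?thesis using P_D_odd2[of a l k u] D_xi assms by simp
  next
    case 4
    have fin: "finite u" using assms(4) finite_subset finite_Y(3) by blast
    define w where "w = u - {l, k}"
    have uw: "u - {l} - {k} = w" "u - {l} - {k} \<subseteq> Y1 m n" using assms by (auto simp: w_def)
    have w: "w \<subseteq> Y1 m n" "k \<notin> w" "l \<notin> w" using assms by (auto simp: w_def)
    have cw: "even (card w)"
    proof -
      have "card u = Suc (Suc (card w))"
        using card_Suc_Diff1[OF fin 4(3)] card_Suc_Diff1[of "u - {l}" k] 4 fin unfolding uw(1) by simp
      then show ?thesis using assms(5) by simp
    qed
    have lw: "lam 0 (xi w)" by (rule lam_xi) (use w cw in auto)
    have lkw: "lam 1 (xi {k} \<odot> xi w)" "lam 1 (xi {l} \<odot> xi w)"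
      by (rule lam_mul[OF lam_xi1 lw]; use assms in simp)+
    obtain c where c: "c \<noteq> 0" "xi u = scaleA c (xi {k} \<odot> (xi {l} \<odot> xi w))"
    proof -
      have m1: "xi {l} \<odot> xi w = scaleA ((-1) ^ inversions {l} w) (xi ({l} \<union> w))"
        by (rule xi_mult) (use assms w in auto)
      have m2: "xi {k} \<odot> xi ({l} \<union> w) = scaleA ((-1) ^ inversions {k} ({l} \<union> w)) (xi ({k} \<union> ({l} \<union> w)))"
        by (rule xi_mult) (use assms w 4 in auto)
      have "{k} \<union> ({l} \<union> w) = u" using 4 by (auto simp: w_def)
      then have e: "xi {k} \<odot> (xi {l} \<odot> xi w) = scaleA ((-1) ^ inversions {l} w * (-1) ^ inversions {k} ({l} \<union> w)) (xi u)"
        using m1 m2 by (simp add: mul_scale_right)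
      define d :: 'a where "d = (-1) ^ inversions {l} w * (-1) ^ inversions {k} ({l} \<union> w)"
      have d: "d \<noteq> 0" by (simp add: d_def)
      have "xi u = scaleA (inverse d) (xi {k} \<odot> (xi {l} \<odot> xi w))" using e d unfolding d_def[symmetric] by simp
      then show ?thesis using that d by (metis inverse_nonzero_iff_nonzero)
    qed
    have 0: "D k (xi w) = 0" "D l (xi w) = 0" "D k (xi {l}) = 0" "D l (xi {k}) = 0"
      using D_xi w assms 4 by auto
    have hom: "homog 1 (xi {k})" "homog 1 (xi {l})" using lam_xi1 lamD assms by blast+
    have xA: "xi {k} \<in> AA" "xi {l} \<in> AA" "xi w \<in> AA" using xi_AA w assms by auto
    have L: "D k (xi {l} \<odot> xi w) = 0" "D l (xi {l} \<odot> xi w) = xi w" "D k (xi {k} \<odot> xi w) = xi w"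
      using D_mul[OF Y1_sub[OF assms(2)] xA(2,3) hom(2)] D_mul[OF Y1_sub[OF assms(3)] xA(2,3) hom(2)]
        D_mul[OF Y1_sub[OF assms(2)] xA(1,3) hom(1)] xA by (simp_all add: 0 D_xi_single assms)
    have Dk: "D k (xi {k} \<odot> (xi {l} \<odot> xi w)) = xi {l} \<odot> xi w"
      using D_mul[OF Y1_sub[OF assms(2)] xA(1) _ hom(1), of "xi {l} \<odot> xi w"] xA L by (simp add: D_xi_single assms)
    have Dl: "D l (xi {k} \<odot> (xi {l} \<odot> xi w)) = - (xi {k} \<odot> xi w)"
      using D_mul[OF Y1_sub[OF assms(3)] xA(1) _ hom(1), of "xi {l} \<odot> xi w"] xA L by (simp add: 0 assms)
    have 1: "P l a (xi {k} \<odot> xi w) \<in> K"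
    proof -
      have "xi {k} \<odot> xi w = scaleA ((-1) ^ inversions {k} w) (xi ({k} \<union> w))"
        by (rule xi_mult) (use assms w in auto)
      moreover have "P l a (xi ({k} \<union> w)) \<in> K"
        by (rule type4) (use assms w 4 cw fin finite_subset[OF w(1) finite_Y(3)] in auto)
      ultimately show ?thesis by (simp add: P_scale K_scale)
    qed
    obtain i where i: "i \<in> Y0 m" using Y0_third by blast
    have A: "XO a (xi {k} \<odot> xi w) \<odot> D l (XO (\<lambda>_. 0) (xi {l})) =
        scaleA (of_nat (a i + (\<lambda>_. 0) i choose a i)) (XO a ((xi {k} \<odot> xi w) \<odot> D l (xi {l})))"
      by (rule XD2) (use assms lkw lam_xi1 i in auto)
    have B: "XO (\<lambda>_. 0) (xi {l}) \<odot> D k (XO a (xi {k} \<odot> xi w)) =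
        scaleA (of_nat ((\<lambda>_. 0) i + a i choose (\<lambda>_. 0) i)) (XO a (xi {l} \<odot> D k (xi {k} \<odot> xi w)))"
      by (rule XD2) (use assms lkw lam_xi1 i in auto)
    have "br (P l a (xi {k} \<odot> xi w)) (P k (\<lambda>_. 0) (xi {l})) = P k a (xi {k} \<odot> xi w) - P l a (xi {l} \<odot> xi w)"
      unfolding brP[OF Y1_sub[OF assms(3)] Y1_sub[OF assms(2)]] A B L using assms xA
      by (simp add: P_def D_xi_single)
    then have "P k a (xi {k} \<odot> xi w) - P l a (xi {l} \<odot> xi w) \<in> K"
      using K_br[OF 1 g2[of l k]] assms 4 by simp
    then have "scaleW (- c) (P k a (xi {k} \<odot> xi w) - P l a (xi {l} \<odot> xi w)) \<in> K" by (rule K_scale)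
    then show ?thesis unfolding c(2) D_scale Dk Dl
      by (simp add: P_scale P_minus scaleW_diff scaleW_left_minus)
  qed
qed

theorem calS_subset: "calS p m n t \<subseteq> K"
proof
  fix E :: "'a wvec" assume "E \<in> calS p m n t"
  then show "E \<in> K"
  proof (rule calS_induct[OF _ K_subspace])
    fix r s b a u
    assume rs: "r \<in> Y m n" "s \<in> Y m n" and b: "b = (tau m r + tau m s) mod 2" and a: "bd a" and
      u: "u \<subseteq> Y1 m n" "card u mod 2 = b"
    show "Drs p m n t r s b (mv (a, u)) \<in> K"
    proof (rule Y_cases[OF rs(1)]; rule Y_cases[OF rs(2)])
      assume r: "r \<in> Y0 m" and s: "s \<in> Y0 m"
      have ev: "even (card u)" using b u r s by auto
      have *: "Drs p m n t r s b (mv (a, u)) = fld s (D r (mv (a, u))) - fld r (D s (mv (a, u)))"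
        using b r s by (simp add: Drs_fld)
      show ?thesis
      proof (cases "r = s")
        case True
        then show ?thesis using * K_0 by simp
      next
        case False
        have psub: "u \<subset> Y1 m n \<or> a q < p ^ t q" if "q \<in> Y0 m" for q using a that by (auto simp: bd_iff)
        show ?thesis
        proof (cases "a r = 0 \<or> a s = 0")
          case True
          have *: "P q (a(q' := a q' - 1)) (xi u) \<in> K" if q: "q \<in> Y0 m" "q' \<in> Y0 m" "q \<noteq> q'" "a q = 0" "a q' \<noteq> 0" for q q'
          proof (rule type1_aux)
            have "a q' < p ^ t q'" using a q by (auto simp: bd_iff)
            then show "bd (a(q' := a q' - 1))" by (intro bd_upd a q) simp
            show "\<exists>l\<in>Y0 m. l \<noteq> q \<and> Suc ((a(q' := a q' - 1)) l) < p ^ t l"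
              using q \<open>a q' < p ^ t q'\<close> by (intro bexI[of _ q']) auto
          qed (use q u ev in auto)
          have "0 - P r (a(s := a s - 1)) (xi u) \<in> K" if "a r = 0" "a s \<noteq> 0"
            using *[of r s] that r s False K_diff[OF K_0] by simp
          then show ?thesis
            using True *[of s r] r s False K_0 u(1) a
            by (auto simp: \<open>Drs p m n t r s b (mv (a, u)) = _\<close> D_mv_P0)
        next
          case nz: False
          then obtain x y where xy: "a r = Suc x" "a s = Suc y" by (metis not0_implies_Suc)
          show ?thesis unfolding *
            using type2[OF a r s False xy u(1) ev] xy a u r s by (simp add: D_mv_P0)
        qed
      qed
    next
      assume r: "r \<in> Y0 m" and s: "s \<in> Y1 m n"
      have ev: "odd (card u)" and "b = 1" using b u r s by auto
      then have *: "Drs p m n t r s b (mv (a, u)) = fld s (D r (mv (a, u))) + fld r (D s (mv (a, u)))"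
        using r s by (simp add: Drs_fld fld_simps)
      show ?thesis unfolding * by (rule Drs01[OF a r s u(1) ev])
    next
      assume r: "r \<in> Y1 m n" and s: "s \<in> Y0 m"
      have ev: "odd (card u)" and "b = 1" using b u r s by auto
      then have *: "Drs p m n t r s b (mv (a, u)) = fld r (D s (mv (a, u))) + fld s (D r (mv (a, u)))"
        using r s by (simp add: Drs_fld fld_simps)
      show ?thesis unfolding * by (rule Drs01[OF a s r u(1) ev])
    next
      assume r: "r \<in> Y1 m n" and s: "s \<in> Y1 m n"
      have ev: "even (card u)" and "b = 0" using b u r s by auto
      then have *: "Drs p m n t r s b (mv (a, u)) = - (P s a (D r (xi u)) + P r a (D s (xi u)))"
        using r s a u(1) by (simp add: Drs_fld fld_simps D_mv_P1)
      show ?thesis unfolding * using Drs11[OF a r s u(1) ev] by (rule K_minus)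
    qed
  qed
qed

end

lemma ex_upd: "(ex q s)(q := v) = ex q v"
  by (simp add: ex_def)

lemma wv_apply:
  "(E + F :: 'a::field wvec) r = E r + F r" "(E - F :: 'a::field wvec) r = E r - F r" "(0 :: 'a::field wvec) r = 0"
  by (simp_all add: papply)

lemma wv_sum: "(\<Sum>i\<in>I. (f i :: 'a::field wvec)) r = (\<Sum>i\<in>I. f i r)"
  by (rule sum_fun_apply)

context special_lie
begin

section \<open>The torus and the weights\<close>

definition wt :: "nat \<Rightarrow> mon \<Rightarrow> nat" where
  "wt q X = (if q \<in> Y0 m then fst X q else if q \<in> snd X then 1 else 0)"

lemma xgen_XO: "q \<in> Y0 m \<Longrightarrow> xgen m q = XO (ex q 1) (xi {})" "q \<in> Y1 m n \<Longrightarrow> xgen m q = XO (\<lambda>_. 0) (xi {q})"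
proof -
  assume "q \<in> Y0 m"
  then show "xgen m q = XO (ex q 1) (xi {})"
    using bd_ex p_pow_gt1 by (simp add: xgen_def XO_xi ex_def)
next
  assume "q \<in> Y1 m n"
  then show "xgen m q = XO (\<lambda>_. 0) (xi {q})"
    using Y0_Y1(2)[of q] by (simp add: xgen_def XO_xi)
qed

lemma Gam_fld: "Gam m q = fld q (xgen m q)"
  by (simp add: Gam_def fld_def)

lemma Gam_WW [simp]:
  assumes "q \<in> Y m n"
  shows "(Gam m q :: 'a wvec) \<in> WW"
  using assms
proof (rule Y_cases)
  assume "q \<in> Y0 m"
  then show ?thesis using P_WW0[OF _ lam_one, of q "ex q 1"] by (simp add: Gam_fld xgen_XO P_def)
next
  assume "q \<in> Y1 m n"
  then show ?thesis using P_WW1[OF _ lam_xi1, of q q "\<lambda>_. 0"] by (simp add: Gam_fld xgen_XO P_def)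
qed

lemma act_Gam_mv:
  assumes "q \<in> Y m n" "bd a" "u \<subseteq> Y1 m n"
  shows "act (Gam m q) (mv (a, u)) = scaleA (of_nat (wt q (a, u))) (mv (a, u))"
  using assms(1)
proof (rule Y_cases)
  assume q: "q \<in> Y0 m"
  have lu: "lam (card u mod 2) (xi u)" by (rule lam_xi) (use assms in auto)
  have bx: "bd (ex q 1)" using bd_ex q p_pow_gt1 by auto
  have "XO (ex q 1) (xi {}) \<odot> D q (XO a (xi u)) = scaleA (of_nat (a q)) (XO a (xi u))"
  proof (cases "a q")
    case 0
    then show ?thesis using XD0[OF assms(2) lu q] by simp
  next
    case (Suc x)
    have "XO (ex q 1) (xi {}) \<odot> D q (XO a (xi u)) = scaleA (of_nat (ex q 1 q + x choose ex q 1 q)) (XO a (xi {} \<odot> xi u))"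
      by (rule XD1) (use bx assms lu lam_one q Suc in auto)
    then show ?thesis using Suc assms by (simp add: xi_AA)
  qed
  then show ?thesis using assms q by (simp add: Gam_fld act_fld xgen_XO XO_xi wt_def)
next
  assume q: "q \<in> Y1 m n"
  have lu: "lam (card u mod 2) (xi u)" by (rule lam_xi) (use assms in auto)
  obtain i where i: "i \<in> Y0 m" using Y0_third by blast
  have "XO (\<lambda>_. 0) (xi {q}) \<odot> D q (XO a (xi u)) =
      scaleA (of_nat ((\<lambda>_. 0) i + a i choose (\<lambda>_. 0) i)) (XO a (xi {q} \<odot> D q (xi u)))"
    by (rule XD2) (use assms q lu lam_xi1 i in auto)
  moreover have "xi {q} \<odot> D q (xi u) = (if q \<in> u then xi u else 0)"
  proof (cases "q \<in> u")
    case True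
    have fin: "finite u" using assms(3) finite_subset finite_Y(3) by blast
    have "xi {q} \<odot> xi (u - {q}) = scaleA ((-1) ^ inversions {q} (u - {q})) (xi ({q} \<union> (u - {q})))"
      by (rule xi_mult) (use assms q in auto)
    moreover have "{q} \<union> (u - {q}) = u" using True by auto
    moreover have "inversions {q} (u - {q}) = card {l \<in> u. l < q}"
    proof -
      have "{l \<in> u - {q}. l < q} = {l \<in> u. l < q}" by auto
      then show ?thesis using inversions_insert1[of "{}" "u - {q}" q] fin by (simp add: inversions_def)
    qed
    ultimately show ?thesis using D_xi_in[OF q assms(3) True] True
      by (simp add: mul_scale_right flip: power_mult_distrib)
  next
    case False
    then show ?thesis using D_xi[OF q assms(3)] by simp
  qed
  ultimately show ?thesis using assms q Y0_Y1(2)[OF q] by (simp add: Gam_fld act_fld xgen_XO XO_xi wt_def)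
qed

lemma act_Gam:
  assumes "q \<in> Y m n" "f \<in> AA"
  shows "act (Gam m q) f X = of_nat (wt q X) * f X"
  using assms(2) True_all
proof (induction f rule: AA_induct[where Q="\<lambda>_. True"])
  case zero
  have "act (Gam m q) 0 X = of_nat (wt q X) * (0 :: 'a alg) X" by (simp add: papply)
  then show ?case .
next
  case (step c y f)
  have "act (Gam m q) (mv y) = scaleA (of_nat (wt q y)) (mv y)"
    using act_Gam_mv[OF assms(1), of "fst y" "snd y"] step(1) by (cases y) (simp add: bd_MM)
  then have "act (Gam m q) (mv y) X = of_nat (wt q X) * mv y X" by (simp add: scaleA_def monvec_def)
  then have "act (Gam m q) (scaleA c (mv y) + f) X = of_nat (wt q X) * (scaleA c (mv y) + f) X"
    using step(5) by (simp add: act_add act_scale papply scaleA_apply algebra_simps)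
  then show ?case .
qed

lemma act_xgen:
  assumes "E \<in> WW" "q \<in> Y m n"
  shows "act E (xgen m q) = E q"
proof -
  have "D r (xgen m q) = (if r = q then xi {} else 0)" if r: "r \<in> Y m n" for r
    using assms(2)
  proof (rule Y_cases)
    assume q: "q \<in> Y0 m"
    have bx: "bd (ex q (Suc 0))" using bd_ex q p_pow_gt1 by auto
    show ?thesis
      by (rule Y_cases[OF r])
        (use q Y0_Y1 in \<open>auto simp: xgen_XO D_XO0[OF bx lam_one] D_XO1[OF bx] xi_AA XO_zero ex_upd\<close>)
  next
    assume q: "q \<in> Y1 m n"
    then have "xgen m q = xi {q}" by (simp add: xgen_XO XO_zero xi_AA)
    then show ?thesis using q Y0_Y1(1) D_xi[of r "{q}"] D_xi_single[OF q] lamD(2)[OF lam_xi1[OF q]]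
      by (auto intro: Y_cases[OF r])
  qed
  then have "act E (xgen m q) = (\<Sum>r\<in>Y m n. if r = q then E q else 0)"
    unfolding act_def using WW_D(1)[OF assms(1)] by (intro sum.cong) auto
  then show ?thesis using assms(2) by simp
qed

text \<open>The eigenvalue of ad \<Gamma>_q on the monomial field with coefficient \<open>X\<close>
  along D_s. It is taken in the field, so exponents count only modulo p.\<close>

definition wtv :: "nat \<Rightarrow> nat \<Rightarrow> mon \<Rightarrow> 'a" where
  "wtv q s X = of_nat (wt q X) - (if q = s then 1 else 0)"

lemma br_Gam:
  assumes "q \<in> Y m n" "E \<in> WW"
  shows "br (Gam m q) E s X = wtv q s X * E s X"
proof -
  have "act E (Gam m q s) = (if q = s then E s else 0)"
    using act_xgen[OF assms(2,1)] by (auto simp: Gam_def)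
  then have "br (Gam m q) E s X = of_nat (wt q X) * E s X - (if q = s then E s X else 0)"
    using act_Gam[OF assms(1) WW_D(1)[OF assms(2)]] by (simp add: br_def papply)
  then show ?thesis by (cases "q = s") (simp_all add: wtv_def left_diff_distrib)
qed

lemma Dvec_P: "Dvec i = P i (\<lambda>_. 0) (xi {})"
  by (simp add: Dvec_def P_def XO_xi fld_def fun_eq_iff)

lemma Dvec_WW [simp]: "i \<in> Y0 m \<Longrightarrow> (Dvec i :: 'a wvec) \<in> WW"
  using P_WW0[OF _ lam_one] by (simp add: Dvec_P)

lemma act_xi_one [simp]: "act E (xi {}) = 0"
  unfolding act_def
proof (rule sum.neutral, intro ballI)
  fix r assume "r \<in> Y m n"
  then have "D r (xi {}) = 0" using lamD(2)[OF lam_one] D_one by (auto intro: Y_cases)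
  then show "E r \<odot> D r (xi {}) = 0" by simp
qed

lemma br_Dvec:
  assumes "i \<in> Y0 m" "E \<in> WW"
  shows "br (Dvec i) E s = D i (E s)"
proof -
  have "act E (Dvec i s) = 0" by (simp add: Dvec_P P_def fld_def XO_zero xi_AA)
  moreover have "act (Dvec i) (E s) = D i (E s)"
    using assms by (simp add: Dvec_P P_def XO_zero xi_AA act_fld Y0_sub)
  ultimately show ?thesis by (simp add: br_def)
qed

definition hh :: "nat \<Rightarrow> nat \<Rightarrow> 'a wvec" where "hh i k = Gam m i + Gam m k"

lemma hh_WW [simp]: "i \<in> Y0 m \<Longrightarrow> k \<in> Y1 m n \<Longrightarrow> hh i k \<in> WW"
  by (simp add: hh_def Y0_sub Y1_sub)

lemma br_hh:
  assumes "i \<in> Y0 m" "k \<in> Y1 m n" "E \<in> WW"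
  shows "br (hh i k) E s X = (wtv i s X + wtv k s X) * E s X"
  using br_Gam[OF Y0_sub[OF assms(1)] assms(3)] br_Gam[OF Y1_sub[OF assms(2)] assms(3)]
  by (simp add: hh_def br_add_left papply algebra_simps)

section \<open>The divergence\<close>

lemma minus_one_tau_sq: "(-1) ^ (tau m r * tau m r) = ((-1) ^ tau m r :: 'a)"
  by (simp add: tau_def)

lemma divW_eq:
  assumes "E \<in> WW"
  shows "divW p m n t E = (\<Sum>r\<in>Y m n. scaleA ((-1) ^ tau m r) (D r (E r)))"
proof
  fix X
  have two: "{..<2::nat} = {0, 1}" by auto
  have "(\<Sum>b<2. (-1) ^ (tau m r * b) * D r (part b (E r)) X) = scaleA ((-1) ^ tau m r) (D r (E r)) X" for r
    by (cases "r \<in> Y0 m") (simp_all add: two part_WW[OF assms] tau_def papply scaleA_def)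
  then show "divW p m n t E X = (\<Sum>r\<in>Y m n. scaleA ((-1) ^ tau m r) (D r (E r))) X"
    by (simp add: divW_def sum_fun_apply)
qed

lemma divW_add: "E \<in> WW \<Longrightarrow> F \<in> WW \<Longrightarrow> divW p m n t (E + F) = divW p m n t E + divW p m n t F"
  by (simp add: divW_eq papply D_add scaleA_add sum.distrib)

lemma divW_scale: "E \<in> WW \<Longrightarrow> divW p m n t (scaleW c E) = scaleA c (divW p m n t E)"
  by (simp add: divW_eq scaleW_alt D_scale scaleA_sum mult.commute)

lemma divW_0: "divW p m n t (0 :: 'a wvec) = 0"
  by (simp add: divW_eq papply)

lemma calSbar_iff: "E \<in> calSbar p m n t \<longleftrightarrow> E \<in> WW \<and> divW p m n t E = 0"
  by (simp add: calSbar_def)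

lemma divW_fld:
  assumes "r \<in> Y m n"
  shows "(\<Sum>q\<in>Y m n. scaleA ((-1) ^ tau m q) (D q (fld r f q))) = scaleA ((-1) ^ tau m r) (D r f)"
proof -
  have "(\<Sum>q\<in>Y m n. scaleA ((-1) ^ tau m q) (D q (fld r f q))) =
      (\<Sum>q\<in>Y m n. if q = r then scaleA ((-1) ^ tau m r) (D r f) else 0)"
    by (rule sum.cong) (auto simp: fld_def)
  then show ?thesis using assms by simp
qed

lemma tau_sign1: "(-1) ^ ((tau m r + tau m s) * ((tau m r + tau m s) mod 2)) = ((-1) ^ (tau m r + tau m s) :: 'a)"
  by (simp add: tau_def)

lemma tau_sq [simp]: "(-1) ^ tau m r * (-1) ^ tau m r = (1 :: 'a)"
  by (simp add: tau_def)

lemma Drs_div: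
  assumes "r \<in> Y m n" "s \<in> Y m n" "f \<in> AA" "homog b f" "b = (tau m r + tau m s) mod 2"
  shows "divW p m n t (Drs p m n t r s b f) = 0"
proof -
  have W: "Drs p m n t r s b f \<in> WW" by (rule Drs_even) (use assms in auto)
  have "divW p m n t (Drs p m n t r s b f) =
      scaleA ((-1) ^ tau m s * (-1) ^ (tau m r * tau m s)) (D s (D r f)) -
      scaleA ((-1) ^ tau m r * (-1) ^ (tau m r + tau m s)) (D r (D s f))"
    unfolding divW_eq[OF W] unfolding Drs_fld wv_apply assms(5) tau_sign1
    by (simp add: D_diff scaleA_diff sum_subtractf divW_fld assms D_scale)
  also have "\<dots> = 0"
    using D_comm[OF assms(2,1,3)] by (simp add: power_add tau_def)
  finally show ?thesis .
qed

lemma calS_sub_Sbar: "calS p m n t \<subseteq> (calSbar p m n t :: 'a wvec set)"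
proof
  fix E :: "'a wvec" assume "E \<in> calS p m n t"
  moreover have "W.subspace {E \<in> WW. divW p m n t E = 0}"
    by (simp add: W.subspace_def divW_0 divW_add divW_scale)
  ultimately have "E \<in> {E \<in> WW. divW p m n t E = 0}"
  proof (rule calS_induct)
    fix r s b a u
    assume "r \<in> Y m n" "s \<in> Y m n" "b = (tau m r + tau m s) mod 2" "bd a" "u \<subseteq> Y1 m n" "card u mod 2 = b"
    moreover from this have "mv (a, u) \<in> AA" "homog b (mv (a, u))" by (simp_all add: bd_MM par_def)
    ultimately show "Drs p m n t r s b (mv (a, u)) \<in> {E \<in> WW. divW p m n t E = 0}"
      using Drs_even Drs_div by simp
  qed
  then show "E \<in> calSbar p m n t" by (simp add: calSbar_iff)
qed

lemma Sset_Drs: "r \<in> Y m n \<Longrightarrow> s \<in> Y m n \<Longrightarrow> b < 2 \<Longrightarrow> f \<in> AA \<Longrightarrow> homog b f \<Longrightarrow> Drs p m n t r s b f \<in> Sset p m n t"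
  unfolding Sset_def by (rule W.span_base) blast

lemma Sset_subspace: "W.subspace (Sset p m n t :: 'a wvec set)"
  by (simp add: Sset_def W.subspace_span)

text \<open>Divergence-free fields \<open>E\<close>, \<open>F\<close> satisfy \<open>[E, F] = \<Sum> \<plusminus> D\<^sub>r\<^sub>q(E\<^sub>r F\<^sub>q)\<close>.\<close>
lemma br_Sbar:
  assumes "E \<in> calSbar p m n t" "F \<in> calSbar p m n t"
  shows "(br E F :: 'a wvec) \<in> calS p m n t"
proof -
  have E: "E \<in> WW" and F: "F \<in> WW" and dE: "divW p m n t E = 0" and dF: "divW p m n t F = 0"
    using assms by (simp_all add: calSbar_iff)
  define G where "G r q = E r \<odot> F q" for r q
  define b where "b r q = (tau m r + tau m q) mod 2" for r q
  define c :: "nat \<Rightarrow> nat \<Rightarrow> 'a" where "c r q = (-1) ^ tau m r * (-1) ^ (tau m r * tau m q)" for r q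
  have ED: "E r \<odot> D r (H s) = scaleA ((-1) ^ tau m r) (D r (E r \<odot> H s)) - scaleA ((-1) ^ tau m r) (D r (E r)) \<odot> H s"
    if "E \<in> WW" "H \<in> WW" "r \<in> Y m n" for E H r s
  proof -
    have "D r (E r \<odot> H s) = D r (E r) \<odot> H s + scaleA ((-1) ^ tau m r) (E r \<odot> D r (H s))"
      using D_mul[OF that(3) WW_D(1)[OF that(1)] WW_D(1)[OF that(2)] WW_D(2)[OF that(1)]]
      by (simp add: minus_one_tau_sq)
    then show ?thesis by (simp add: scaleA_add mul_scale_left)
  qed
  have act: "act E (H s) = (\<Sum>r\<in>Y m n. scaleA ((-1) ^ tau m r) (D r (E r \<odot> H s)))"
    if "E \<in> WW" "H \<in> WW" "divW p m n t E = 0" for E H s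
  proof -
    have "act E (H s) = (\<Sum>r\<in>Y m n. scaleA ((-1) ^ tau m r) (D r (E r \<odot> H s))) -
        (\<Sum>r\<in>Y m n. scaleA ((-1) ^ tau m r) (D r (E r)) \<odot> H s)"
      unfolding act_def by (simp add: ED[OF that(1,2)] sum_subtractf cong: sum.cong)
    also have "(\<Sum>r\<in>Y m n. scaleA ((-1) ^ tau m r) (D r (E r)) \<odot> H s) = divW p m n t E \<odot> H s"
      unfolding divW_eq[OF that(1)] by (simp add: mul_sum_left)
    finally show ?thesis using that(3) by simp
  qed
  have "F r \<odot> E s = scaleA ((-1) ^ (tau m s * tau m r)) (G s r)" for r s
    unfolding G_def by (rule mul_comm[OF WW_D(1)[OF E] WW_D(1)[OF F] WW_D(2)[OF E] WW_D(2)[OF F]])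
  then have brs: "br E F s = (\<Sum>r\<in>Y m n. scaleA ((-1) ^ tau m r) (D r (G r s)) -
      scaleA (c r s) (D r (G s r)))" for s
    unfolding br_def act[OF E F dE] act[OF F E dF] G_def[symmetric]
    by (simp add: D_scale sum_subtractf c_def mult.commute)
  have Drs: "scaleW (c r q) (Drs p m n t r q (b r q) (G r q)) =
      fld q (scaleA ((-1) ^ tau m r) (D r (G r q))) - fld r (scaleA (c q r) (D q (G r q)))" for r q
  proof -
    have "c r q * (-1) ^ (tau m r * tau m q) = (-1) ^ tau m r" "c r q * (-1) ^ (tau m r + tau m q) = c q r"
      by (simp_all add: c_def tau_def)
    then show ?thesis unfolding Drs_fld b_def tau_sign1
      by (simp add: fld_simps scaleW_diff)
  qed
  have "br E F = (\<Sum>r\<in>Y m n. \<Sum>q\<in>Y m n. scaleW (c r q) (Drs p m n t r q (b r q) (G r q)))"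
  proof
    fix s
    show "br E F s = (\<Sum>r\<in>Y m n. \<Sum>q\<in>Y m n. scaleW (c r q) (Drs p m n t r q (b r q) (G r q))) s"
    proof (cases "s \<in> Y m n")
      case True
      have "(\<Sum>r\<in>Y m n. \<Sum>q\<in>Y m n. scaleW (c r q) (Drs p m n t r q (b r q) (G r q))) s =
        (\<Sum>r\<in>Y m n. \<Sum>q\<in>Y m n. (if q = s then scaleA ((-1) ^ tau m r) (D r (G r s)) else 0) -
          (if r = s then scaleA (c q s) (D q (G s q)) else 0))"
        unfolding wv_sum Drs wv_apply by (intro sum.cong refl) (auto simp: fld_def)
      also have "\<dots> = (\<Sum>r\<in>Y m n. scaleA ((-1) ^ tau m r) (D r (G r s))) -
          (\<Sum>q\<in>Y m n. \<Sum>r\<in>Y m n. (if r = s then scaleA (c q s) (D q (G s q)) else 0))"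
        unfolding sum_subtractf using True by (subst (3) sum.swap) simp
      also have "\<dots> = br E F s" unfolding brs using True by (simp add: sum_subtractf)
      finally show ?thesis by simp
    next
      case False
      have "scaleW (c r q) (Drs p m n t r q (b r q) (G r q)) s = 0" if "r \<in> Y m n" "q \<in> Y m n" for r q
        unfolding Drs wv_apply using that False by (auto simp: fld_def)
      then show ?thesis using False WW_D(3)[OF br_closed[OF E F]] by (simp add: wv_sum)
    qed
  qed
  moreover have "Drs p m n t r q (b r q) (G r q) \<in> Sset p m n t" if "r \<in> Y m n" "q \<in> Y m n" for r q
    unfolding G_def by (rule Sset_Drs[OF that _ AA_closed(6) homog_mul[OF WW_D(2)[OF E] WW_D(2)[OF F]]])
      (simp_all add: b_def)
  ultimately have "br E F \<in> Sset p m n t"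
    by (simp add: W.subspace_sum[OF Sset_subspace] W.subspace_scale[OF Sset_subspace])
  then show ?thesis using br_closed[OF E F] by (simp add: calS_def)
qed

lemma calS_br: "E \<in> calS p m n t \<Longrightarrow> F \<in> calS p m n t \<Longrightarrow> (br E F :: 'a wvec) \<in> calS p m n t"
  using br_Sbar calS_sub_Sbar by blast

lemma Drs_WW_mv:
  assumes "r \<in> Y m n" "s \<in> Y m n" "b = (tau m r + tau m s) mod 2" "bd a" "u \<subseteq> Y1 m n" "card u mod 2 = b"
  shows "Drs p m n t r s b (mv (a, u)) \<in> WW" "Drs p m n t r s b (mv (a, u)) \<in> calS p m n t"
proof -
  have "mv (a, u) \<in> AA" "homog b (mv (a, u))" using assms by (simp_all add: bd_MM par_def)
  then show "Drs p m n t r s b (mv (a, u)) \<in> WW" "Drs p m n t r s b (mv (a, u)) \<in> calS p m n t"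
    using Drs_even Sset_Drs assms by (simp_all add: calS_def)
qed

lemma wt_D:
  assumes "r \<in> Y m n" "q \<in> Y m n"
  shows "of_nat (wt q X) * D r (mv Z) X = (of_nat (wt q Z) - (if q = r then 1 else 0)) * D r (mv Z) X"
proof (cases "D r (mv Z) X = 0")
  case False
  then have M: "X \<in> MM" by (auto simp: Dop_def split: if_splits)
  show ?thesis using assms(1)
  proof (rule Y_cases)
    assume r: "r \<in> Y0 m"
    then have "Z = ((fst X)(r := fst X r + 1), snd X)"
      using False M by (auto simp: Dop_def monvec_def split: if_splits)
    then show ?thesis using r by (auto simp: wt_def)
  next
    assume r: "r \<in> Y1 m n"
    then have "Z = (fst X, insert r (snd X))" "r \<notin> snd X"
      using False M Y0_Y1(2)[OF r] by (auto simp: Dop_def monvec_def split: if_splits)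
    then show ?thesis using Y0_Y1(2)[OF r] by (auto simp: wt_def)
  qed
qed simp

text \<open>D_r lowers the weight of the monomial by one at r, and attaching D_s lowers it by one at
  s; the two summands of a D_rs-image therefore have the same weight. Hence the whole of
  \<open>calT\<close> normalizes S, although its elements need not have divergence 0.\<close>

lemma br_Gam_Drs:
  assumes "q \<in> Y m n" "r \<in> Y m n" "s \<in> Y m n" "b = (tau m r + tau m s) mod 2" "bd a" "u \<subseteq> Y1 m n" "card u mod 2 = b"
  shows "br (Gam m q) (Drs p m n t r s b (mv (a, u))) =
    scaleW (of_nat (wt q (a, u)) - (if q = r then 1 else 0) - (if q = s then 1 else 0)) (Drs p m n t r s b (mv (a, u)))"
proof (rule ext, rule ext)
  fix x X
  define C :: 'a where "C = of_nat (wt q (a, u)) - (if q = r then 1 else 0) - (if q = s then 1 else 0)"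
  have 1: "wtv q s X * D r (mv (a, u)) X = C * D r (mv (a, u)) X"
    using wt_D[OF assms(2,1), of X "(a, u)"] by (simp add: wtv_def C_def left_diff_distrib)
  have 2: "wtv q r X * D s (mv (a, u)) X = C * D s (mv (a, u)) X"
    using wt_D[OF assms(3,1), of X "(a, u)"] by (simp add: wtv_def C_def left_diff_distrib)
  have A: "wtv q x X * (if x = s then k * D r (mv (a, u)) X else 0) = C * (if x = s then k * D r (mv (a, u)) X else 0)" for k
    using 1 by (cases "x = s") (auto simp: mult.left_commute[of _ k])
  have B: "wtv q x X * (if x = r then k * D s (mv (a, u)) X else 0) = C * (if x = r then k * D s (mv (a, u)) X else 0)" for k
    using 2 by (cases "x = r") (auto simp: mult.left_commute[of _ k])
  show "br (Gam m q) (Drs p m n t r s b (mv (a, u))) x X = scaleW (of_nat (wt q (a, u)) - (if q = r then 1 else 0) - (if q = s then 1 else 0)) (Drs p m n t r s b (mv (a, u))) x X"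
    unfolding br_Gam[OF assms(1) Drs_WW_mv(1)[OF assms(2-7)]] scaleW_def C_def[symmetric]
    unfolding Drs_def right_diff_distrib A B ..
qed

lemma br_Gam_calS:
  assumes "q \<in> Y m n" "E \<in> calS p m n t"
  shows "br (Gam m q) E \<in> calS p m n t"
proof -
  have "W.subspace {E. br (Gam m q) E \<in> calS p m n t}"
    using calS_subspace by (simp add: W.subspace_def br_add_right br_scale_right)
  with assms(2) have "E \<in> {E. br (Gam m q) E \<in> calS p m n t}"
  proof (rule calS_induct)
    fix r s b a u
    assume *: "r \<in> Y m n" "s \<in> Y m n" "b = (tau m r + tau m s) mod 2" "bd a" "u \<subseteq> Y1 m n" "card u mod 2 = b"
    show "Drs p m n t r s b (mv (a, u)) \<in> {E. br (Gam m q) E \<in> calS p m n t}"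
      using br_Gam_Drs[OF assms(1) *] Drs_WW_mv(2)[OF *] calS_subspace by (simp add: W.subspace_scale)
  qed
  then show ?thesis by simp
qed

lemma calT_WW: "calT m n \<subseteq> WW"
proof -
  have "W.subspace WW" by (simp add: W.subspace_def)
  then show ?thesis unfolding calT_def by (intro W.span_minimal) auto
qed

lemma br_calT:
  assumes "G \<in> calT m n" "E \<in> calS p m n t"
  shows "(br G E :: 'a wvec) \<in> calS p m n t"
proof -
  have "W.subspace {G. br G E \<in> calS p m n t}"
    using calS_subspace by (simp add: W.subspace_def br_add_left br_scale_left)
  then have "calT m n \<subseteq> {G. br G E \<in> calS p m n t}"
    unfolding calT_def using br_Gam_calS assms(2) by (intro W.span_minimal) auto
  then show ?thesis using assms(1) by blast
qed


section \<open>Generators and centralizers\<close>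

abbreviation LL :: "'a wvec set" where "LL \<equiv> calS p m n t"

lemma LL_WW: "E \<in> LL \<Longrightarrow> E \<in> WW"
  using calS_WW by blast

lemma LL_closed: "0 \<in> LL" "E \<in> LL \<Longrightarrow> F \<in> LL \<Longrightarrow> E + F \<in> LL" "E \<in> LL \<Longrightarrow> F \<in> LL \<Longrightarrow> E - F \<in> LL"
  "E \<in> LL \<Longrightarrow> scaleW c E \<in> LL" "E \<in> LL \<Longrightarrow> F \<in> LL \<Longrightarrow> br E F \<in> LL"
  using calS_subspace by (simp_all add: W.subspace_0 W.subspace_add W.subspace_diff W.subspace_scale calS_br)

lemma P_xi: "bd a \<Longrightarrow> u \<subseteq> Y1 m n \<Longrightarrow> P s a (xi u) = fld s (mv (a, u))"
  by (simp add: P_def XO_xi)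

text \<open>The field is the D_qs-image of x_q x^(a) \<xi>_u for an auxiliary even variable x_q not
  occurring in it; the last hypothesis removes the other summand of that image.\<close>

lemma P_calS:
  assumes "s \<in> Y m n" "q \<in> Y0 m" "q \<noteq> s" "bd a" "a q = 0" "u \<subseteq> Y1 m n" "card u mod 2 = tau m s"
    and "D s (mv (a(q := 1), u)) = 0"
  shows "P s a (xi u) \<in> LL"
proof -
  have b: "bd (a(q := 1))" using bd_upd assms p_pow_gt1 by simp
  have "Drs p m n t q s (tau m s) (mv (a(q := 1), u)) \<in> LL"
    by (rule Drs_WW_mv(2)) (use assms b Y0_sub tau_less in auto)
  moreover have "Drs p m n t q s (tau m s) (mv (a(q := 1), u)) = P s a (xi u)"
  proof -
    have "(a(q := 1))(q := 0) = a" using assms(5) by auto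
    then have "fld s (D q (mv (a(q := 1), u))) = P s a (xi u)"
      using D_mv_P0[OF b assms(6,2), of s] by simp
    then show ?thesis using assms(2,8) by (simp add: Drs_fld fld_simps)
  qed
  ultimately show ?thesis by simp
qed

lemma D_mv_other0: "i \<in> Y0 m \<Longrightarrow> bd a \<Longrightarrow> u \<subseteq> Y1 m n \<Longrightarrow> a i = 0 \<Longrightarrow> D i (mv (a, u)) = 0"
  by (simp add: D_mv0 bd_MM)

lemma D_mv_other1: "k \<in> Y1 m n \<Longrightarrow> bd a \<Longrightarrow> u \<subseteq> Y1 m n \<Longrightarrow> k \<notin> u \<Longrightarrow> D k (mv (a, u)) = 0"
  by (simp add: D_mv1 bd_MM)

lemma Dvec_calS: "i \<in> Y0 m \<Longrightarrow> Dvec i \<in> LL"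
proof -
  assume i: "i \<in> Y0 m"
  obtain q where q: "q \<in> Y0 m" "q \<noteq> i" using Y0_third by blast
  have "bd ((\<lambda>_. 0)(q := 1))" using q p_pow_gt1 by (intro bd_upd) auto
  then show ?thesis unfolding Dvec_P
    by (intro P_calS[OF Y0_sub[OF i] q] D_mv_other0[OF i]) (use i q in auto)
qed

lemma G1_calS:
  assumes "i \<in> Y0 m" "j \<in> Y0 m" "i \<noteq> j" "s < p ^ t i"
  shows "P j (ex i s) (xi {}) \<in> LL"
proof -
  obtain q where q: "q \<in> Y0 m" "q \<noteq> i" "q \<noteq> j" using Y0_third by blast
  have b: "bd (ex i s)" using bd_ex assms by simp
  have "bd ((ex i s)(q := 1))" using q p_pow_gt1 b by (intro bd_upd) auto
  then show ?thesis
    by (intro P_calS[OF Y0_sub[OF assms(2)] q(1,3)] D_mv_other0[OF assms(2)] b) (use assms q in auto)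
qed

lemma G2_calS:
  assumes "k \<in> Y1 m n" "l \<in> Y1 m n" "k \<noteq> l"
  shows "P l (\<lambda>_. 0) (xi {k}) \<in> LL"
proof -
  obtain q where q: "q \<in> Y0 m" using Y0_third by blast
  have "bd ((\<lambda>_. 0)(q := 1))" using q p_pow_gt1 by (intro bd_upd) auto
  moreover have "q \<noteq> l" using q assms Y0_Y1 by auto
  ultimately show ?thesis
    by (intro P_calS[OF Y1_sub[OF assms(2)] q] D_mv_other1[OF assms(2)]) (use assms q in auto)
qed

lemma G3_calS:
  assumes "k \<in> Y1 m n" "l \<in> Y1 m n" "k \<noteq> l" "i \<in> Y0 m"
  shows "P i (\<lambda>_. 0) (xi {k, l}) \<in> LL"
proof -
  obtain q where q: "q \<in> Y0 m" "q \<noteq> i" using Y0_third by blast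
  have "bd ((\<lambda>_. 0)(q := 1))" using q p_pow_gt1 by (intro bd_upd) auto
  then show ?thesis
    by (intro P_calS[OF Y0_sub[OF assms(4)] q] D_mv_other0[OF assms(4)]) (use assms q in auto)
qed

lemma xi_pair: "k \<in> Y1 m n \<Longrightarrow> l \<in> Y1 m n \<Longrightarrow> k \<noteq> l \<Longrightarrow> xi {k} \<odot> xi {l} = scaleA ((-1) ^ inversions {k} {l}) (xi {k, l})"
  using xi_mult[of "{k}" "{l}"] by (simp add: insert_commute)

text \<open>The D_ik-image of x_i^(2) \<xi>_k. Its bracket with D_i is \<open>hh i k\<close>, which
  is how the torus elements are seen to lie in S.\<close>

definition EE :: "nat \<Rightarrow> nat \<Rightarrow> 'a wvec" where
  "EE i k = P i (ex i 2) (xi {}) + P k (ex i 1) (xi {k})"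

lemma EE_calS:
  assumes "i \<in> Y0 m" "k \<in> Y1 m n"
  shows "EE i k \<in> LL"
proof -
  have b: "bd (ex i 2)" using bd_ex assms p_pow_gt1 by simp
  have "Drs p m n t i k 1 (mv (ex i 2, {k})) \<in> LL"
    by (rule Drs_WW_mv(2)) (use assms b Y0_sub Y1_sub in auto)
  moreover have "Drs p m n t i k 1 (mv (ex i 2, {k})) = EE i k"
    using D_mv_P0[OF b _ assms(1), of "{k}" k] D_mv_P1[OF b _ assms(2), of "{k}" i] assms
    by (simp add: Drs_fld EE_def D_xi_single ex_upd fld_simps)
  ultimately show ?thesis by simp
qed

lemma br_Dvec_P:
  assumes "i \<in> Y0 m" "bd a" "lam c \<omega>" "P s a \<omega> \<in> WW"
  shows "br (Dvec i) (P s a \<omega>) = (if a i = 0 then 0 else P s (a(i := a i - 1)) \<omega>)"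
proof
  fix r
  show "br (Dvec i) (P s a \<omega>) r = (if a i = 0 then 0 else P s (a(i := a i - 1)) \<omega>) r"
    unfolding br_Dvec[OF assms(1,4)] using D_XO0[OF assms(2,3,1)]
    by (simp add: P_def fld_def wv_apply)
qed

lemma Gam_P0: "i \<in> Y0 m \<Longrightarrow> Gam m i = P i (ex i 1) (xi {})"
  and Gam_P1: "k \<in> Y1 m n \<Longrightarrow> Gam m k = P k (\<lambda>_. 0) (xi {k})"
  by (simp_all add: Gam_fld xgen_XO P_def)

lemma br_Dvec_EE:
  assumes "j \<in> Y0 m" "i \<in> Y0 m" "k \<in> Y1 m n"
  shows "br (Dvec j) (EE i k) = (if j = i then hh i k else 0)"
proof -
  have b: "bd (ex i 2)" "bd (ex i 1)" using bd_ex assms p_pow_gt1 by simp_all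
  show ?thesis
    unfolding EE_def br_add_right
      br_Dvec_P[OF assms(1) b(1) lam_one P_WW0[OF assms(2) lam_one]]
      br_Dvec_P[OF assms(1) b(2) lam_xi1[OF assms(3)] P_WW1[OF assms(3) lam_xi1[OF assms(3)]]]
    using assms by (simp add: hh_def Gam_P0 Gam_P1 ex_upd)
qed

lemma hh_calS: "i \<in> Y0 m \<Longrightarrow> k \<in> Y1 m n \<Longrightarrow> hh i k \<in> LL"
  using br_Dvec_EE[of i i k] LL_closed(5)[OF Dvec_calS EE_calS, of i i k] by simp

lemma br_Gam_fld:
  assumes "q \<in> Y m n" "fld s (mv Z) \<in> WW"
  shows "br (Gam m q) (fld s (mv Z)) = scaleW (wtv q s Z) (fld s (mv Z))"
proof (rule ext, rule ext)
  fix r X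
  show "br (Gam m q) (fld s (mv Z)) r X = scaleW (wtv q s Z) (fld s (mv Z)) r X"
    unfolding br_Gam[OF assms] by (auto simp: scaleW_def fld_def monvec_def papply)
qed

lemma wtv_simps:
  assumes "i \<in> Y0 m" "k \<in> Y1 m n"
  shows "wtv i s (a, u) = of_nat (a i) - (if i = s then 1 else 0)"
    "wtv k s (a, u) = (if k \<in> u then 1 else 0) - (if k = s then 1 else 0)"
  using assms Y0_Y1(2)[OF assms(2)] by (simp_all add: wtv_def wt_def)

text \<open>Annihilation by every even derivation leaves only terms \<xi>_u D_s without even
  variables. Their weights are differences of indicator values, so a comparison with \<chi>
  determines \<open>s\<close> and \<open>u\<close> in all cases below.\<close>

lemma weight_vector:
  assumes z: "z \<in> WW" and D: "\<forall>i\<in>Y0 m. br (Dvec i) z = 0"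
    and H: "\<forall>i\<in>Y0 m. \<forall>k\<in>Y1 m n. br (hh i k) z = scaleW (\<chi> i k) z"
    and nz: "z s (\<alpha>, u) \<noteq> 0"
  shows "s \<in> Y m n" "\<alpha> = (\<lambda>_. 0)" "u \<subseteq> Y1 m n" "card u mod 2 = tau m s"
    "\<And>i k. i \<in> Y0 m \<Longrightarrow> k \<in> Y1 m n \<Longrightarrow>
      (if k \<in> u then 1 else 0) - (if k = s then 1 else 0) - (if i = s then 1 else 0) = \<chi> i k"
proof -
  show s: "s \<in> Y m n"
    by (rule ccontr) (use WW_D(3)[OF z, of s] nz in \<open>simp add: papply\<close>)
  have M: "(\<alpha>, u) \<in> MM" using WW_D(1)[OF z, of s] nz unfolding AA_iff by blast
  then show u: "u \<subseteq> Y1 m n" by (simp add: bd_MM)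
  show "card u mod 2 = tau m s" using WW_D(2)[OF z, of s] nz unfolding homog_iff par_def by fastforce
  show a: "\<alpha> = (\<lambda>_. 0)"
  proof (rule ccontr)
    assume "\<alpha> \<noteq> (\<lambda>_. 0)"
    then obtain i where i: "\<alpha> i \<noteq> 0" by auto
    then have iY: "i \<in> Y0 m" using M by (auto simp: MM_iff)
    have "D i (z s) (\<alpha>(i := \<alpha> i - 1), u) = z s (\<alpha>, u)"
      using MM_lower[OF M, of i] iY i by (simp add: Dop_def)
    moreover have "D i (z s) = 0" using br_Dvec[OF iY z, of s] D iY by (simp add: wv_apply)
    ultimately show False using nz by (simp add: papply)
  qed
  fix i k assume ik: "i \<in> Y0 m" "k \<in> Y1 m n"
  have "(wtv i s (\<alpha>, u) + wtv k s (\<alpha>, u)) * z s (\<alpha>, u) = \<chi> i k * z s (\<alpha>, u)"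
  proof -
    have "br (hh i k) z = scaleW (\<chi> i k) z" using H ik by simp
    then have "br (hh i k) z s (\<alpha>, u) = \<chi> i k * z s (\<alpha>, u)" by (simp only: scaleW_def)
    then show ?thesis using br_hh[OF ik z, of s "(\<alpha>, u)"] by simp
  qed
  then have "wtv i s (\<alpha>, u) + wtv k s (\<alpha>, u) = \<chi> i k" using nz by simp
  then show "(if k \<in> u then 1 else 0) - (if k = s then 1 else 0) - (if i = s then 1 else 0) = \<chi> i k"
    using ik a by (simp add: wtv_simps algebra_simps)
qed

text \<open>Only odd indices occur: these combinations commute with all D_i and all h_ik, and so can
  be subtracted without disturbing earlier normalizations. For even i, \<Gamma>_i does not commute
  with D_i.\<close>

definition TT :: "(nat \<Rightarrow> 'a) \<Rightarrow> 'a wvec" where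
  "TT c = (\<Sum>q\<in>Y1 m n. scaleW (c q) (Gam m q))"

lemma WW_sum: "(\<And>i. i \<in> I \<Longrightarrow> f i \<in> WW) \<Longrightarrow> (\<Sum>i\<in>I. f i) \<in> WW"
  by (induction I rule: infinite_finite_induct) simp_all

lemma br_sum_left: "br (\<Sum>i\<in>I. f i) E = (\<Sum>i\<in>I. br (f i) E)"
  by (induction I rule: infinite_finite_induct) (simp_all add: br_add_left)

lemma br_sum_right: "br E (\<Sum>i\<in>I. f i) = (\<Sum>i\<in>I. br E (f i))"
  by (induction I rule: infinite_finite_induct) (simp_all add: br_add_right)

lemma TT_WW: "TT c \<in> WW"
  unfolding TT_def by (intro WW_sum WW_closed(4) Gam_WW Y1_sub)

lemma br_TT:
  assumes "fld s (mv (a, u)) \<in> WW" "u \<subseteq> Y1 m n"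
  shows "br (TT c) (fld s (mv (a, u))) = scaleW ((\<Sum>q\<in>u. c q) - (if s \<in> Y1 m n then c s else 0)) (fld s (mv (a, u)))"
proof -
  have "br (TT c) (fld s (mv (a, u))) = scaleW (\<Sum>q\<in>Y1 m n. c q * wtv q s (a, u)) (fld s (mv (a, u)))"
    unfolding TT_def br_sum_left br_scale_left W.scale_sum_left
    by (intro sum.cong refl) (simp add: br_Gam_fld[OF Y1_sub assms(1)])
  moreover have "(\<Sum>q\<in>Y1 m n. c q * wtv q s (a, u)) = (\<Sum>q\<in>Y1 m n. (if q \<in> u then c q else 0) - (if q = s then c q else 0))"
    using Y0_Y1(2) by (intro sum.cong refl) (auto simp: wtv_def wt_def)
  moreover have "\<dots> = (\<Sum>q\<in>u. c q) - (if s \<in> Y1 m n then c s else 0)"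
    using assms(2) by (simp add: sum_subtractf sum.If_cases inf_absorb2)
  ultimately show ?thesis by simp
qed

lemma fld_mv_WW: "s \<in> Y m n \<Longrightarrow> bd a \<Longrightarrow> u \<subseteq> Y1 m n \<Longrightarrow> card u mod 2 = tau m s \<Longrightarrow> fld s (mv (a, u)) \<in> WW"
  by (rule fld_WW) (simp_all add: bd_MM par_def)

lemma fld_nz: "scaleW c (fld s (mv Z)) = 0 \<Longrightarrow> c = 0"
proof -
  assume "scaleW c (fld s (mv Z)) = 0"
  then have "scaleW c (fld s (mv Z)) s Z = 0" by (simp add: papply)
  then show ?thesis by (simp add: scaleW_def fld_def monvec_def)
qed

text \<open>Commuting with the D_i and h_ik forces z to be a combination of the \<Gamma>_q with q
  odd. Then \<xi>_k D_l gives c_k = c_l, \<xi>_k \<xi>_l D_i gives c_k = - c_l, and 2 is invertible.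
  The test elements are kept to this short list because all of them are annihilated by (ad
  D_i)^(p^r) with r >= 1; the same lemma thereby proves that the decomposition is direct.\<close>

lemma centralizer:
  assumes z: "z \<in> WW" and D: "\<And>i. i \<in> Y0 m \<Longrightarrow> br z (Dvec i) = 0"
    and H: "\<And>i k. i \<in> Y0 m \<Longrightarrow> k \<in> Y1 m n \<Longrightarrow> br z (hh i k) = 0"
    and G2: "\<And>k l. k \<in> Y1 m n \<Longrightarrow> l \<in> Y1 m n \<Longrightarrow> k \<noteq> l \<Longrightarrow> br z (P l (\<lambda>_. 0) (xi {k})) = 0"
    and G3: "\<And>k l i. k \<in> Y1 m n \<Longrightarrow> l \<in> Y1 m n \<Longrightarrow> k \<noteq> l \<Longrightarrow> i \<in> Y0 m \<Longrightarrow> br z (P i (\<lambda>_. 0) (xi {k, l})) = 0"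
  shows "z = 0"
proof -
  have D': "\<forall>i\<in>Y0 m. br (Dvec i) z = 0" using br_anti[of "Dvec _" z] D by simp
  have H': "\<forall>i\<in>Y0 m. \<forall>k\<in>Y1 m n. br (hh i k) z = scaleW 0 z"
    using br_anti[of "hh _ _" z] H by simp
  have sup: "s \<in> Y1 m n \<and> \<alpha> = (\<lambda>_. 0) \<and> u = {s}" if nz: "z s (\<alpha>, u) \<noteq> 0" for s \<alpha> u
  proof -
    note w = weight_vector[where \<chi>="\<lambda>_ _. 0", OF z D' H' nz]
    \<comment> \<open>For a fixed odd index the odd part of the weight is the same at every even
      index, whereas the even part at \<open>s\<close> differs by 1 from that at another even
      index.\<close>
    have s: "s \<notin> Y0 m"
    proof
      assume s: "s \<in> Y0 m"
      obtain i where i: "i \<in> Y0 m" "i \<noteq> s" using Y0_third by blast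
      obtain k where k: "k \<in> Y1 m n" using Y1_third by blast
      have "k \<noteq> s" using k s Y0_Y1 by auto
      then show False using w(5)[OF s k] w(5)[OF i(1) k] i by (auto split: if_splits)
    qed
    then have s1: "s \<in> Y1 m n" using w(1) by (auto simp: Y_def)
    obtain i where i: "i \<in> Y0 m" using Y0_third by blast
    then have "i \<noteq> s" using s by auto
    then have "k \<in> u \<longleftrightarrow> k = s" if "k \<in> Y1 m n" for k
      using w(5)[OF i that] by (auto split: if_splits)
    then have "u = {s}" using w(3) s1 by auto
    then show ?thesis using s1 w(2) by simp
  qed
  define c where "c q = z q (\<lambda>_. 0, {q})" for q
  have "z = TT c"
  proof (rule ext, rule ext)
    fix s :: nat and X :: mon
    obtain \<alpha> u where X: "X = (\<alpha>, u)" by (cases X)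
    have "TT c s X = (\<Sum>q\<in>Y1 m n. if q = s then c s * mv (\<lambda>_. 0, {s}) X else 0)"
      unfolding TT_def wv_sum sum_fun_apply
    proof (rule sum.cong[OF refl])
      fix q assume q: "q \<in> Y1 m n"
      show "scaleW (c q) (Gam m q) s X = (if q = s then c s * mv (\<lambda>_. 0, {s}) X else 0)"
        using Y0_Y1(2)[OF q] by (auto simp: scaleW_def Gam_def xgen_def papply)
    qed
    also have "\<dots> = (if s \<in> Y1 m n then c s * mv (\<lambda>_. 0, {s}) X else 0)" by simp
    finally have T: "TT c s X = (if s \<in> Y1 m n then c s * mv (\<lambda>_. 0, {s}) X else 0)" .
    show "z s X = TT c s X"
    proof (cases "z s X = 0")
      case True
      then show ?thesis unfolding T by (auto simp: monvec_def c_def)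
    next
      case False
      then show ?thesis unfolding T using sup[of s \<alpha> u] by (simp add: X monvec_def c_def)
    qed
  qed
  have c1: "c k = c l" if "k \<in> Y1 m n" "l \<in> Y1 m n" "k \<noteq> l" for k l
  proof -
    have "fld l (mv (\<lambda>_. 0, {k})) \<in> WW" using that by (intro fld_mv_WW) (auto simp: Y1_sub)
    then show ?thesis
      using G2[OF that] br_TT[of l "\<lambda>_. 0" "{k}" c] that fld_nz[of "c k - c l" l "(\<lambda>_. 0, {k})"] \<open>z = TT c\<close>
      by (simp add: P_xi)
  qed
  have c2: "c k + c l = 0" if "k \<in> Y1 m n" "l \<in> Y1 m n" "k \<noteq> l" for k l
  proof -
    obtain i where i: "i \<in> Y0 m" using Y0_third by blast
    have "fld i (mv (\<lambda>_. 0, {k, l})) \<in> WW" using that i by (intro fld_mv_WW) (auto simp: Y0_sub)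
    then show ?thesis
      using G3[OF that i] br_TT[of i "\<lambda>_. 0" "{k, l}" c] that fld_nz[of "c k + c l" i "(\<lambda>_. 0, {k, l})"] \<open>z = TT c\<close> i Y0_Y1(1)[OF i]
      by (simp add: P_xi)
  qed
  have "c k = 0" if k: "k \<in> Y1 m n" for k
  proof -
    obtain l where l: "l \<in> Y1 m n" "l \<noteq> k" using Y1_third by blast
    have "2 * c k = 0" using c1[OF k l(1)] c2[OF k l(1)] l by simp
    then show ?thesis using two_nz by simp
  qed
  then have "TT c = 0" unfolding TT_def by (intro sum.neutral) simp
  then show ?thesis using \<open>z = TT c\<close> by simp
qed

lemma centralizer_LL: "z \<in> WW \<Longrightarrow> (\<And>X. X \<in> LL \<Longrightarrow> br z X = 0) \<Longrightarrow> z = 0"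
  by (rule centralizer) (auto intro: Dvec_calS hh_calS G2_calS G3_calS)

section \<open>Derivations into the even vector fields\<close>

definition derW :: "('a wvec \<Rightarrow> 'a wvec) \<Rightarrow> bool" where
  "derW \<psi> \<longleftrightarrow> (\<forall>X\<in>LL. \<psi> X \<in> WW) \<and> (\<forall>X\<in>LL. \<forall>Z\<in>LL. \<psi> (X + Z) = \<psi> X + \<psi> Z) \<and>
    (\<forall>c. \<forall>X\<in>LL. \<psi> (scaleW c X) = scaleW c (\<psi> X)) \<and>
    (\<forall>X\<in>LL. \<forall>Z\<in>LL. \<psi> (br X Z) = br (\<psi> X) Z + br X (\<psi> Z))"

lemma derWD:
  assumes "derW \<psi>"
  shows "X \<in> LL \<Longrightarrow> \<psi> X \<in> WW" "X \<in> LL \<Longrightarrow> Z \<in> LL \<Longrightarrow> \<psi> (X + Z) = \<psi> X + \<psi> Z"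
    "X \<in> LL \<Longrightarrow> \<psi> (scaleW c X) = scaleW c (\<psi> X)"
    "X \<in> LL \<Longrightarrow> Z \<in> LL \<Longrightarrow> \<psi> (br X Z) = br (\<psi> X) Z + br X (\<psi> Z)"
  using assms by (simp_all add: derW_def)

lemma derW_0: "derW \<psi> \<Longrightarrow> \<psi> 0 = 0"
  using derWD(3)[of \<psi> 0 0] LL_closed(1) by simp

lemma derW_diff: "derW \<psi> \<Longrightarrow> derW \<phi> \<Longrightarrow> derW (\<lambda>X. \<psi> X - \<phi> X)"
  unfolding derW_def by (simp add: br_diff_left br_diff_right scaleW_diff)

lemma derW_zero: "derW (\<lambda>_. 0)"
  by (simp add: derW_def)

lemma derW_add: "derW \<psi> \<Longrightarrow> derW \<phi> \<Longrightarrow> derW (\<lambda>X. \<psi> X + \<phi> X)"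
  unfolding derW_def by (simp add: br_add_left br_add_right scaleW_add)

lemma derW_scale: "derW \<psi> \<Longrightarrow> derW (\<lambda>X. scaleW c (\<psi> X))"
  unfolding derW_def by (simp add: br_scale_left br_scale_right scaleW_add mult.commute)

lemma derW_ad: "z \<in> WW \<Longrightarrow> derW (br z)"
  unfolding derW_def using jacobi[OF _ LL_WW LL_WW, of z] by (simp add: br_add_right br_scale_right LL_WW)

text \<open>The j = 0 term is absorbed to give the second half of Pascal's rule in the two
  inductions on N below.\<close>

lemma choose_shift:
  fixes F :: "nat \<Rightarrow> nat \<Rightarrow> 'a wvec"
  shows "F 0 N + (\<Sum>j<N. scaleW (of_nat (N choose Suc j)) (F (Suc j) (N - Suc j))) =
    (\<Sum>j\<le>N. scaleW (of_nat (N choose j)) (F j (N - j)))"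
proof -
  have "(\<Sum>j\<le>N. scaleW (of_nat (N choose j)) (F j (N - j))) = (\<Sum>j<Suc N. scaleW (of_nat (N choose j)) (F j (N - j)))"
    by (simp add: lessThan_Suc_atMost)
  also have "\<dots> = scaleW (of_nat (N choose 0)) (F 0 (N - 0)) + (\<Sum>j<N. scaleW (of_nat (N choose Suc j)) (F (Suc j) (N - Suc j)))"
    by (rule sum.lessThan_Suc_shift)
  finally show ?thesis by simp
qed

lemma funpow_WW: "x \<in> WW \<Longrightarrow> X \<in> WW \<Longrightarrow> (br x ^^ N) X \<in> WW"
  by (induction N) simp_all

lemma funpow_LL: "x \<in> LL \<Longrightarrow> X \<in> LL \<Longrightarrow> (br x ^^ N) X \<in> LL"
  by (induction N) (simp_all add: LL_closed)

lemma br_funpow_leibniz: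
  assumes "x \<in> WW" "X \<in> WW" "Z \<in> WW"
  shows "(br x ^^ N) (br X Z) = (\<Sum>j\<le>N. scaleW (of_nat (N choose j)) (br ((br x ^^ j) X) ((br x ^^ (N - j)) Z)))"
proof (induction N)
  case (Suc N)
  define F where "F j l = br ((br x ^^ j) X) ((br x ^^ l) Z)" for j l
  have dF: "br x (F j l) = F (Suc j) l + F j (Suc l)" for j l
    unfolding F_def using jacobi[OF assms(1) funpow_WW[OF assms(1,2)] funpow_WW[OF assms(1,3)]] by simp
  have "(br x ^^ Suc N) (br X Z) = (\<Sum>j\<le>N. scaleW (of_nat (N choose j)) (F (Suc j) (N - j))) +
      (\<Sum>j\<le>N. scaleW (of_nat (N choose j)) (F j (Suc (N - j))))"
    using Suc by (simp add: F_def[symmetric] br_sum_right br_scale_right dF scaleW_add sum.distrib)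
  also have "(\<Sum>j\<le>N. scaleW (of_nat (N choose j)) (F j (Suc (N - j)))) = (\<Sum>j\<le>N. scaleW (of_nat (N choose j)) (F j (Suc N - j)))"
    by (intro sum.cong refl) (simp add: Suc_diff_le)
  also have "\<dots> = F 0 (Suc N) + (\<Sum>j<N. scaleW (of_nat (N choose Suc j)) (F (Suc j) (N - j)))"
    using sum.lessThan_Suc_shift[of "\<lambda>j. scaleW (of_nat (N choose j)) (F j (Suc N - j))" N]
    by (simp add: lessThan_Suc_atMost)
  also have "(\<Sum>j<N. scaleW (of_nat (N choose Suc j)) (F (Suc j) (N - j))) = (\<Sum>j\<le>N. scaleW (of_nat (N choose Suc j)) (F (Suc j) (N - j)))"
    unfolding lessThan_Suc_atMost[symmetric] by (simp add: binomial_eq_0)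
  finally have "(br x ^^ Suc N) (br X Z) = F 0 (Suc N) + (\<Sum>j<Suc N. scaleW (of_nat (Suc N choose Suc j)) (F (Suc j) (Suc N - Suc j)))"
    by (simp add: lessThan_Suc_atMost scaleW_left_add sum.distrib)
  then show ?case unfolding choose_shift by (simp add: F_def)
qed simp

text \<open>Jacobson's identity: a derivation maps \<open>(ad x)^N\<close> to this sum of brackets with \<open>y = \<psi> x\<close>.\<close>
lemma derW_funpow:
  assumes "derW \<psi>" "x \<in> LL" "X \<in> LL"
  shows "\<psi> ((br x ^^ N) X) = (br x ^^ N) (\<psi> X) +
    (\<Sum>j<N. scaleW (of_nat (N choose Suc j)) (br ((br x ^^ j) (\<psi> x)) ((br x ^^ (N - Suc j)) X)))"
proof (induction N)
  case (Suc N)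
  define F where "F j l = br ((br x ^^ j) (\<psi> x)) ((br x ^^ l) X)" for j l
  have W: "x \<in> WW" "X \<in> WW" "\<psi> x \<in> WW" using assms LL_WW derWD(1) by auto
  have dF: "br x (F j l) = F (Suc j) l + F j (Suc l)" for j l
    unfolding F_def using jacobi[OF W(1) funpow_WW[OF W(1,3)] funpow_WW[OF W(1,2)]] by simp
  have "\<psi> ((br x ^^ Suc N) X) = F 0 N + br x (\<psi> ((br x ^^ N) X))"
    using derWD(4)[OF assms(1,2) funpow_LL[OF assms(2,3)]] by (simp add: F_def)
  also have "\<dots> = (br x ^^ Suc N) (\<psi> X) + ((F 0 N + (\<Sum>j<N. scaleW (of_nat (N choose Suc j)) (F (Suc j) (N - Suc j)))) +
      (\<Sum>j<N. scaleW (of_nat (N choose Suc j)) (F j (Suc (N - Suc j)))))"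
    unfolding Suc F_def[symmetric]
    by (simp add: br_add_right br_sum_right br_scale_right dF scaleW_add sum.distrib)
  also have "(\<Sum>j<N. scaleW (of_nat (N choose Suc j)) (F j (Suc (N - Suc j)))) = (\<Sum>j<N. scaleW (of_nat (N choose Suc j)) (F j (N - j)))"
    by (intro sum.cong refl) (simp add: Suc_diff_Suc)
  also have "\<dots> = (\<Sum>j\<le>N. scaleW (of_nat (N choose Suc j)) (F j (N - j)))"
    unfolding lessThan_Suc_atMost[symmetric] by (simp add: binomial_eq_0)
  finally show ?case unfolding choose_shift
    by (simp add: F_def lessThan_Suc_atMost scaleW_left_add sum.distrib binomial_eq_0)
qed simp

lemma of_nat_choose_pow: "0 < j \<Longrightarrow> j < p ^ k \<Longrightarrow> of_nat (p ^ k choose j) = (0 :: 'a)"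
  using prime_dvd_choose_prime_power[OF prime_p] of_nat_0_iff by blast

text \<open>In Jacobson's identity all coefficients but the last vanish modulo p. If (ad x)^(p^k) is
  0 or again ad x on even fields, what is left is an equation for \<psi> x alone, by way of the
  trivial centralizer.\<close>

lemma derW_funpow_p:
  assumes "derW \<psi>" "x \<in> LL" "X \<in> LL"
  shows "\<psi> ((br x ^^ (p ^ k)) X) = (br x ^^ (p ^ k)) (\<psi> X) + br ((br x ^^ (p ^ k - 1)) (\<psi> x)) X"
proof -
  obtain N where N: "p ^ k = Suc N" using gr0_implies_Suc[of "p ^ k"] p_pos by auto
  have "scaleW (of_nat (Suc N choose Suc j)) (br ((br x ^^ j) (\<psi> x)) ((br x ^^ (Suc N - Suc j)) X)) = 0" if "j < N" for j
    using of_nat_choose_pow[of "Suc j" k] that N by simp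
  then have "(\<Sum>j<N. scaleW (of_nat (Suc N choose Suc j)) (br ((br x ^^ j) (\<psi> x)) ((br x ^^ (Suc N - Suc j)) X))) = 0"
    by (intro sum.neutral) blast
  then show ?thesis using derW_funpow[OF assms, of "Suc N"] unfolding N
    by (simp del: binomial_Suc_Suc funpow.simps)
qed

lemma br_funpow_p:
  assumes "x \<in> WW" "X \<in> WW" "Z \<in> WW"
  shows "(br x ^^ (p ^ k)) (br X Z) = br ((br x ^^ (p ^ k)) X) Z + br X ((br x ^^ (p ^ k)) Z)"
proof -
  obtain N where N: "p ^ k = Suc N" using gr0_implies_Suc[of "p ^ k"] p_pos by auto
  let ?f = "\<lambda>j. scaleW (of_nat (Suc N choose j)) (br ((br x ^^ j) X) ((br x ^^ (Suc N - j)) Z))"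
  have "?f (Suc j) = 0" if "j < N" for j
    using of_nat_choose_pow[of "Suc j" k] that N by simp
  then have 0: "(\<Sum>j<N. ?f (Suc j)) = 0" by (intro sum.neutral) blast
  have "(\<Sum>j\<le>Suc N. ?f j) = (\<Sum>j<Suc (Suc N). ?f j)" by (simp only: lessThan_Suc_atMost)
  also have "\<dots> = ?f 0 + (\<Sum>j<Suc N. ?f (Suc j))" by (rule sum.lessThan_Suc_shift)
  also have "\<dots> = ?f 0 + ((\<Sum>j<N. ?f (Suc j)) + ?f (Suc N))" by (simp only: sum.lessThan_Suc)
  also have "\<dots> = ?f 0 + ?f (Suc N)" unfolding 0 by simp
  finally show ?thesis unfolding N br_funpow_leibniz[OF assms] by (simp add: add.commute)
qed

lemma funpow_linear:
  "(br x ^^ N) (X + Z) = (br x ^^ N) X + (br x ^^ N) Z" "(br x ^^ N) (scaleW c X) = scaleW c ((br x ^^ N) X)"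
  by (induction N) (simp_all add: br_add_right br_scale_right)

lemma derW_Dpow: "i \<in> Y0 m \<Longrightarrow> derW (br (Dvec i) ^^ (p ^ k))"
  unfolding derW_def by (simp add: funpow_linear br_funpow_p funpow_WW LL_WW)

section \<open>Integration\<close>

lemma D_funpow:
  assumes "i \<in> Y0 m" "f \<in> AA"
  shows "(D i ^^ M) f (\<alpha>, u) = (if (\<alpha>, u) \<in> MM then f (\<alpha>(i := \<alpha> i + M), u) else 0)"
proof (induction M arbitrary: \<alpha>)
  case 0
  then show ?case using assms(2) by (auto simp: AA_iff)
next
  case (Suc M)
  have "f (\<alpha>(i := \<alpha> i + Suc M), u) = 0" if "(\<alpha>, u) \<in> MM" "(\<alpha>(i := Suc (\<alpha> i)), u) \<notin> MM"
  proof -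
    have "(\<alpha>(i := \<alpha> i + Suc M), u) \<notin> MM"
      using that assms(1) by (auto simp: MM_iff split: if_splits)
    then show ?thesis using assms(2) unfolding AA_iff by blast
  qed
  moreover have "(D i ^^ Suc M) f (\<alpha>, u) = (if (\<alpha>, u) \<in> MM then (D i ^^ M) f (\<alpha>(i := Suc (\<alpha> i)), u) else 0)"
    using assms(1) by (simp add: Dop_def[of p m n t i "(D i ^^ M) f"])
  moreover have "(\<alpha>(i := Suc (\<alpha> i)))(i := (\<alpha>(i := Suc (\<alpha> i))) i + M) = \<alpha>(i := \<alpha> i + Suc M)" by simp
  ultimately show ?case unfolding Suc by (simp only: if_distrib) simp
qed

lemma br_Dvec_funpow:
  assumes "i \<in> Y0 m" "E \<in> WW"
  shows "(br (Dvec i) ^^ M) E s = (D i ^^ M) (E s)"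
  by (induction M) (use assms br_Dvec[OF assms(1) funpow_WW[OF Dvec_WW[OF assms(1)] assms(2)]] in simp_all)

text \<open>A Poincare lemma for truncated divided powers. The coefficient of z at \<alpha> is the
  coefficient of y_i at \<alpha> lowered at i, for any i with \<alpha>_i > 0, and z is 0 where no
  even variable occurs. The condition \<open>top\<close> cannot be avoided, since D_i z never
  contains the maximal power of x_i.\<close>

lemma integrate:
  assumes y: "\<And>i. i \<in> Y0 m \<Longrightarrow> y i \<in> WW"
    and c: "\<And>i j s. i \<in> Y0 m \<Longrightarrow> j \<in> Y0 m \<Longrightarrow> D i (y j s) = D j (y i s)"
    and top: "\<And>i s \<alpha> u. i \<in> Y0 m \<Longrightarrow> Suc (\<alpha> i) = p ^ t i \<Longrightarrow> y i s (\<alpha>, u) = 0"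
  shows "\<exists>z\<in>WW. \<forall>i\<in>Y0 m. \<forall>s. D i (z s) = y i s"
proof -
  define z where "z s X = (if X \<in> MM \<and> (\<exists>i\<in>Y0 m. fst X i \<noteq> 0) then
    (let i = (SOME i. i \<in> Y0 m \<and> fst X i \<noteq> 0) in y i s ((fst X)(i := fst X i - 1), snd X)) else 0)" for s X
  have z: "z s (\<alpha>, u) = y j s (\<alpha>(j := \<alpha> j - 1), u)" if M: "(\<alpha>, u) \<in> MM" and j: "j \<in> Y0 m" "\<alpha> j \<noteq> 0" for s \<alpha> u j
  proof -
    define i where "i = (SOME i. i \<in> Y0 m \<and> \<alpha> i \<noteq> 0)"
    have i: "i \<in> Y0 m \<and> \<alpha> i \<noteq> 0" unfolding i_def by (rule someI[of _ j]) (use j in auto)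
    have zi: "z s (\<alpha>, u) = y i s (\<alpha>(i := \<alpha> i - 1), u)"
      using M j by (auto simp: z_def i_def Let_def)
    show ?thesis
    proof (cases "i = j")
      case True
      then show ?thesis using zi by simp
    next
      case False
      \<comment> \<open>At the exponent lowered in both \<open>i\<close> and \<open>j\<close>, D_j
        y_i and D_i y_j read off the two candidate coefficients, so closedness makes the choice of
        index irrelevant.\<close>
      define \<beta> where "\<beta> = \<alpha>(i := \<alpha> i - 1, j := \<alpha> j - 1)"
      have B: "(\<beta>, u) \<in> MM" using MM_lower[OF MM_lower[OF M, of i], of j] False by (simp add: \<beta>_def)
      have "\<beta>(j := \<beta> j + 1) = \<alpha>(i := \<alpha> i - 1)" "\<beta>(i := \<beta> i + 1) = \<alpha>(j := \<alpha> j - 1)"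
        using False i j by (auto simp: \<beta>_def)
      then have "D j (y i s) (\<beta>, u) = y i s (\<alpha>(i := \<alpha> i - 1), u)" "D i (y j s) (\<beta>, u) = y j s (\<alpha>(j := \<alpha> j - 1), u)"
        using B i j by (simp_all add: Dop_def)
      then show ?thesis using zi c[of i j s] i j by simp
    qed
  qed
  have nz: "X \<in> MM \<and> (\<exists>i\<in>Y0 m. \<exists>\<beta>. y i s (\<beta>, snd X) \<noteq> 0)" if "z s X \<noteq> 0" for s X
  proof -
    obtain \<alpha> u where X: "X = (\<alpha>, u)" by (cases X)
    have M: "X \<in> MM" "\<exists>i\<in>Y0 m. \<alpha> i \<noteq> 0" using that by (auto simp: z_def X split: if_splits)
    then obtain i where "i \<in> Y0 m" "\<alpha> i \<noteq> 0" by blast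
    then show ?thesis using z[of \<alpha> u i s] M(1) that unfolding X by auto
  qed
  have "z \<in> WW"
    unfolding WW_iff
  proof (intro conjI allI impI)
    fix s
    show "z s \<in> AA" unfolding AA_iff using nz by blast
    show "homog (tau m s) (z s)" unfolding homog_iff
    proof (intro allI impI)
      fix X assume "z s X \<noteq> 0"
      then obtain i \<beta> where i: "i \<in> Y0 m" "y i s (\<beta>, snd X) \<noteq> 0" using nz by blast
      then have "par (\<beta>, snd X) = tau m s" using WW_D(2)[OF y[OF i(1)], of s] unfolding homog_iff by blast
      then show "par X = tau m s" by (simp add: par_def)
    qed
    assume "s \<notin> Y m n"
    then have "y i s = 0" if "i \<in> Y0 m" for i using WW_D(3)[OF y[OF that]] by simp
    then have "z s X = 0" for X using nz[of s X] by (auto simp: papply)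
    then show "z s = 0" by (simp add: fun_eq_iff papply)
  qed
  moreover have "D j (z s) = y j s" if j: "j \<in> Y0 m" for j s
  proof
    fix X :: mon
    obtain \<alpha> u where X: "X = (\<alpha>, u)" by (cases X)
    show "D j (z s) X = y j s X"
    proof (cases "X \<in> MM")
      case False
      then show ?thesis using WW_D(1)[OF y[OF j], of s] unfolding AA_iff by (auto simp: Dop_def)
    next
      case M: True
      then have d: "D j (z s) X = z s (\<alpha>(j := Suc (\<alpha> j)), u)" using j by (simp add: Dop_def X)
      show ?thesis
      proof (cases "(\<alpha>(j := Suc (\<alpha> j)), u) \<in> MM")
        case True
        then show ?thesis unfolding d using z[OF True j, of s] by (simp add: X)
      next
        case False
        have "Suc (\<alpha> j) = p ^ t j"
        proof (rule ccontr)
          assume "Suc (\<alpha> j) \<noteq> p ^ t j"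
          moreover have "\<alpha> j < p ^ t j" using M j by (auto simp: X MM_iff)
          ultimately have "Suc (\<alpha> j) < p ^ t j" by simp
          then have "(\<alpha>(j := Suc (\<alpha> j)), u) \<in> MM" using M j by (auto simp: X MM_iff)
          then show False using False by simp
        qed
        then have "y j s X = 0" using top[OF j] by (simp add: X)
        then show ?thesis unfolding d using False by (simp add: z_def)
      qed
    qed
  qed
  ultimately show ?thesis by blast
qed


section \<open>Normalizing a derivation\<close>

lemma br_Dvec_Dvec: "i \<in> Y0 m \<Longrightarrow> j \<in> Y0 m \<Longrightarrow> br (Dvec i) (Dvec j) = 0"
  using br_Dvec_P[OF _ bd_zero lam_one P_WW0[OF _ lam_one], of i j] by (simp add: Dvec_P)

text \<open>Applying \<psi> to (ad D_i)^(p^t_i) = 0 shows that (ad D_i)^(p^t_i - 1) maps \<psi> D_i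
  to an element centralizing S, hence to 0. Evaluated at exponent 0 in x_i this is the condition
  \<open>top\<close>; closedness comes from [D_i, D_j] = 0.\<close>

lemma inner_on_translations:
  assumes "derW \<psi>"
  shows "\<exists>z\<in>WW. \<forall>i\<in>Y0 m. \<psi> (Dvec i) = br z (Dvec i)"
proof -
  define y where "y i = \<psi> (Dvec i)" for i
  have y: "y i \<in> WW" if "i \<in> Y0 m" for i
    unfolding y_def using derWD(1)[OF assms Dvec_calS[OF that]] .
  have c: "D i (y j s) = D j (y i s)" if "i \<in> Y0 m" "j \<in> Y0 m" for i j s
  proof -
    have "br (y i) (Dvec j) + br (Dvec i) (y j) = 0"
      using derWD(4)[OF assms Dvec_calS[OF that(1)] Dvec_calS[OF that(2)]] br_Dvec_Dvec[OF that] derW_0[OF assms]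
      by (simp add: y_def)
    then have "br (Dvec i) (y j) = br (Dvec j) (y i)"
      using br_anti[of "Dvec j" "y i"] by (simp add: add_eq_0_iff)
    then show ?thesis using br_Dvec[OF that(1) y[OF that(2)], of s] br_Dvec[OF that(2) y[OF that(1)], of s] by simp
  qed
  have top: "y i s (\<alpha>, u) = 0" if i: "i \<in> Y0 m" "Suc (\<alpha> i) = p ^ t i" for i s \<alpha> u
  proof -
    have th0: "(br (Dvec i) ^^ (p ^ t i)) X = 0" if X: "X \<in> WW" for X
    proof (rule ext, rule ext)
      fix r :: nat and Z :: mon
      obtain \<beta> v where Z: "Z = (\<beta>, v)" by (cases Z)
      have "(\<beta>(i := \<beta> i + p ^ t i), v) \<notin> MM" using i(1) by (auto simp: MM_iff dest!: bspec[of _ _ i])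
      then have "X r (\<beta>(i := \<beta> i + p ^ t i), v) = 0" using WW_D(1)[OF X, of r] unfolding AA_iff by blast
      then show "(br (Dvec i) ^^ (p ^ t i)) X r Z = 0 r Z"
        unfolding Z br_Dvec_funpow[OF i(1) X] D_funpow[OF i(1) WW_D(1)[OF X]] by (simp add: papply)
    qed
    have C: "br ((br (Dvec i) ^^ (p ^ t i - 1)) (y i)) X = 0" if X: "X \<in> LL" for X
      using derW_funpow_p[OF assms Dvec_calS[OF i(1)] X, of "t i"] th0[OF LL_WW[OF X]] th0[OF derWD(1)[OF assms X]]
        derW_0[OF assms] by (simp add: y_def)
    have z: "(br (Dvec i) ^^ (p ^ t i - 1)) (y i) = 0"
      by (rule centralizer_LL[OF funpow_WW[OF Dvec_WW[OF i(1)] y[OF i(1)]] C])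
    show ?thesis
    proof (cases "(\<alpha>, u) \<in> MM")
      case True
      then have M: "(\<alpha>(i := 0), u) \<in> MM" by (auto simp: MM_iff)
      have "(D i ^^ (p ^ t i - 1)) (y i s) (\<alpha>(i := 0), u) = 0"
        using br_Dvec_funpow[OF i(1) y[OF i(1)], of "p ^ t i - 1" s] z by (simp add: papply)
      moreover have "\<alpha>(i := p ^ t i - 1) = \<alpha>" using i(2) by (metis diff_Suc_1 fun_upd_triv)
      ultimately show ?thesis
        using D_funpow[OF i(1) WW_D(1)[OF y[OF i(1)]], of "p ^ t i - 1" s "\<alpha>(i := 0)" u] M by simp
    next
      case False
      then show ?thesis using WW_D(1)[OF y[OF i(1)], of s] unfolding AA_iff by blast
    qed
  qed
  obtain z where z: "z \<in> WW" "\<forall>i\<in>Y0 m. \<forall>s. D i (z s) = y i s"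
    using integrate[of y, OF y c top] by blast
  \<comment> \<open>Integration solves [D_i, z] = y_i, so the inner derivation to subtract belongs
    to -z.\<close>
  have "\<psi> (Dvec i) = br (scaleW (-1) z) (Dvec i)" if i: "i \<in> Y0 m" for i
  proof -
    have "br (Dvec i) z = y i" by (rule ext) (use br_Dvec[OF i z(1)] z(2) i in simp)
    then show ?thesis unfolding br_scale_left y_def using br_anti[of z "Dvec i"] by simp
  qed
  then show ?thesis using WW_closed(4)[OF z(1)] by blast
qed

lemma of_nat_pow_p: "(of_nat x :: 'a) ^ p = of_nat x"
proof (induction x)
  case 0
  then show ?case using p_pos by simp
next
  case (Suc x)
  obtain N where N: "p = Suc N" using p_pos gr0_implies_Suc by blast
  have "(of_nat x + 1 :: 'a) ^ p = (\<Sum>k\<le>p. of_nat (p choose k) * of_nat x ^ k * 1 ^ (p - k))"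
    by (rule binomial_ring)
  also have "\<dots> = (\<Sum>k\<in>{0, p}. of_nat (p choose k) * of_nat x ^ k * 1 ^ (p - k))"
  proof (rule sum.mono_neutral_right)
    show "\<forall>k\<in>{..p} - {0, p}. of_nat (p choose k) * of_nat x ^ k * 1 ^ (p - k) = (0 :: 'a)"
      using of_nat_choose_pow[of _ 1] by auto
  qed auto
  also have "\<dots> = 1 + of_nat x ^ p" using p_pos by simp
  finally show ?case using Suc by (simp add: add.commute)
qed

text \<open>Writing -1 as p - 1 exhibits the weight as the image of a natural number, which is fixed
  by the p-th power map.\<close>

lemma hh_weight_pow: "(wtv i s X + wtv k s X) ^ p = wtv i s X + wtv k s X"
proof -
  have "of_nat (p - 1) = (-1 :: 'a)"
  proof -
    have "of_nat (p - 1) + 1 = (of_nat p :: 'a)" using p_pos by (metis Suc_diff_1 of_nat_Suc add.commute)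
    then show ?thesis using of_nat_0_iff[of p] by (simp add: eq_neg_iff_add_eq_0)
  qed
  then have "wtv q s X = of_nat (wt q X + (if q = s then p - 1 else 0))" for q
    by (simp add: wtv_def)
  then show ?thesis using of_nat_pow_p by (metis of_nat_add)
qed

lemma br_hh_funpow:
  assumes "i \<in> Y0 m" "k \<in> Y1 m n" "E \<in> WW"
  shows "(br (hh i k) ^^ N) E s X = (wtv i s X + wtv k s X) ^ N * E s X"
proof (induction N)
  case (Suc N)
  then show ?case using br_hh[OF assms(1,2) funpow_WW[OF hh_WW[OF assms(1,2)] assms(3)]] by simp
qed simp

lemma br_Dvec_hh: "j \<in> Y0 m \<Longrightarrow> i \<in> Y0 m \<Longrightarrow> k \<in> Y1 m n \<Longrightarrow> br (Dvec j) (hh i k) = (if j = i then Dvec j else 0)"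
proof -
  assume j: "j \<in> Y0 m" and i: "i \<in> Y0 m" and k: "k \<in> Y1 m n"
  have b: "bd (ex i 1)" using bd_ex i p_pow_gt1 by simp
  show ?thesis
    unfolding hh_def Gam_P0[OF i] Gam_P1[OF k] br_add_right
      br_Dvec_P[OF j b lam_one P_WW0[OF i lam_one]]
      br_Dvec_P[OF j bd_zero lam_xi1[OF k] P_WW1[OF k lam_xi1[OF k]]]
    by (simp add: Dvec_P ex_upd)
qed

lemma br_hh_hh: "i \<in> Y0 m \<Longrightarrow> k \<in> Y1 m n \<Longrightarrow> j \<in> Y0 m \<Longrightarrow> l \<in> Y1 m n \<Longrightarrow> br (hh i k) (hh j l) = 0"
proof -
  assume ik: "i \<in> Y0 m" "k \<in> Y1 m n" and jl: "j \<in> Y0 m" "l \<in> Y1 m n"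
  have "br (Gam m q) (Gam m r) = 0" if q: "q \<in> Y m n" and r: "r \<in> Y m n" for q r :: nat
  proof -
    have W: "(Gam m r :: 'a wvec) \<in> WW" using r by simp
    have "wtv q s X * Gam m r s X = 0" for s X
      using q by (auto simp: wtv_def wt_def Gam_def xgen_def monvec_def papply tau_def elim!: Y_cases
        dest: Y0_Y1)
    then show ?thesis unfolding fun_eq_iff br_Gam[OF q W] by (simp add: papply)
  qed
  then show ?thesis using ik jl by (simp add: hh_def br_add_left br_add_right Y0_sub Y1_sub)
qed

text \<open>For y = \<phi> h the relation (ad h)^p = ad h forces y = (ad h)^(p-1) y, so y = [h, z']
  with z' = (ad h)^(p-2) y. The torus elements are treated one after the other: y commutes with all
  D_j and with the earlier torus elements, and applying powers of ad h preserves this, so the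
  correction z' does not disturb the values already made 0.\<close>

lemma inner_on_torus_aux:
  assumes "derW \<psi>" "\<forall>i\<in>Y0 m. \<psi> (Dvec i) = 0" "finite S" "S \<subseteq> Y0 m \<times> Y1 m n"
  shows "\<exists>z\<in>WW. (\<forall>i\<in>Y0 m. br z (Dvec i) = 0) \<and> (\<forall>(i, k)\<in>S. \<psi> (hh i k) = br z (hh i k))"
  using assms(3,4)
proof (induction S rule: finite_induct)
  case empty
  show ?case by (rule bexI[of _ 0]) simp_all
next
  case (insert ik S)
  obtain i k where ik: "ik = (i, k)" "i \<in> Y0 m" "k \<in> Y1 m n" using insert.prems by (cases ik) auto
  obtain z where z: "z \<in> WW" "\<forall>i\<in>Y0 m. br z (Dvec i) = 0" "\<forall>(i, k)\<in>S. \<psi> (hh i k) = br z (hh i k)"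
    using insert.IH insert.prems by auto
  define \<phi> where "\<phi> X = \<psi> X - br z X" for X
  have d: "derW \<phi>" unfolding \<phi>_def by (intro derW_diff assms derW_ad z)
  have D0: "\<phi> (Dvec j) = 0" if "j \<in> Y0 m" for j using assms(2) z(2) that by (simp add: \<phi>_def)
  define h where "h = hh i k"
  define y where "y = \<phi> h"
  have hL: "h \<in> LL" unfolding h_def by (rule hh_calS[OF ik(2,3)])
  have hW: "h \<in> WW" by (rule LL_WW[OF hL])
  have yW: "y \<in> WW" unfolding y_def by (rule derWD(1)[OF d hL])
  have yD: "br (Dvec j) y = 0" if j: "j \<in> Y0 m" for j
  proof -
    have "\<phi> (br (Dvec j) h) = br (Dvec j) y"
      using derWD(4)[OF d Dvec_calS[OF j] hL] D0[OF j] by (simp add: y_def)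
    then show ?thesis using br_Dvec_hh[OF j ik(2,3)] D0[OF j] derW_0[OF d] by (simp add: h_def split: if_splits)
  qed
  have yh: "br (hh j l) y = 0" if jl: "(j, l) \<in> S" for j l
  proof -
    have Y: "j \<in> Y0 m" "l \<in> Y1 m n" using jl insert.prems by auto
    have "\<phi> (hh j l) = 0" using z(3) jl by (auto simp: \<phi>_def)
    then show ?thesis using derWD(4)[OF d hh_calS[OF Y] hL] br_hh_hh[OF Y ik(2,3)] derW_0[OF d]
      by (simp add: y_def h_def)
  qed
  define th where "th = br h"
  have thp: "(th ^^ p) X = th X" if "X \<in> WW" for X
    by (rule ext, rule ext)
      (simp add: th_def h_def br_hh_funpow[OF ik(2,3) that] br_hh[OF ik(2,3) that] hh_weight_pow)
  \<comment> \<open>Two evaluations of \<phi> on ad h X = (ad h)^p X, one by the product rule and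
    one by Jacobson's identity.\<close>
  have C: "br (y - (th ^^ (p - 1)) y) X = 0" if X: "X \<in> LL" for X
  proof -
    have "\<phi> (th X) = th (\<phi> X) + br ((th ^^ (p - 1)) y) X"
      using derW_funpow_p[OF d hL X, of 1] thp[OF LL_WW[OF X]] thp[OF derWD(1)[OF d X]]
      by (simp add: th_def y_def)
    moreover have "\<phi> (th X) = br y X + th (\<phi> X)"
      using derWD(4)[OF d hL X] by (simp add: th_def y_def)
    ultimately show ?thesis by (simp add: br_diff_left)
  qed
  have "(th ^^ (p - 1)) y \<in> WW" unfolding th_def by (rule funpow_WW[OF hW yW])
  then have "y - (th ^^ (p - 1)) y = 0"
    by (rule centralizer_LL[OF WW_closed(3)[OF yW] C])
  then have y1: "y = (th ^^ (p - 1)) y" by simp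
  define z' where "z' = (th ^^ (p - 2)) y"
  have z'W: "z' \<in> WW" by (simp add: z'_def th_def funpow_WW hW yW)
  have "p - 1 = Suc (p - 2)" using p3 by simp
  then have hz': "br h z' = y" using y1 by (simp add: z'_def th_def)
  have z'D: "br (Dvec j) z' = 0" if j: "j \<in> Y0 m" for j
  proof -
    have "br (Dvec j) ((th ^^ N) y) = 0" for N
    proof (induction N)
      case (Suc N)
      have "br (Dvec j) (br h ((th ^^ N) y)) = br (br (Dvec j) h) ((th ^^ N) y) + br h (br (Dvec j) ((th ^^ N) y))"
        by (rule jacobi) (use j hW yW in \<open>simp_all add: th_def funpow_WW\<close>)
      then show ?case using Suc br_Dvec_hh[OF j ik(2,3)] by (cases "j = i") (simp_all add: th_def h_def)
    qed (simp add: yD j)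
    then show ?thesis by (simp add: z'_def)
  qed
  have z'h: "br (hh j l) z' = 0" if jl: "(j, l) \<in> S" for j l
  proof -
    have Y: "j \<in> Y0 m" "l \<in> Y1 m n" using jl insert.prems by auto
    have 0: "(wtv j s X + wtv l s X) * y s X = 0" for s X
      using br_hh[OF Y yW, of s X] yh[OF jl] by (simp add: papply)
    have "(wtv j s X + wtv l s X) * z' s X = 0" for s X
      using br_hh_funpow[OF ik(2,3) yW, of "p - 2" s X] 0[of s X]
      unfolding z'_def th_def h_def by (metis mult.left_commute mult_zero_right)
    then show ?thesis unfolding fun_eq_iff br_hh[OF Y z'W] by (simp add: papply)
  qed
  show ?case
  proof (rule bexI[of _ "z - z'"], intro conjI ballI)
    show "z - z' \<in> WW" using z(1) z'W by simp
    show "br (z - z') (Dvec j) = 0" if "j \<in> Y0 m" for j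
      using z(2) z'D[OF that] that br_anti[of z' "Dvec j"] by (simp add: br_diff_left)
    fix jl assume jl: "jl \<in> insert ik S"
    show "case jl of (j, l) \<Rightarrow> \<psi> (hh j l) = br (z - z') (hh j l)"
    proof (cases "jl \<in> S")
      case True
      then obtain j l where "jl = (j, l)" "(j, l) \<in> S" by (cases jl) auto
      then show ?thesis using z(3) z'h br_anti[of z' "hh j l"] by (auto simp: br_diff_left)
    next
      case False
      then have "jl = (i, k)" using jl ik by simp
      moreover have "\<psi> h = br z h + y" by (simp add: y_def \<phi>_def)
      ultimately show ?thesis using hz' br_anti[of z' h] by (simp add: br_diff_left h_def)
    qed
  qed
qed

lemma inner_on_torus:
  assumes "derW \<psi>" "\<forall>i\<in>Y0 m. \<psi> (Dvec i) = 0"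
  shows "\<exists>z\<in>WW. (\<forall>i\<in>Y0 m. br z (Dvec i) = 0) \<and> (\<forall>i\<in>Y0 m. \<forall>k\<in>Y1 m n. \<psi> (hh i k) = br z (hh i k))"
  using inner_on_torus_aux[OF assms finite_cartesian_product[OF finite_Y(2,3)] order_refl] by auto

definition normd :: "('a wvec \<Rightarrow> 'a wvec) \<Rightarrow> bool" where
  "normd \<psi> \<longleftrightarrow> derW \<psi> \<and> (\<forall>i\<in>Y0 m. \<psi> (Dvec i) = 0) \<and> (\<forall>i\<in>Y0 m. \<forall>k\<in>Y1 m n. \<psi> (hh i k) = 0)"

text \<open>If \<psi> is 0 on the brackets [D_i, X], then \<psi> X commutes with the D_i; it also
  has the same torus weight as X. Each generator is thus reduced to a comparison of weights of
  fields \<xi>_u D_s.\<close>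

lemma normd_value:
  assumes n: "normd \<psi>" and X: "X \<in> LL" and D: "\<forall>i\<in>Y0 m. \<psi> (br (Dvec i) X) = 0"
    and H: "\<forall>i\<in>Y0 m. \<forall>k\<in>Y1 m n. br (hh i k) X = scaleW (\<chi> i k) X"
    and nz: "\<psi> X s (\<alpha>, u) \<noteq> 0"
  shows "s \<in> Y m n" "\<alpha> = (\<lambda>_. 0)" "u \<subseteq> Y1 m n" "card u mod 2 = tau m s"
    "\<And>i k. i \<in> Y0 m \<Longrightarrow> k \<in> Y1 m n \<Longrightarrow>
      (if k \<in> u then 1 else 0) - (if k = s then 1 else 0) - (if i = s then 1 else 0) = \<chi> i k"
proof -
  have d: "derW \<psi>" using n by (simp add: normd_def)
  have D': "\<forall>i\<in>Y0 m. br (Dvec i) (\<psi> X) = 0"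
  proof
    fix i assume i: "i \<in> Y0 m"
    have "\<psi> (br (Dvec i) X) = br (Dvec i) (\<psi> X)"
      using derWD(4)[OF d Dvec_calS[OF i] X] n i by (simp add: normd_def)
    then show "br (Dvec i) (\<psi> X) = 0" using D i by simp
  qed
  have H': "\<forall>i\<in>Y0 m. \<forall>k\<in>Y1 m n. br (hh i k) (\<psi> X) = scaleW (\<chi> i k) (\<psi> X)"
  proof (intro ballI)
    fix i k assume ik: "i \<in> Y0 m" "k \<in> Y1 m n"
    have "\<psi> (br (hh i k) X) = br (hh i k) (\<psi> X)"
      using derWD(4)[OF d hh_calS[OF ik] X] n ik by (simp add: normd_def)
    then show "br (hh i k) (\<psi> X) = scaleW (\<chi> i k) (\<psi> X)" using H ik derWD(3)[OF d X] by simp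
  qed
  note w = weight_vector[OF derWD(1)[OF d X] D' H' nz]
  show "s \<in> Y m n" "\<alpha> = (\<lambda>_. 0)" "u \<subseteq> Y1 m n" "card u mod 2 = tau m s" by (fact w)+
  show "(if k \<in> u then 1 else 0) - (if k = s then 1 else 0) - (if i = s then 1 else 0) = \<chi> i k"
    if "i \<in> Y0 m" "k \<in> Y1 m n" for i k using w(5)[OF that] .
qed

lemma hh_fld:
  assumes "i \<in> Y0 m" "k \<in> Y1 m n" "fld s (mv (a, u)) \<in> WW"
  shows "br (hh i k) (fld s (mv (a, u))) =
    scaleW (of_nat (a i) - (if i = s then 1 else 0) + ((if k \<in> u then 1 else 0) - (if k = s then 1 else 0))) (fld s (mv (a, u)))"
  unfolding hh_def br_add_left br_Gam_fld[OF Y0_sub[OF assms(1)] assms(3)] br_Gam_fld[OF Y1_sub[OF assms(2)] assms(3)]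
    wtv_simps[OF assms(1,2)] scaleW_left_add ..

lemma single_support:
  assumes "\<And>s \<alpha> u. z s (\<alpha>, u) \<noteq> 0 \<Longrightarrow> s = s0 \<and> \<alpha> = \<alpha>0 \<and> u = u0"
  shows "z = scaleW (z s0 (\<alpha>0, u0)) (fld s0 (mv (\<alpha>0, u0)))"
proof (rule ext, rule ext)
  fix s :: nat and X :: mon
  obtain \<alpha> u where X: "X = (\<alpha>, u)" by (cases X)
  show "z s X = scaleW (z s0 (\<alpha>0, u0)) (fld s0 (mv (\<alpha>0, u0))) s X"
    using assms[of s \<alpha> u] by (cases "z s X = 0") (auto simp: X scaleW_def fld_def monvec_def papply)
qed

lemma one_nz: "(1::'a) \<noteq> -1" "(-1::'a) \<noteq> 1" "(-2::'a) \<noteq> 0" "(1::'a) \<noteq> 0" "(2::'a) \<noteq> 0"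
  using two_nz by (auto simp: eq_neg_iff_add_eq_0 neg_eq_iff_add_eq_0)

text \<open>The generator has the pairwise different weights 1, -1, 0 at \<open>i\<close>,
  \<open>j\<close> and a third even index. A field \<xi>_u D_s has the same even weights at all even
  indices other than \<open>s\<close>, so two of the three values would have to agree.\<close>

lemma normd_xD:
  assumes n: "normd \<psi>" and ij: "i \<in> Y0 m" "j \<in> Y0 m" "i \<noteq> j"
  shows "\<psi> (P j (ex i 1) (xi {})) = 0"
proof (rule ccontr)
  define X where "X = P j (ex i 1) (xi {})"
  have b: "bd (ex i 1)" using bd_ex ij p_pow_gt1 by simp
  have X: "X = fld j (mv (ex i 1, {}))" unfolding X_def by (rule P_xi[OF b]) simp
  have XL: "X \<in> LL" unfolding X_def by (rule G1_calS) (use ij p_pow_gt1 in auto)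
  have XW: "fld j (mv (ex i 1, {})) \<in> WW" using LL_WW[OF XL] X by simp
  have D: "\<forall>a\<in>Y0 m. \<psi> (br (Dvec a) X) = 0"
  proof
    fix a assume a: "a \<in> Y0 m"
    have "br (Dvec a) X = (if a = i then Dvec j else 0)"
      unfolding X_def using br_Dvec_P[OF a b lam_one P_WW0[OF ij(2) lam_one]] by (simp add: Dvec_P ex_upd)
    then show "\<psi> (br (Dvec a) X) = 0" using n ij derW_0 by (auto simp: normd_def)
  qed
  define \<chi> :: "nat \<Rightarrow> nat \<Rightarrow> 'a" where "\<chi> a k = (if a = i then 1 else 0) - (if a = j then 1 else 0)" for a k
  have H: "\<forall>a\<in>Y0 m. \<forall>k\<in>Y1 m n. br (hh a k) X = scaleW (\<chi> a k) X"
    using hh_fld[OF _ _ XW] ij(2) Y0_Y1 by (auto simp: X \<chi>_def)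
  assume "\<psi> (P j (ex i 1) (xi {})) \<noteq> 0"
  then obtain s Z where "\<psi> X s Z \<noteq> 0" unfolding X_def[symmetric] by (auto simp: fun_eq_iff papply)
  then obtain \<alpha> u where nz: "\<psi> X s (\<alpha>, u) \<noteq> 0" by (cases Z) auto
  note v = normd_value[OF n XL D H nz]
  obtain l where l: "l \<in> Y0 m" "l \<noteq> i" "l \<noteq> j" using Y0_third by blast
  obtain k where k: "k \<in> Y1 m n" using Y1_third by blast
  define e :: 'a where "e = (if k \<in> u then 1 else 0) - (if k = s then 1 else 0)"
  have E: "e - (if i = s then 1 else 0) = 1" "e - (if j = s then 1 else 0) = - 1" "e - (if l = s then 1 else 0) = 0"
    using v(5)[OF ij(1) k] v(5)[OF ij(2) k] v(5)[OF l(1) k] ij l by (simp_all add: \<chi>_def e_def)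
  show False
    using E ij l one_nz by (auto split: if_splits simp: eq_neg_iff_add_eq_0 neg_eq_iff_add_eq_0)
qed

text \<open>The even weights are 1 at \<open>i\<close> and 0 at two further indices. For \<xi>_u D_s
  at most the index \<open>s\<close> is exceptional, and there the weight is smaller by 1 instead of
  larger; this is a contradiction because 1 and -1 are different.\<close>

lemma normd_EE:
  assumes n: "normd \<psi>" and ik: "i \<in> Y0 m" "k \<in> Y1 m n"
  shows "\<psi> (EE i k) = 0"
proof (rule ccontr)
  define X where "X = EE i k"
  have b: "bd (ex i 2)" "bd (ex i 1)" using bd_ex ik p_pow_gt1 by simp_all
  have XL: "X \<in> LL" unfolding X_def by (rule EE_calS[OF ik])
  have X: "X = fld i (mv (ex i 2, {})) + fld k (mv (ex i 1, {k}))"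
    using b ik by (simp add: X_def EE_def P_xi)
  have W: "fld i (mv (ex i 2, {})) \<in> WW" "fld k (mv (ex i 1, {k})) \<in> WW"
    using b ik by (auto intro!: fld_mv_WW simp: Y0_sub Y1_sub)
  have D: "\<forall>a\<in>Y0 m. \<psi> (br (Dvec a) X) = 0"
    using br_Dvec_EE[OF _ ik] n ik derW_0 by (auto simp: normd_def X_def)
  define \<chi> :: "nat \<Rightarrow> nat \<Rightarrow> 'a" where "\<chi> a q = (if a = i then 1 else 0)" for a q
  have H: "\<forall>a\<in>Y0 m. \<forall>q\<in>Y1 m n. br (hh a q) X = scaleW (\<chi> a q) X"
  proof (intro ballI)
    fix a q assume aq: "a \<in> Y0 m" "q \<in> Y1 m n"
    have "q \<noteq> i" "a \<noteq> k" using aq ik Y0_Y1 by auto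
    then show "br (hh a q) X = scaleW (\<chi> a q) X"
      using hh_fld[OF aq W(1)] hh_fld[OF aq W(2)] by (simp add: X br_add_right scaleW_add \<chi>_def)
  qed
  assume "\<psi> (EE i k) \<noteq> 0"
  then obtain s Z where "\<psi> X s Z \<noteq> 0" unfolding X_def[symmetric] by (auto simp: fun_eq_iff papply)
  then obtain \<alpha> u where nz: "\<psi> X s (\<alpha>, u) \<noteq> 0" by (cases Z) auto
  note v = normd_value[OF n XL D H nz]
  obtain j where j: "j \<in> Y0 m" "j \<noteq> i" using Y0_third by blast
  obtain l where l: "l \<in> Y0 m" "l \<noteq> i" "l \<noteq> j" using Y0_third by blast
  define e :: 'a where "e = (if k \<in> u then 1 else 0) - (if k = s then 1 else 0)"
  have E: "e - (if i = s then 1 else 0) = 1" "e - (if j = s then 1 else 0) = 0" "e - (if l = s then 1 else 0) = 0"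
    using v(5)[OF ik(1) ik(2)] v(5)[OF j(1) ik(2)] v(5)[OF l(1) ik(2)] j l by (simp_all add: \<chi>_def e_def)
  show False
    using E j l one_nz by (auto split: if_splits)
qed

lemma normd_odd:
  assumes n: "normd \<psi>" and kl: "k \<in> Y1 m n" "l \<in> Y1 m n" "k \<noteq> l"
  shows "\<exists>c. \<psi> (P l (\<lambda>_. 0) (xi {k})) = scaleW c (P l (\<lambda>_. 0) (xi {k}))"
proof -
  define X where "X = P l (\<lambda>_. 0) (xi {k})"
  have X: "X = fld l (mv (\<lambda>_. 0, {k}))" using kl by (simp add: X_def P_xi)
  have XL: "X \<in> LL" unfolding X_def by (rule G2_calS[OF kl])
  have XW: "fld l (mv (\<lambda>_. 0, {k})) \<in> WW" using LL_WW[OF XL] X by simp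
  have D: "\<forall>a\<in>Y0 m. \<psi> (br (Dvec a) X) = 0"
    unfolding X_def using br_Dvec_P[OF _ bd_zero lam_xi1[OF kl(1)] P_WW1[OF kl(2) lam_xi1[OF kl(1)]]] n derW_0
    by (simp add: normd_def)
  define \<chi> :: "nat \<Rightarrow> nat \<Rightarrow> 'a" where "\<chi> a q = (if q = k then 1 else 0) - (if q = l then 1 else 0)" for a q
  have H: "\<forall>a\<in>Y0 m. \<forall>q\<in>Y1 m n. br (hh a q) X = scaleW (\<chi> a q) X"
    using hh_fld[OF _ _ XW] kl(2) Y0_Y1 by (auto simp: X \<chi>_def)
  have "\<psi> X = scaleW (\<psi> X l (\<lambda>_. 0, {k})) (fld l (mv (\<lambda>_. 0, {k})))"
  proof (rule single_support)
    fix s \<alpha> u assume nz: "\<psi> X s (\<alpha>, u) \<noteq> 0"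
    note v = normd_value[OF n XL D H nz]
    have s: "s \<notin> Y0 m"
    proof
      assume s: "s \<in> Y0 m"
      obtain j where j: "j \<in> Y0 m" "j \<noteq> s" using Y0_third by blast
      show False using v(5)[OF s kl(1)] v(5)[OF j(1) kl(1)] j one_nz by (simp add: \<chi>_def)
    qed
    obtain i where i: "i \<in> Y0 m" using Y0_third by blast
    have iis: "i \<noteq> s" using i s by auto
    have e: "(if q \<in> u then 1 else 0) - (if q = s then 1 else 0) = (if q = k then 1 else 0) - (if q = l then 1 else (0::'a))"
      if "q \<in> Y1 m n" for q using v(5)[OF i that] iis by (simp add: \<chi>_def)
    have sl: "s = l" "l \<notin> u" using e[OF kl(2)] kl one_nz by (auto split: if_splits simp: eq_neg_iff_add_eq_0)
    have "q \<in> u \<longleftrightarrow> q = k" if "q \<in> Y1 m n" for q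
      using e[OF that] sl kl one_nz by (auto split: if_splits)
    then show "s = l \<and> \<alpha> = (\<lambda>_. 0) \<and> u = {k}" using sl v(2,3) kl by auto
  qed
  then show ?thesis using X unfolding X_def by metis
qed

lemma normd_pair:
  assumes n: "normd \<psi>" and kl: "k \<in> Y1 m n" "l \<in> Y1 m n" "k \<noteq> l" and i: "i \<in> Y0 m"
  shows "\<exists>c. \<psi> (P i (\<lambda>_. 0) (xi {k, l})) = scaleW c (P i (\<lambda>_. 0) (xi {k, l}))"
proof -
  define X where "X = P i (\<lambda>_. 0) (xi {k, l})"
  have X: "X = fld i (mv (\<lambda>_. 0, {k, l}))" using kl by (simp add: X_def P_xi)
  have XL: "X \<in> LL" unfolding X_def by (rule G3_calS[OF kl i])
  have XW: "fld i (mv (\<lambda>_. 0, {k, l})) \<in> WW" using LL_WW[OF XL] X by simp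
  have lx: "lam 0 (xi {k, l})" by (rule lam_xi) (use kl in auto)
  have D: "\<forall>a\<in>Y0 m. \<psi> (br (Dvec a) X) = 0"
    unfolding X_def using br_Dvec_P[OF _ bd_zero lx P_WW0[OF i lx]] n derW_0
    by (simp add: normd_def)
  define \<chi> :: "nat \<Rightarrow> nat \<Rightarrow> 'a" where "\<chi> a q = (if q \<in> {k, l} then 1 else 0) - (if a = i then 1 else 0)" for a q
  have H: "\<forall>a\<in>Y0 m. \<forall>q\<in>Y1 m n. br (hh a q) X = scaleW (\<chi> a q) X"
  proof (intro ballI)
    fix a q assume aq: "a \<in> Y0 m" "q \<in> Y1 m n"
    have "q \<noteq> i" using aq i Y0_Y1 by auto
    then show "br (hh a q) X = scaleW (\<chi> a q) X"
      using hh_fld[OF aq XW] by (simp add: X \<chi>_def)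
  qed
  have "\<psi> X = scaleW (\<psi> X i (\<lambda>_. 0, {k, l})) (fld i (mv (\<lambda>_. 0, {k, l})))"
  proof (rule single_support)
    fix s \<alpha> u assume nz: "\<psi> X s (\<alpha>, u) \<noteq> 0"
    note v = normd_value[OF n XL D H nz]
    have s: "s = i"
    proof (rule ccontr)
      assume si: "s \<noteq> i"
      obtain j where j: "j \<in> Y0 m" "j \<noteq> s" "j \<noteq> i" using Y0_third by blast
      show False using v(5)[OF i kl(1)] v(5)[OF j(1) kl(1)] j si one_nz by (simp add: \<chi>_def)
    qed
    have "q \<in> u \<longleftrightarrow> q \<in> {k, l}" if q: "q \<in> Y1 m n" for q
    proof -
      have "q \<noteq> s" using q i Y0_Y1 s by auto
      then show ?thesis using v(5)[OF i q] s one_nz by (auto simp: \<chi>_def split: if_splits)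
    qed
    then show "s = i \<and> \<alpha> = (\<lambda>_. 0) \<and> u = {k, l}" using s v(2,3) kl by auto
  qed
  then show ?thesis using X unfolding X_def by metis
qed

text \<open>The hypothesis \<open>low\<close> makes \<psi> vanish on [D_i, X]. Since p^r is 0 in the
  field, the weight of X is that of D_j, and weights leave exactly this one-dimensional
  freedom.\<close>

lemma normd_xpD:
  assumes n: "normd \<psi>" and ij: "i \<in> Y0 m" "j \<in> Y0 m" "i \<noteq> j" and r: "r \<ge> 1" "p ^ r < p ^ t i"
    and low: "\<psi> (P j (ex i (p ^ r - 1)) (xi {})) = 0"
  shows "\<exists>c. \<psi> (P j (ex i (p ^ r)) (xi {})) = scaleW c (Dvec j)"
proof -
  define X where "X = P j (ex i (p ^ r)) (xi {})"
  have b: "bd (ex i (p ^ r))" using bd_ex ij r by simp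
  have X: "X = fld j (mv (ex i (p ^ r), {}))" by (simp add: X_def P_xi b)
  have XL: "X \<in> LL" unfolding X_def by (rule G1_calS[OF ij r(2)])
  have XW: "fld j (mv (ex i (p ^ r), {})) \<in> WW" using LL_WW[OF XL] X by simp
  have D: "\<forall>a\<in>Y0 m. \<psi> (br (Dvec a) X) = 0"
  proof
    fix a assume a: "a \<in> Y0 m"
    have "br (Dvec a) X = (if a = i then P j (ex i (p ^ r - 1)) (xi {}) else 0)"
      unfolding X_def using br_Dvec_P[OF a b lam_one P_WW0[OF ij(2) lam_one]] p3
      by (cases "a = i") (simp_all add: ex_upd)
    then show "\<psi> (br (Dvec a) X) = 0" using n low derW_0 by (auto simp: normd_def)
  qed
  have p0: "of_nat (p ^ r) = (0::'a)" unfolding of_nat_0_iff using r(1) by (simp add: dvd_power)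
  define \<chi> :: "nat \<Rightarrow> nat \<Rightarrow> 'a" where "\<chi> a k = - (if a = j then 1 else 0)" for a k
  have H: "\<forall>a\<in>Y0 m. \<forall>k\<in>Y1 m n. br (hh a k) X = scaleW (\<chi> a k) X"
  proof (intro ballI)
    fix a q assume aq: "a \<in> Y0 m" "q \<in> Y1 m n"
    have "q \<noteq> j" using aq ij Y0_Y1 by auto
    moreover have "of_nat (ex i (p ^ r) a) = (0::'a)" using p0 by simp
    ultimately show "br (hh a q) X = scaleW (\<chi> a q) X"
      using hh_fld[OF aq XW] by (simp add: X \<chi>_def)
  qed
  have "\<psi> X = scaleW (\<psi> X j (\<lambda>_. 0, {})) (fld j (mv (\<lambda>_. 0, {})))"
  proof (rule single_support)
    fix s \<alpha> u assume nz: "\<psi> X s (\<alpha>, u) \<noteq> 0"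
    note v = normd_value[OF n XL D H nz]
    obtain k where k: "k \<in> Y1 m n" using Y1_third by blast
    have s: "s = j"
    proof (rule ccontr)
      assume sj: "s \<noteq> j"
      obtain a where a: "a \<in> Y0 m" "a \<noteq> s" "a \<noteq> j" using Y0_third by blast
      show False using v(5)[OF ij(2) k] v(5)[OF a(1) k] a sj one_nz by (simp add: \<chi>_def)
    qed
    have "q \<notin> u" if q: "q \<in> Y1 m n" for q
    proof -
      have "q \<noteq> s" using q ij Y0_Y1 s by auto
      then show ?thesis using v(5)[OF ij(2) q] s one_nz by (auto simp: \<chi>_def split: if_splits)
    qed
    then show "s = j \<and> \<alpha> = (\<lambda>_. 0) \<and> u = {}" using s v(2,3) by auto
  qed
  then have "\<psi> X = scaleW (\<psi> X j (\<lambda>_. 0, {})) (Dvec j)" by (simp add: Dvec_P P_xi)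
  then show ?thesis unfolding X_def by blast
qed

end

interpretation Dm: module "scaleD :: 'a::field \<Rightarrow> ('a wvec \<Rightarrow> 'a wvec) \<Rightarrow> ('a wvec \<Rightarrow> 'a wvec)"
  by standard (rule ext, rule ext, rule ext, simp add: scaleD_def scaleW_def papply algebra_simps)+

context special_lie
begin

definition normd2 :: "('a wvec \<Rightarrow> 'a wvec) \<Rightarrow> bool" where
  "normd2 \<psi> \<longleftrightarrow> normd \<psi> \<and>
    (\<forall>k\<in>Y1 m n. \<forall>l\<in>Y1 m n. k \<noteq> l \<longrightarrow> \<psi> (P l (\<lambda>_. 0) (xi {k})) = 0) \<and>
    (\<forall>k\<in>Y1 m n. \<forall>l\<in>Y1 m n. k \<noteq> l \<longrightarrow> (\<forall>i\<in>Y0 m. \<psi> (P i (\<lambda>_. 0) (xi {k, l})) = 0))"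

lemma P0_nz: "scaleW c (P s (\<lambda>_. 0) (xi u)) = 0 \<Longrightarrow> u \<subseteq> Y1 m n \<Longrightarrow> c = 0"
  using fld_nz[of c s "(\<lambda>_. 0, u)"] by (simp add: P_xi)

lemma P0_cancel: "scaleW c (P s (\<lambda>_. 0) (xi u)) = scaleW d (P s (\<lambda>_. 0) (xi u)) \<Longrightarrow> u \<subseteq> Y1 m n \<Longrightarrow> c = d"
  using P0_nz[of "c - d" s u] by (simp add: scaleW_left_diff)

lemma br_odd_odd:
  assumes "k \<in> Y1 m n" "l \<in> Y1 m n" "q \<in> Y1 m n" "k \<noteq> l"
  shows "br (P l (\<lambda>_. 0) (xi {k})) (P q (\<lambda>_. 0) (xi {l})) =
    P q (\<lambda>_. 0) (xi {k}) - (if q = k then P l (\<lambda>_. 0) (xi {l}) else 0)"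
  unfolding brP[OF Y1_sub[OF assms(2)] Y1_sub[OF assms(3)]]
  using assms D_xi[of q "{k}"] by (simp add: XO_zero xi_AA D_xi_single P_def fld_simps)

lemma br_odd_pair:
  assumes "k \<in> Y1 m n" "l \<in> Y1 m n" "q \<in> Y1 m n" "k \<noteq> l" "q \<noteq> k" "q \<noteq> l" "i \<in> Y0 m"
  shows "\<exists>e. e \<noteq> 0 \<and> br (P k (\<lambda>_. 0) (xi {q})) (P i (\<lambda>_. 0) (xi {k, l})) = scaleW e (P i (\<lambda>_. 0) (xi {q, l}))"
proof -
  have "{k, l} - {k} = {l}" using assms(4) by auto
  then have 1: "D k (xi {k, l}) = scaleA ((-1) ^ card {x \<in> {k, l}. x < k}) (xi {l})"
    using D_xi_in[OF assms(1), of "{k, l}"] assms by simp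
  have 2: "xi {q} \<odot> xi {l} = scaleA ((-1) ^ inversions {q} {l}) (xi {q, l})"
    using xi_pair assms by simp
  have 3: "D i (xi {q}) = 0" using lamD(2)[OF lam_xi1[OF assms(3)] assms(7)] .
  have "br (P k (\<lambda>_. 0) (xi {q})) (P i (\<lambda>_. 0) (xi {k, l})) =
      fld i (xi {q} \<odot> D k (xi {k, l})) - fld k (xi {k, l} \<odot> D i (xi {q}))"
    unfolding brP[OF Y1_sub[OF assms(1)] Y0_sub[OF assms(7)]] using assms by (simp add: XO_zero xi_AA)
  also have "\<dots> = scaleW ((-1) ^ card {x \<in> {k, l}. x < k} * (-1) ^ inversions {q} {l}) (P i (\<lambda>_. 0) (xi {q, l}))"
    unfolding 1 3 mul_scale_right 2 using assms by (simp add: P_def XO_zero xi_AA fld_simps)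
  finally show ?thesis by (intro exI[of _ "(-1) ^ card {x \<in> {k, l}. x < k} * (-1) ^ inversions {q} {l}"]) simp
qed

lemma br_TT_0:
  assumes "s \<in> Y0 m" "bd a"
  shows "br (TT b) (P s a (xi {})) = 0"
proof -
  have "fld s (mv (a, {})) \<in> WW" using assms by (intro fld_mv_WW) (auto simp: Y0_sub)
  then show ?thesis using br_TT[of s a "{}" b] Y0_Y1(1)[OF assms(1)] assms(2) by (simp add: P_xi)
qed

lemma br_TT_1:
  assumes "k \<in> Y1 m n" "l \<in> Y1 m n" "bd a"
  shows "br (TT b) (P l a (xi {k})) = scaleW (b k - b l) (P l a (xi {k}))"
proof -
  have "fld l (mv (a, {k})) \<in> WW" using assms by (intro fld_mv_WW) (auto simp: Y1_sub)
  then show ?thesis using br_TT[of l a "{k}" b] assms by (simp add: P_xi)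
qed

lemma br_TT_2:
  assumes "k \<in> Y1 m n" "l \<in> Y1 m n" "k \<noteq> l" "i \<in> Y0 m"
  shows "br (TT b) (P i (\<lambda>_. 0) (xi {k, l})) = scaleW (b k + b l) (P i (\<lambda>_. 0) (xi {k, l}))"
proof -
  have "fld i (mv (\<lambda>_. 0, {k, l})) \<in> WW" using assms by (intro fld_mv_WW) (auto simp: Y0_sub)
  then show ?thesis using br_TT[of i "\<lambda>_. 0" "{k, l}" b] assms Y0_Y1(1)[OF assms(4)] by (simp add: P_xi)
qed

lemma normd_TT: "normd (br (TT b))"
proof -
  have "br (TT b) (Dvec i) = 0" if "i \<in> Y0 m" for i using br_TT_0[OF that] by (simp add: Dvec_P)
  moreover have "br (TT b) (hh i k) = 0" if ik: "i \<in> Y0 m" "k \<in> Y1 m n" for i k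
  proof -
    have "bd (ex i 1)" using bd_ex ik p_pow_gt1 by simp
    then show ?thesis
      using br_TT_0[OF ik(1), of "ex i 1" b] br_TT_1[OF ik(2,2) bd_zero, of b]
      unfolding hh_def Gam_P0[OF ik(1)] Gam_P1[OF ik(2)] br_add_right by simp
  qed
  ultimately show ?thesis using derW_ad[OF TT_WW] by (simp add: normd_def)
qed

lemma normd_diff: "normd \<psi> \<Longrightarrow> normd \<phi> \<Longrightarrow> normd (\<lambda>X. \<psi> X - \<phi> X)"
  by (simp add: normd_def derW_diff)

text \<open>The scalars c_kl on \<xi>_k D_l add along chains and are antisymmetric, so c_kl = b_k -
  b_l with b unique up to a constant. The scalars on \<xi>_k \<xi>_l D_i do not depend on i, and
  after subtracting b_k + b_l they do not depend on the pair; half of the common value is the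
  missing constant.\<close>

lemma inner_on_odd:
  assumes n: "normd \<psi>"
  shows "\<exists>b. normd2 (\<lambda>X. \<psi> X - br (TT b) X)"
proof -
  have d: "derW \<psi>" using n by (simp add: normd_def)
  define c where "c k l = (SOME c. \<psi> (P l (\<lambda>_. 0) (xi {k})) = scaleW c (P l (\<lambda>_. 0) (xi {k})))" for k l
  have c: "\<psi> (P l (\<lambda>_. 0) (xi {k})) = scaleW (c k l) (P l (\<lambda>_. 0) (xi {k}))"
    if "k \<in> Y1 m n" "l \<in> Y1 m n" "k \<noteq> l" for k l
    unfolding c_def using normd_odd[OF n that] by (rule someI_ex)
  define d' where "d' u i = (SOME c. \<psi> (P i (\<lambda>_. 0) (xi u)) = scaleW c (P i (\<lambda>_. 0) (xi u)))" for u i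
  have d': "\<psi> (P i (\<lambda>_. 0) (xi {k, l})) = scaleW (d' {k, l} i) (P i (\<lambda>_. 0) (xi {k, l}))"
    if "k \<in> Y1 m n" "l \<in> Y1 m n" "k \<noteq> l" "i \<in> Y0 m" for k l i
    unfolding d'_def using normd_pair[OF n that] by (rule someI_ex)
  have cc: "c k q = c k l + c l q" if k: "k \<in> Y1 m n" and l: "l \<in> Y1 m n" and q: "q \<in> Y1 m n"
    and ne: "k \<noteq> l" "l \<noteq> q" "k \<noteq> q" for k l q
  proof -
    have B: "br (P l (\<lambda>_. 0) (xi {k})) (P q (\<lambda>_. 0) (xi {l})) = P q (\<lambda>_. 0) (xi {k})"
      using br_odd_odd[OF k l q ne(1)] ne by simp
    have "\<psi> (P q (\<lambda>_. 0) (xi {k})) = scaleW (c k l + c l q) (P q (\<lambda>_. 0) (xi {k}))"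
      using derWD(4)[OF d G2_calS[OF k l ne(1)] G2_calS[OF l q ne(2)]]
      unfolding B c[OF k l ne(1)] c[OF l q ne(2)] br_scale_left br_scale_right by (simp add: scaleW_left_add B)
    then show ?thesis unfolding c[OF k q ne(3)] using P0_cancel k by blast
  qed
  have cn: "c k l + c l k = 0" if k: "k \<in> Y1 m n" and l: "l \<in> Y1 m n" and ne: "k \<noteq> l" for k l
  proof -
    obtain i where i: "i \<in> Y0 m" using Y0_third by blast
    \<comment> \<open>The bracket of \<xi>_k D_l with \<xi>_l D_k is h_ik - h_il, where \<psi> is
      already 0; this gives the antisymmetry of the scalars.\<close>
    define H where "H = P k (\<lambda>_. 0) (xi {k}) - P l (\<lambda>_. 0) (xi {l})"
    have B: "br (P l (\<lambda>_. 0) (xi {k})) (P k (\<lambda>_. 0) (xi {l})) = H"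
      using br_odd_odd[OF k l k ne] by (simp add: H_def)
    have "H = hh i k - hh i l" by (simp add: H_def hh_def Gam_P1 k l)
    then have "H = hh i k + scaleW (-1) (hh i l)" by simp
    then have "\<psi> H = \<psi> (hh i k) + scaleW (-1) (\<psi> (hh i l))"
      using derWD(2)[OF d hh_calS[OF i k] LL_closed(4)[OF hh_calS[OF i l]]] derWD(3)[OF d hh_calS[OF i l]] by metis
    then have "\<psi> H = 0" using n i k l by (simp add: normd_def)
    moreover have "\<psi> H = scaleW (c k l + c l k) H"
      using derWD(4)[OF d G2_calS[OF k l ne] G2_calS[OF l k ne[symmetric]]]
      unfolding B c[OF k l ne] c[OF l k ne[symmetric]] br_scale_left br_scale_right by (simp add: scaleW_left_add B)
    ultimately have "scaleW (c k l + c l k) H k (\<lambda>_. 0, {k}) = 0" by (simp add: papply)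
    then show ?thesis using k l ne by (simp add: H_def P_xi scaleW_def papply fld_def monvec_def)
  qed
  have dq: "d' {q, l} i = c q k + d' {k, l} i" if k: "k \<in> Y1 m n" and l: "l \<in> Y1 m n" and q: "q \<in> Y1 m n"
    and ne: "k \<noteq> l" "q \<noteq> k" "q \<noteq> l" and i: "i \<in> Y0 m" for k l q i
  proof -
    obtain e where e: "e \<noteq> 0"
      "br (P k (\<lambda>_. 0) (xi {q})) (P i (\<lambda>_. 0) (xi {k, l})) = scaleW e (P i (\<lambda>_. 0) (xi {q, l}))"
      using br_odd_pair[OF k l q ne i] by blast
    have "scaleW e (\<psi> (P i (\<lambda>_. 0) (xi {q, l}))) = scaleW ((c q k + d' {k, l} i) * e) (P i (\<lambda>_. 0) (xi {q, l}))"
      using derWD(4)[OF d G2_calS[OF q k ne(2)] G3_calS[OF k l ne(1) i]]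
      unfolding c[OF q k ne(2)] d'[OF k l ne(1) i] br_scale_left br_scale_right e(2)
        derWD(3)[OF d G3_calS[OF q l ne(3) i]]
      by (simp add: scaleW_left_add distrib_right)
    then have "scaleW (e * d' {q, l} i) (P i (\<lambda>_. 0) (xi {q, l})) = scaleW ((c q k + d' {k, l} i) * e) (P i (\<lambda>_. 0) (xi {q, l}))"
      unfolding d'[OF q l ne(3) i] by simp
    then have "e * d' {q, l} i = (c q k + d' {k, l} i) * e" using P0_cancel q l by blast
    then show ?thesis using e(1) by (simp add: mult.commute)
  qed
  have di: "d' {k, l} j = d' {k, l} i" if k: "k \<in> Y1 m n" and l: "l \<in> Y1 m n" and ne: "k \<noteq> l"
    and ij: "i \<in> Y0 m" "j \<in> Y0 m" "i \<noteq> j" for k l i j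
  proof -
    have lx: "lam 0 (xi {k, l})" by (rule lam_xi) (use k l ne in auto)
    have XL: "P j (ex i 1) (xi {}) \<in> LL" by (rule G1_calS[OF ij]) (use ij p_pow_gt1 in simp)
    have "br (P i (\<lambda>_. 0) (xi {k, l})) (P j (ex i 1) (xi {})) =
      scaleW (of_nat ((\<lambda>_. 0) i + 0 choose (\<lambda>_. 0) i)) (P j (\<lambda>_. 0) (xi {k, l} \<odot> xi {}))"
      by (rule brA) (use ij lx lam_one bd_ex p_pow_gt1 in auto)
    then have B: "br (P i (\<lambda>_. 0) (xi {k, l})) (P j (ex i 1) (xi {})) = P j (\<lambda>_. 0) (xi {k, l})"
      using k l by (simp add: xi_AA)
    have "\<psi> (P j (\<lambda>_. 0) (xi {k, l})) = scaleW (d' {k, l} i) (P j (\<lambda>_. 0) (xi {k, l}))"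
      using derWD(4)[OF d G3_calS[OF k l ne ij(1)] XL] normd_xD[OF n ij]
      unfolding B d'[OF k l ne ij(1)] br_scale_left by simp
    then show ?thesis unfolding d'[OF k l ne ij(2)] using P0_cancel k l by blast
  qed
  obtain i0 where i0: "i0 \<in> Y0 m" using Y0_third by blast
  obtain k0 where k0: "k0 \<in> Y1 m n" using Y1_third by blast
  define b0 where "b0 k = (if k = k0 then 0 else c k k0)" for k
  have cb: "c k l = b0 k - b0 l" if "k \<in> Y1 m n" "l \<in> Y1 m n" "k \<noteq> l" for k l
    using cc[OF that(1) k0 that(2)] cn[of k0 l] cn[of l k0] k0 that
    by (auto simp: b0_def add_eq_0_iff)
  define g where "g k l = d' {k, l} i0 - b0 k - b0 l" for k l
  have g1: "g q l = g k l" if "k \<in> Y1 m n" "l \<in> Y1 m n" "q \<in> Y1 m n" "k \<noteq> l" "q \<noteq> l" for k l q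
  proof (cases "q = k")
    case False
    then show ?thesis using dq[OF that(1-4) False that(5) i0] cb[OF that(3,1) False] by (simp add: g_def)
  qed simp
  have g2: "g k l = g l k" for k l by (simp add: g_def insert_commute)
  obtain l0 where l0: "l0 \<in> Y1 m n" "l0 \<noteq> k0" using Y1_third by blast
  have g3: "g k l = g k0 l0" if kl: "k \<in> Y1 m n" "l \<in> Y1 m n" "k \<noteq> l" for k l
  proof -
    \<comment> \<open>An intermediate odd index connects {k, l} with {k0, l0} by replacing one
      member of the pair at a time.\<close>
    obtain x where x: "x \<in> Y1 m n" "x \<noteq> l" "x \<noteq> l0" using Y1_third by blast
    have "g k l = g x l" using g1[of x l k] x kl by simp
    also have "\<dots> = g l x" by (rule g2)
    also have "\<dots> = g l0 x" using g1[of l0 x l] x kl l0 by simp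
    also have "\<dots> = g x l0" by (rule g2)
    also have "\<dots> = g k0 l0" using g1[of k0 l0 x] x k0 l0 by simp
    finally show ?thesis .
  qed
  define b where "b k = b0 k + g k0 l0 / 2" for k
  have b1: "c k l = b k - b l" if "k \<in> Y1 m n" "l \<in> Y1 m n" "k \<noteq> l" for k l
    using cb[OF that] by (simp add: b_def)
  have b2: "d' {k, l} i = b k + b l" if kl: "k \<in> Y1 m n" "l \<in> Y1 m n" "k \<noteq> l" and i: "i \<in> Y0 m" for k l i
  proof -
    have "d' {k, l} i = d' {k, l} i0" using di[OF kl i0 i] by (cases "i = i0") auto
    also have "\<dots> = g k0 l0 + b0 k + b0 l" using g3[OF kl] by (simp add: g_def algebra_simps)
    also have "g k0 l0 = g k0 l0 / 2 + g k0 l0 / 2"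
      using two_nz by (metis add_divide_distrib mult_2 nonzero_mult_div_cancel_left)
    finally have "d' {k, l} i = g k0 l0 / 2 + g k0 l0 / 2 + b0 k + b0 l" .
    also have "\<dots> = b k + b l" by (simp add: b_def)
    finally show ?thesis .
  qed
  have "normd2 (\<lambda>X. \<psi> X - br (TT b) X)"
    unfolding normd2_def using normd_diff[OF n normd_TT]
    by (simp add: c d' br_TT_1 br_TT_2 b1 b2)
  then show ?thesis by blast
qed

lemma funpow_Dvec_P:
  assumes "i \<in> Y0 m" "bd a" "lam c \<omega>" "P s a \<omega> \<in> WW"
  shows "(br (Dvec i) ^^ N) (P s a \<omega>) = (if N \<le> a i then P s (a(i := a i - N)) \<omega> else 0)"
proof (induction N)
  case (Suc N)
  have "bd (a(i := a i - N))" using bd_upd[OF assms(2,1)] assms(1,2) by (auto simp: bd_iff)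
  moreover have "P s (a(i := a i - N)) \<omega> \<in> WW" if "N \<le> a i"
    using funpow_WW[OF Dvec_WW[OF assms(1)] assms(4), of N] Suc that by simp
  ultimately show ?case using Suc br_Dvec_P[OF assms(1) _ assms(3), of "a(i := a i - N)" s]
    by (cases "N \<le> a i") (auto simp add: Suc_le_eq fun_upd_same simp del: fun_upd_apply)
qed simp

lemma funpow_Dvec_0:
  assumes "i \<in> Y0 m" "k \<ge> 1"
  shows "j \<in> Y0 m \<Longrightarrow> (br (Dvec i) ^^ (p ^ k)) (Dvec j) = 0"
    "j \<in> Y0 m \<Longrightarrow> q \<in> Y1 m n \<Longrightarrow> (br (Dvec i) ^^ (p ^ k)) (hh j q) = 0"
    "l \<in> Y1 m n \<Longrightarrow> q \<in> Y1 m n \<Longrightarrow> (br (Dvec i) ^^ (p ^ k)) (P l (\<lambda>_. 0) (xi {q})) = 0"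
    "l \<in> Y1 m n \<Longrightarrow> q \<in> Y1 m n \<Longrightarrow> q \<noteq> l \<Longrightarrow> j \<in> Y0 m \<Longrightarrow> (br (Dvec i) ^^ (p ^ k)) (P j (\<lambda>_. 0) (xi {q, l})) = 0"
proof -
  have "p ^ 1 \<le> p ^ k" using assms(2) p3 by (intro power_increasing) auto
  then have N: "p ^ k > 1" using p3 by simp
  have one: "(br (Dvec i) ^^ (p ^ k)) (P s (\<lambda>_. 0) \<omega>) = 0" if "lam c \<omega>" "P s (\<lambda>_. 0) \<omega> \<in> WW" for c s \<omega>
    using funpow_Dvec_P[OF assms(1) bd_zero that] p3 by simp
  show "(br (Dvec i) ^^ (p ^ k)) (Dvec j) = 0" if "j \<in> Y0 m"
    unfolding Dvec_P[of j] by (rule one[OF lam_one P_WW0[OF that lam_one]])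
  show o: "(br (Dvec i) ^^ (p ^ k)) (P l (\<lambda>_. 0) (xi {q})) = 0" if "l \<in> Y1 m n" "q \<in> Y1 m n" for l q
    by (rule one[OF lam_xi1[OF that(2)] P_WW1[OF that(1) lam_xi1[OF that(2)]]])
  show "(br (Dvec i) ^^ (p ^ k)) (P j (\<lambda>_. 0) (xi {q, l})) = 0"
    if "l \<in> Y1 m n" "q \<in> Y1 m n" "q \<noteq> l" "j \<in> Y0 m"
  proof -
    have "lam 0 (xi {q, l})" by (rule lam_xi) (use that in auto)
    then show ?thesis using one P_WW0 that by blast
  qed
  show "(br (Dvec i) ^^ (p ^ k)) (hh j q) = 0" if j: "j \<in> Y0 m" and q: "q \<in> Y1 m n"
  proof -
    have b: "bd (ex j 1)" using bd_ex j p_pow_gt1 by simp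
    have "\<not> p ^ k \<le> ex j 1 i" using N by simp
    then have "(br (Dvec i) ^^ (p ^ k)) (P j (ex j 1) (xi {})) = 0"
      using funpow_Dvec_P[OF assms(1) b lam_one P_WW0[OF j lam_one]] by simp
    then show ?thesis unfolding hh_def Gam_P0[OF j] Gam_P1[OF q] funpow_linear using o[OF q q] by simp
  qed
qed

lemma normd2_Dpow: "i \<in> Y0 m \<Longrightarrow> k \<ge> 1 \<Longrightarrow> normd2 (br (Dvec i) ^^ (p ^ k))"
  unfolding normd2_def normd_def using derW_Dpow funpow_Dvec_0 by simp

lemma normd2_linear:
  "normd2 \<psi> \<Longrightarrow> normd2 \<phi> \<Longrightarrow> normd2 (\<lambda>X. \<psi> X - \<phi> X)" "normd2 \<psi> \<Longrightarrow> normd2 \<phi> \<Longrightarrow> normd2 (\<lambda>X. \<psi> X + \<phi> X)"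
  "normd2 \<psi> \<Longrightarrow> normd2 (\<lambda>X. scaleW c (\<psi> X))" "normd2 (\<lambda>_. 0)"
  by (simp_all add: normd2_def normd_def derW_diff derW_add derW_scale derW_zero)

lemma normd2_sum: "(\<And>i. i \<in> I \<Longrightarrow> normd2 (f i)) \<Longrightarrow> normd2 (\<lambda>X. \<Sum>i\<in>I. f i X)"
  by (induction I rule: infinite_finite_induct) (simp_all add: normd2_linear)

text \<open>The exponent starts at 1 because ad D_i itself is inner, and the coefficients are cut
  off at \<open>t i\<close> so that only powers from the spanning set of the theorem occur.\<close>

definition PP :: "(nat \<Rightarrow> nat \<Rightarrow> 'a) \<Rightarrow> nat \<Rightarrow> 'a wvec \<Rightarrow> 'a wvec" where
  "PP c R X = (\<Sum>k\<in>{1..<R}. \<Sum>i\<in>Y0 m. scaleW (if k < t i then c i k else 0) ((br (Dvec i) ^^ (p ^ k)) X))"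

lemma normd2_PP: "normd2 (PP c R)"
  unfolding PP_def by (intro normd2_sum normd2_linear(3) normd2_Dpow) auto

lemma kernel_gen:
  assumes "normd2 \<psi>" "R \<ge> 1"
    and "\<And>i j r. i \<in> Y0 m \<Longrightarrow> j \<in> Y0 m \<Longrightarrow> i \<noteq> j \<Longrightarrow> p ^ r < p ^ t i \<Longrightarrow> r < R \<Longrightarrow> \<psi> (P j (ex i (p ^ r)) (xi {})) = 0"
  shows "gen_subalg0 p m n t {X \<in> LL. \<psi> X = 0} R"
proof unfold_locales
  have n: "normd \<psi>" and d: "derW \<psi>" using assms(1) by (simp_all add: normd2_def normd_def)
  show "R \<ge> 1" by fact
  show "0 \<in> {X \<in> LL. \<psi> X = 0}" using LL_closed derW_0[OF d] by simp
  show "E + F \<in> {X \<in> LL. \<psi> X = 0}" if "E \<in> {X \<in> LL. \<psi> X = 0}" "F \<in> {X \<in> LL. \<psi> X = 0}" for E F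
    using that LL_closed derWD(2)[OF d] by simp
  show "scaleW c E \<in> {X \<in> LL. \<psi> X = 0}" if "E \<in> {X \<in> LL. \<psi> X = 0}" for c E
    using that LL_closed derWD(3)[OF d] by simp
  show "br E F \<in> {X \<in> LL. \<psi> X = 0}" if "E \<in> {X \<in> LL. \<psi> X = 0}" "F \<in> {X \<in> LL. \<psi> X = 0}" for E F
    using that LL_closed derWD(4)[OF d] by simp
  show "P i (\<lambda>_. 0) (xi {}) \<in> {X \<in> LL. \<psi> X = 0}" if "i \<in> Y0 m" for i
    using Dvec_calS[OF that] n that by (simp add: Dvec_P normd_def)
  show "P j (ex i (p ^ r)) (xi {}) \<in> {X \<in> LL. \<psi> X = 0}"
    if "i \<in> Y0 m" "j \<in> Y0 m" "i \<noteq> j" "p ^ r < p ^ t i" "r < R" for i j r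
    using assms(3)[OF that] G1_calS[OF that(1-4)] by simp
  show "P l (\<lambda>_. 0) (xi {k}) \<in> {X \<in> LL. \<psi> X = 0}" if "k \<in> Y1 m n" "l \<in> Y1 m n" "k \<noteq> l" for k l
    using G2_calS[OF that] assms(1) that by (simp add: normd2_def)
  show "P i (\<lambda>_. 0) (xi {k} \<odot> xi {l}) \<in> {X \<in> LL. \<psi> X = 0}" if "k \<in> Y1 m n" "l \<in> Y1 m n" "k \<noteq> l" "i \<in> Y0 m" for k l i
    using G3_calS[OF that] assms(1) that derWD(3)[OF d G3_calS[OF that]] LL_closed(4)
    by (simp add: xi_pair P_scale normd2_def)
  show "P i (ex i 2) (xi {}) + P k (ex i 1) (xi {k}) \<in> {X \<in> LL. \<psi> X = 0}" if "i \<in> Y0 m" "k \<in> Y1 m n" for i k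
    using EE_calS[OF that] normd_EE[OF n that] by (simp add: EE_def)
qed

text \<open>Once the generators with r <= R are in the kernel, so is x_i^(p^(R+1) - 1) D_j, and the
  next generator is sent to g_ij D_j. Bracketing with x_j D_l shows that g_ij is independent of j,
  hence one multiple of (ad D_i)^(p^(R+1)) corrects all j simultaneously. That power annihilates the
  generators with smaller r, so the earlier values remain 0.\<close>

lemma subtract_powers:
  assumes "normd2 \<psi>"
  shows "\<exists>c. \<forall>i j r. i \<in> Y0 m \<longrightarrow> j \<in> Y0 m \<longrightarrow> i \<noteq> j \<longrightarrow> p ^ r < p ^ t i \<longrightarrow> r < Suc R \<longrightarrow>
    \<psi> (P j (ex i (p ^ r)) (xi {})) - PP c (Suc R) (P j (ex i (p ^ r)) (xi {})) = 0"
proof (induction R)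
  case 0
  have "normd \<psi>" using assms by (simp add: normd2_def)
  show ?case
  proof (intro exI allI impI)
    fix i j r
    assume "i \<in> Y0 m" "j \<in> Y0 m" "i \<noteq> j" "p ^ r < p ^ t i" "r < Suc 0"
    then show "\<psi> (P j (ex i (p ^ r)) (xi {})) - PP (\<lambda>_ _. 0) (Suc 0) (P j (ex i (p ^ r)) (xi {})) = 0"
      using normd_xD[OF \<open>normd \<psi>\<close>, of i j] by (simp add: PP_def del: ex_apply)
  qed
next
  case (Suc R)
  then obtain c where c: "\<And>i j r. i \<in> Y0 m \<Longrightarrow> j \<in> Y0 m \<Longrightarrow> i \<noteq> j \<Longrightarrow> p ^ r < p ^ t i \<Longrightarrow> r < Suc R \<Longrightarrow>
      \<psi> (P j (ex i (p ^ r)) (xi {})) - PP c (Suc R) (P j (ex i (p ^ r)) (xi {})) = 0" by blast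
  define \<phi> where "\<phi> X = \<psi> X - PP c (Suc R) X" for X
  have n2: "normd2 \<phi>" unfolding \<phi>_def by (intro normd2_linear(1) assms normd2_PP)
  then have n: "normd \<phi>" and d: "derW \<phi>" by (simp_all add: normd2_def normd_def)
  interpret G: gen_subalg0 p m n t ty "{X \<in> LL. \<phi> X = 0}" "Suc R"
    by (rule kernel_gen[OF n2]) (use c in \<open>simp_all add: \<phi>_def\<close>)
  have ex: "\<exists>g. \<phi> (P j (ex i (p ^ Suc R)) (xi {})) = scaleW g (Dvec j)"
    if ij: "i \<in> Y0 m" "j \<in> Y0 m" "i \<noteq> j" and R: "p ^ Suc R < p ^ t i" for i j
  proof (rule normd_xpD[OF n ij _ R])
    have "p ^ Suc R > 0" using p_pos by simp
    then have "P j (ex i (p ^ Suc R - 1)) (xi {}) \<in> {X \<in> LL. \<phi> X = 0}"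
      by (intro G.xsD_bounded ij) (use R in simp_all)
    then show "\<phi> (P j (ex i (p ^ Suc R - 1)) (xi {})) = 0" by simp
  qed simp
  define g where "g i j = (SOME g. \<phi> (P j (ex i (p ^ Suc R)) (xi {})) = scaleW g (Dvec j))" for i j
  have g: "\<phi> (P j (ex i (p ^ Suc R)) (xi {})) = scaleW (g i j) (Dvec j)"
    if "i \<in> Y0 m" "j \<in> Y0 m" "i \<noteq> j" "p ^ Suc R < p ^ t i" for i j
    unfolding g_def using ex[OF that] by (rule someI_ex)
  have gg: "g i l = g i j" if ij: "i \<in> Y0 m" "j \<in> Y0 m" "i \<noteq> j" and l: "l \<in> Y0 m" "l \<noteq> i" "l \<noteq> j"
    and R: "p ^ Suc R < p ^ t i" for i j l
  proof -
    have b: "bd (ex i (p ^ Suc R))" "bd (ex j 1)" using bd_ex ij R p_pow_gt1 by simp_all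
    have B1: "br (P j (ex i (p ^ Suc R)) (xi {})) (P l (ex j 1) (xi {})) =
      scaleW (of_nat (ex i (p ^ Suc R) j + 0 choose ex i (p ^ Suc R) j)) (P l (ex i (p ^ Suc R)) (xi {} \<odot> xi {}))"
      by (rule brA) (use ij l b lam_one in auto)
    have B1': "br (P j (ex i (p ^ Suc R)) (xi {})) (P l (ex j 1) (xi {})) = P l (ex i (p ^ Suc R)) (xi {})"
      unfolding B1 using ij by (simp add: xi_AA)
    have B2: "br (P j (\<lambda>_. 0) (xi {})) (P l (ex j 1) (xi {})) =
      scaleW (of_nat ((\<lambda>_. 0) j + 0 choose (\<lambda>_. 0) j)) (P l (\<lambda>_. 0) (xi {} \<odot> xi {}))"
      by (rule brA) (use ij l b lam_one in auto)
    have X: "P l (ex j 1) (xi {}) \<in> LL" by (rule G1_calS) (use ij l p_pow_gt1 in auto)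
    have "\<phi> (P l (ex j 1) (xi {})) = 0" by (rule normd_xD[OF n]) (use ij l in auto)
    then have "\<phi> (P l (ex i (p ^ Suc R)) (xi {})) = br (scaleW (g i j) (Dvec j)) (P l (ex j 1) (xi {}))"
      using derWD(4)[OF d G1_calS[OF ij R] X] unfolding B1' g[OF ij R] by simp
    also have "\<dots> = scaleW (g i j) (Dvec l)"
      unfolding br_scale_left Dvec_P B2 by (simp add: xi_AA)
    finally have "scaleW (g i l) (Dvec l) = scaleW (g i j) (Dvec l)" using g[OF ij(1) l(1) _ R] l by simp
    then show ?thesis using P0_cancel[of "g i l" l "{}" "g i j"] by (simp add: Dvec_P)
  qed
  \<comment> \<open>By \<open>gg\<close> any even index other than \<open>i\<close> gives the same
    scalar; \<open>j0\<close> merely selects one.\<close>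
  define j0 where "j0 i = (SOME j. j \<in> Y0 m \<and> j \<noteq> i)" for i
  have j0: "j0 i \<in> Y0 m \<and> j0 i \<noteq> i" for i
    unfolding j0_def by (rule someI_ex) (use Y0_third[of i i] in auto)
  define c' where "c' i k = (if k = Suc R then g i (j0 i) else c i k)" for i k
  have PP': "PP c' (Suc (Suc R)) X = PP c (Suc R) X +
      (\<Sum>i\<in>Y0 m. scaleW (if Suc R < t i then g i (j0 i) else 0) ((br (Dvec i) ^^ (p ^ Suc R)) X))" for X
  proof -
    have "PP c' (Suc R) X = PP c (Suc R) X"
      unfolding PP_def by (intro sum.cong refl) (auto simp: c'_def)
    moreover have "PP c' (Suc (Suc R)) X = PP c' (Suc R) X +
      (\<Sum>i\<in>Y0 m. scaleW (if Suc R < t i then c' i (Suc R) else 0) ((br (Dvec i) ^^ (p ^ Suc R)) X))"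
      unfolding PP_def by (subst sum.atLeastLessThan_Suc) simp_all
    ultimately show ?thesis by (simp add: c'_def cong: if_cong)
  qed
  show ?case
  proof (intro exI[of _ c'] allI impI)
    fix i j r
    assume ij: "i \<in> Y0 m" "j \<in> Y0 m" "i \<noteq> j" and r: "p ^ r < p ^ t i" "r < Suc (Suc R)"
    define X where "X = P j (ex i (p ^ r)) (xi {})"
    have b: "bd (ex i (p ^ r))" using bd_ex ij r by simp
    have th: "(br (Dvec q) ^^ (p ^ Suc R)) X = (if q = i \<and> r = Suc R then Dvec j else 0)" if q: "q \<in> Y0 m" for q
    proof -
      have N: "p ^ Suc R > 0" using p_pos by simp
      have "p ^ Suc R \<le> p ^ r \<longleftrightarrow> r = Suc R"
        using r(2) p3 power_increasing_iff[of p "Suc R" r] by auto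
      then show ?thesis
        using funpow_Dvec_P[OF q b lam_one P_WW0[OF ij(2) lam_one], of "p ^ Suc R"] N p3
        by (auto simp: X_def Dvec_P ex_upd simp del: power_Suc)
    qed
    have S: "(\<Sum>q\<in>Y0 m. scaleW (if Suc R < t q then g q (j0 q) else 0) ((br (Dvec q) ^^ (p ^ Suc R)) X)) =
        (if r = Suc R then scaleW (g i (j0 i)) (Dvec j) else 0)"
    proof -
      have "Suc R < t i" if "r = Suc R" using r(1) that p3 by (simp add: power_strict_increasing_iff del: power_Suc)
      then have "(\<Sum>q\<in>Y0 m. scaleW (if Suc R < t q then g q (j0 q) else 0) ((br (Dvec q) ^^ (p ^ Suc R)) X)) =
        (\<Sum>q\<in>Y0 m. if q = i then (if r = Suc R then scaleW (g i (j0 i)) (Dvec j) else 0) else 0)"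
        by (intro sum.cong refl) (auto simp: th simp del: power_Suc)
      then show ?thesis using ij by simp
    qed
    have "\<phi> X = (if r = Suc R then scaleW (g i (j0 i)) (Dvec j) else 0)"
    proof (cases "r = Suc R")
      case True
      have "g i j = g i (j0 i)" using gg[of i "j0 i" j] j0[of i] ij r True by (cases "j = j0 i") auto
      then show ?thesis using g[OF ij] r True by (simp add: X_def)
    next
      case False
      then have "r < Suc R" using r by simp
      then show ?thesis using c[OF ij r(1)] False by (simp add: \<phi>_def X_def)
    qed
    then show "\<psi> X - PP c' (Suc (Suc R)) X = 0"
      unfolding PP' S by (simp add: \<phi>_def algebra_simps)
  qed
qed

theorem derW_structure:
  assumes "derW \<psi>"
  shows "\<exists>z\<in>WW. \<exists>c R. \<forall>X\<in>LL. \<psi> X = br z X + PP c R X"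
proof -
  obtain z1 where z1: "z1 \<in> WW" "\<forall>i\<in>Y0 m. \<psi> (Dvec i) = br z1 (Dvec i)"
    using inner_on_translations[OF assms] by blast
  define \<psi>1 where "\<psi>1 X = \<psi> X - br z1 X" for X
  have d1: "derW \<psi>1" unfolding \<psi>1_def by (intro derW_diff assms derW_ad z1)
  have D1: "\<forall>i\<in>Y0 m. \<psi>1 (Dvec i) = 0" using z1 by (simp add: \<psi>1_def)
  obtain z2 where z2: "z2 \<in> WW" "\<forall>i\<in>Y0 m. br z2 (Dvec i) = 0"
    "\<forall>i\<in>Y0 m. \<forall>k\<in>Y1 m n. \<psi>1 (hh i k) = br z2 (hh i k)"
    using inner_on_torus[OF d1 D1] by blast
  define \<psi>2 where "\<psi>2 X = \<psi>1 X - br z2 X" for X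
  have "derW \<psi>2" unfolding \<psi>2_def by (intro derW_diff d1 derW_ad z2)
  then have "normd \<psi>2" using z2 D1 by (simp add: normd_def \<psi>2_def)
  then obtain b where b: "normd2 (\<lambda>X. \<psi>2 X - br (TT b) X)" using inner_on_odd by blast
  define \<psi>3 where "\<psi>3 X = \<psi>2 X - br (TT b) X" for X
  have n3: "normd2 \<psi>3" unfolding \<psi>3_def by (rule b)
  \<comment> \<open>Any common bound for the t_i would do; beyond it there are no further
    generators.\<close>
  define R where "R = (\<Sum>i\<in>Y0 m. t i)"
  obtain c where c: "\<And>i j r. i \<in> Y0 m \<Longrightarrow> j \<in> Y0 m \<Longrightarrow> i \<noteq> j \<Longrightarrow> p ^ r < p ^ t i \<Longrightarrow> r < Suc R \<Longrightarrow>
    \<psi>3 (P j (ex i (p ^ r)) (xi {})) - PP c (Suc R) (P j (ex i (p ^ r)) (xi {})) = 0"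
    using subtract_powers[OF n3, of R] by blast
  define \<psi>4 where "\<psi>4 X = \<psi>3 X - PP c (Suc R) X" for X
  have n4: "normd2 \<psi>4" unfolding \<psi>4_def by (intro normd2_linear(1) n3 normd2_PP)
  have tR: "t i \<le> Suc R" if "i \<in> Y0 m" for i
    using member_le_sum[of i "Y0 m" t] that by (simp add: R_def le_SucI)
  have "gen_subalg0 p m n t {X \<in> LL. \<psi>4 X = 0} (Suc R)"
    by (rule kernel_gen[OF n4]) (use c in \<open>simp_all add: \<psi>4_def\<close>)
  then have "gen_subalg p m n t {X \<in> LL. \<psi>4 X = 0} (Suc R)"
    using tR by (simp add: gen_subalg_def gen_subalg_axioms_def)
  then have "LL \<subseteq> {X \<in> LL. \<psi>4 X = 0}" by (rule gen_subalg.calS_subset)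
  then have "\<psi> X = br (z1 + z2 + TT b) X + PP c (Suc R) X" if "X \<in> LL" for X
    using that by (auto simp: \<psi>4_def \<psi>3_def \<psi>2_def \<psi>1_def br_add_left algebra_simps)
  moreover have "z1 + z2 + TT b \<in> WW" using z1 z2 TT_WW by simp
  ultimately show ?thesis by blast
qed


section \<open>The normalizer and the main theorem\<close>

lemma divW_br_Dvec:
  assumes "i \<in> Y0 m" "z \<in> WW"
  shows "divW p m n t (br (Dvec i) z) = D i (divW p m n t z)"
proof -
  have "D r (D i (z r)) = D i (D r (z r))" if "r \<in> Y m n" for r
    using D_comm[OF that Y0_sub[OF assms(1)] WW_D(1)[OF assms(2)]] assms(1) by simp
  then show ?thesis
    by (simp add: divW_eq assms br_Dvec D_sum D_scale cong: sum.cong)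
qed

text \<open>The -1 in the weight of the r-th component at q = r compensates the shift caused by D_r.
  Consequently the torus acts on the divergence by the plain weight of the monomial.\<close>

lemma D_br_Gam:
  assumes "q \<in> Y m n" "r \<in> Y m n" "z \<in> WW"
  shows "D r (br (Gam m q) z r) X = of_nat (wt q X) * D r (z r) X"
  using assms(2)
proof (rule Y_cases)
  assume "r \<in> Y0 m"
  then show ?thesis by (auto simp: Dop_def br_Gam[OF assms(1,3)] wtv_def wt_def)
next
  assume r: "r \<in> Y1 m n"
  then show ?thesis using Y0_Y1(2)[OF r] by (auto simp: Dop_def br_Gam[OF assms(1,3)] wtv_def wt_def)
qed

lemma divW_br_hh:
  assumes "i \<in> Y0 m" "k \<in> Y1 m n" "z \<in> WW"
  shows "divW p m n t (br (hh i k) z) X = (of_nat (wt i X) + of_nat (wt k X)) * divW p m n t z X"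
proof -
  have "divW p m n t (br (hh i k) z) X = (\<Sum>r\<in>Y m n. (-1) ^ tau m r * D r (br (hh i k) z r) X)"
    by (simp add: divW_eq assms sum_fun_apply scaleA_apply)
  also have "\<dots> = (\<Sum>r\<in>Y m n. (of_nat (wt i X) + of_nat (wt k X)) * ((-1) ^ tau m r * D r (z r) X))"
  proof (rule sum.cong[OF refl])
    fix r assume r: "r \<in> Y m n"
    have "D r (br (hh i k) z r) X = of_nat (wt i X) * D r (z r) X + of_nat (wt k X) * D r (z r) X"
      using D_br_Gam[OF Y0_sub[OF assms(1)] r assms(3), of X] D_br_Gam[OF Y1_sub[OF assms(2)] r assms(3), of X]
      by (simp add: hh_def br_add_left wv_apply D_add plus_fun_apply)
    then show "(-1) ^ tau m r * D r (br (hh i k) z r) X =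
        (of_nat (wt i X) + of_nat (wt k X)) * ((-1) ^ tau m r * D r (z r) X)"
      by (simp add: algebra_simps)
  qed
  also have "\<dots> = (of_nat (wt i X) + of_nat (wt k X)) * divW p m n t z X"
    by (simp add: divW_eq assms sum_fun_apply scaleA_apply sum_distrib_left)
  finally show ?thesis .
qed

lemma divW_Gam:
  assumes "i \<in> Y0 m"
  shows "divW p m n t (Gam m i :: 'a wvec) = xi {}"
proof -
  have b: "bd (ex i 1)" using bd_ex assms p_pow_gt1 by simp
  have "D i (xgen m i) = xi {}"
    using D_XO0[OF b lam_one assms] assms by (simp add: xgen_XO ex_upd XO_zero xi_AA)
  then show ?thesis
    using divW_eq[OF Gam_WW[OF Y0_sub[OF assms]]] divW_fld[OF Y0_sub[OF assms], of "xgen m i"] assms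
    by (simp add: Gam_fld)
qed

text \<open>The divergence vanishes on S and carries ad D_i to D_i and ad h_ik to multiplication by
  the weight. Without even variables, a term \<xi>_u with k in u has h_ik-weight 1, so only a
  constant \<gamma> survives; it is the divergence of \<gamma> \<Gamma>_i for any even i.\<close>

lemma normalizer:
  assumes z: "z \<in> WW" and nz: "\<And>X. X \<in> LL \<Longrightarrow> br z X \<in> LL"
  shows "\<exists>E\<in>calSbar p m n t. \<exists>G\<in>calT m n. z = E + G"
proof -
  define g where "g = divW p m n t z"
  have div0: "divW p m n t (br X z) = 0" if "X \<in> LL" for X
  proof -
    have "br X z = scaleW (-1) (br z X)" using br_anti[of X z] by simp
    then have "br X z \<in> LL" using LL_closed(4)[OF nz[OF that]] by metis
    then show ?thesis using calS_sub_Sbar calSbar_iff by blast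
  qed
  have gA: "g \<in> AA" unfolding g_def divW_eq[OF z] by (intro AA_sum AA_closed)
  have Dg: "D i g = 0" if i: "i \<in> Y0 m" for i
    using div0[OF Dvec_calS[OF i]] divW_br_Dvec[OF i z] by (simp add: g_def)
  have sup: "\<alpha> = (\<lambda>_. 0) \<and> u = {}" if nz: "g (\<alpha>, u) \<noteq> 0" for \<alpha> u
  proof -
    have M: "(\<alpha>, u) \<in> MM" using gA nz unfolding AA_iff by blast
    have a: "\<alpha> = (\<lambda>_. 0)"
    proof (rule ccontr)
      assume "\<alpha> \<noteq> (\<lambda>_. 0)"
      then obtain i where i: "\<alpha> i \<noteq> 0" by auto
      then have iY: "i \<in> Y0 m" using M by (auto simp: MM_iff)
      have "D i g (\<alpha>(i := \<alpha> i - 1), u) = g (\<alpha>, u)"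
        using MM_lower[OF M, of i] iY i by (simp add: Dop_def)
      then show False using Dg[OF iY] nz by (simp add: papply)
    qed
    obtain i where i: "i \<in> Y0 m" using Y0_third by blast
    have "k \<notin> u" if k: "k \<in> Y1 m n" for k
    proof
      assume "k \<in> u"
      have "(of_nat (wt i (\<alpha>, u)) + of_nat (wt k (\<alpha>, u))) * g (\<alpha>, u) = 0"
        using divW_br_hh[OF i k z, of "(\<alpha>, u)"] div0[OF hh_calS[OF i k]] by (simp add: g_def papply)
      then show False using nz i k a \<open>k \<in> u\<close> Y0_Y1(2)[OF k] by (simp add: wt_def)
    qed
    then have "u = {}" using M by (auto simp: MM_iff)
    then show ?thesis using a by simp
  qed
  define \<gamma> where "\<gamma> = g (\<lambda>_. 0, {})"
  have g: "g = scaleA \<gamma> (xi {})"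
  proof
    fix X :: mon
    obtain \<alpha> u where X: "X = (\<alpha>, u)" by (cases X)
    show "g X = scaleA \<gamma> (xi {}) X"
      using sup[of \<alpha> u] by (cases "g X = 0") (auto simp: X \<gamma>_def xi_def scaleA_def monvec_def)
  qed
  obtain i where i: "i \<in> Y0 m" using Y0_third by blast
  define G where "G = scaleW \<gamma> (Gam m i :: 'a wvec)"
  have GW: "G \<in> WW" unfolding G_def using Gam_WW[OF Y0_sub[OF i]] by simp
  have GT: "G \<in> calT m n" unfolding G_def calT_def
    by (intro W.span_scale W.span_base) (use i Y0_sub in auto)
  have "divW p m n t (z - G) = 0"
  proof -
    have "z - G = z + scaleW (-1) G" by simp
    then have "divW p m n t (z - G) = divW p m n t z + scaleA (-1) (divW p m n t G)"
      using divW_add[OF z WW_closed(4)[OF GW]] divW_scale[OF GW] by metis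
    also have "divW p m n t G = scaleA \<gamma> (xi {})"
      unfolding G_def using divW_scale[OF Gam_WW[OF Y0_sub[OF i]]] divW_Gam[OF i] by simp
    finally show ?thesis using g by (simp add: g_def flip: scaleA_left_add)
  qed
  then have "z - G \<in> calSbar p m n t" using z GW by (simp add: calSbar_iff)
  moreover have "z = (z - G) + G" by simp
  ultimately show ?thesis using GT by blast
qed

section \<open>The direct decomposition\<close>

abbreviation NN :: "'a wvec set" where
  "NN \<equiv> {E + G | E G. E \<in> calSbar p m n t \<and> G \<in> calT m n}"

lemma NN_D:
  assumes "z \<in> NN"
  shows "z \<in> WW" "X \<in> LL \<Longrightarrow> br z X \<in> LL"
proof -
  obtain E G where z: "z = E + G" "E \<in> calSbar p m n t" "G \<in> calT m n" using assms by blast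
  then show "z \<in> WW" using calT_WW calSbar_iff by auto
  show "br z X \<in> LL" if "X \<in> LL"
    using z that calS_sub_Sbar br_Sbar[of E X] br_calT[of G X] LL_closed(2) by (auto simp: br_add_left)
qed

lemma adS_eq: "z \<in> WW \<Longrightarrow> adS p m n t z = (\<lambda>X. if X \<in> LL then br z X else 0)"
  by (rule ext) (simp add: adS_def Wbr_eq LL_WW)

lemma adDpow_eq:
  assumes "i \<in> Y0 m"
  shows "adDpow p m n t i k = (\<lambda>X. if X \<in> LL then (br (Dvec i) ^^ (p ^ k)) X else 0)"
proof
  fix X :: "'a wvec"
  have "(Wbr p m n t (Dvec i) ^^ N) X = (br (Dvec i) ^^ N) X" if "X \<in> LL" for N
    by (induction N) (use that assms funpow_WW LL_WW in \<open>simp_all add: Wbr_eq\<close>)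
  then show "adDpow p m n t i k X = (if X \<in> LL then (br (Dvec i) ^^ (p ^ k)) X else 0)"
    by (simp add: adDpow_def)
qed

lemma Der_iff:
  "\<phi> \<in> Der p m n t \<longleftrightarrow> (\<forall>X. X \<notin> LL \<longrightarrow> \<phi> X = 0) \<and> (\<forall>X\<in>LL. \<phi> X \<in> LL) \<and> derW \<phi>"
proof -
  have "\<phi> (Wbr p m n t X Z) = Wbr p m n t (\<phi> X) Z + Wbr p m n t X (\<phi> Z) \<longleftrightarrow>
      \<phi> (br X Z) = br (\<phi> X) Z + br X (\<phi> Z)" if "X \<in> LL" "Z \<in> LL" "\<forall>X\<in>LL. \<phi> X \<in> LL" for X Z
    using that LL_WW by (simp add: Wbr_eq)
  then show ?thesis unfolding Der_def derW_def using LL_WW by auto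
qed

lemma derW_restrict: "derW \<psi> \<Longrightarrow> derW (\<lambda>X. if X \<in> LL then \<psi> X else 0)"
  unfolding derW_def using LL_closed by simp

lemma Der_subspace: "Dm.subspace (Der p m n t :: ('a wvec \<Rightarrow> 'a wvec) set)"
proof (rule Dm.subspaceI)
  show "0 \<in> (Der p m n t :: ('a wvec \<Rightarrow> 'a wvec) set)"
    unfolding Der_iff using LL_closed by (simp add: derW_def papply)
  fix \<phi> \<psi> :: "'a wvec \<Rightarrow> 'a wvec" and c :: 'a
  assume a: "\<phi> \<in> Der p m n t"
  show "\<phi> + \<psi> \<in> Der p m n t" if "\<psi> \<in> Der p m n t"
  proof -
    have "derW (\<lambda>X. \<phi> X + \<psi> X)" using a that derW_add unfolding Der_iff by blast
    then show ?thesis using a that LL_closed unfolding Der_iff plus_fun_def[of \<phi> \<psi>] by simp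
  qed
  have "derW (\<lambda>X. scaleW c (\<phi> X))" using a derW_scale unfolding Der_iff by blast
  then show "scaleD c \<phi> \<in> Der p m n t" using a LL_closed unfolding Der_iff scaleD_def by simp
qed

abbreviation BB :: "('a wvec \<Rightarrow> 'a wvec) set" where
  "BB \<equiv> module.span scaleD {adDpow p m n t i k | i k. i \<in> Y0 m \<and> 1 \<le> k \<and> k < t i}"

lemma adDpow_Der: "i \<in> Y0 m \<Longrightarrow> adDpow p m n t i k \<in> (Der p m n t :: ('a wvec \<Rightarrow> 'a wvec) set)"
  unfolding Der_iff adDpow_eq
  using derW_restrict[OF derW_Dpow] funpow_LL[OF Dvec_calS] by simp

lemma BB_Der: "BB \<subseteq> Der p m n t"
  by (rule Dm.span_minimal[OF _ Der_subspace]) (use adDpow_Der in auto)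

lemma adS_Der:
  assumes "z \<in> NN"
  shows "adS p m n t z \<in> Der p m n t"
  unfolding adS_eq[OF NN_D(1)[OF assms]] Der_iff
  using derW_restrict[OF derW_ad[OF NN_D(1)[OF assms]]] NN_D(2)[OF assms] by simp

text \<open>Evaluation at X is linear, so it suffices to test the spanning powers. Elements killed
  by all of them detect only the inner part of a derivation.\<close>

lemma BB_kills:
  assumes "\<beta> \<in> BB" and X: "\<And>i k. i \<in> Y0 m \<Longrightarrow> 1 \<le> k \<Longrightarrow> (br (Dvec i) ^^ (p ^ k)) X = 0"
  shows "\<beta> X = 0"
proof -
  have "Dm.subspace {\<beta>. \<beta> X = 0}"
    by (rule Dm.subspaceI) (simp_all add: papply scaleD_def)
  moreover have "adDpow p m n t i k X = 0" if "i \<in> Y0 m" "1 \<le> k" for i k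
    using X[OF that] by (simp add: adDpow_eq[OF that(1)])
  ultimately have "BB \<subseteq> {\<beta>. \<beta> X = 0}"
    by (intro Dm.span_minimal) auto
  then show ?thesis using assms(1) by blast
qed

lemma PP_BB: "(\<lambda>X. if X \<in> LL then PP c R X else 0) \<in> BB"
proof -
  have "(\<lambda>X. if X \<in> LL then PP c R X else 0) =
      (\<Sum>k\<in>{1..<R}. \<Sum>i\<in>Y0 m. scaleD (if k < t i then c i k else 0) (adDpow p m n t i k))"
  proof
    fix X :: "'a wvec"
    have "(\<Sum>k\<in>{1..<R}. \<Sum>i\<in>Y0 m. scaleD (if k < t i then c i k else 0) (adDpow p m n t i k)) X =
      (\<Sum>k\<in>{1..<R}. \<Sum>i\<in>Y0 m. scaleD (if k < t i then c i k else 0) (adDpow p m n t i k) X)"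
      by (simp only: sum_fun_apply[where x=X])
    also have "\<dots> = (\<Sum>k\<in>{1..<R}. \<Sum>i\<in>Y0 m. if X \<in> LL then scaleW (if k < t i then c i k else 0) ((br (Dvec i) ^^ (p ^ k)) X) else 0)"
      by (intro sum.cong refl) (simp add: scaleD_def adDpow_eq)
    finally show "(if X \<in> LL then PP c R X else 0) =
      (\<Sum>k\<in>{1..<R}. \<Sum>i\<in>Y0 m. scaleD (if k < t i then c i k else 0) (adDpow p m n t i k)) X"
      by (simp add: PP_def)
  qed
  also have "\<dots> \<in> BB"
  proof (intro Dm.span_sum)
    fix k i assume ki: "k \<in> {1..<R}" "i \<in> Y0 m"
    show "scaleD (if k < t i then c i k else 0) (adDpow p m n t i k) \<in> BB"
    proof (cases "k < t i")
      case True
      then have "adDpow p m n t i k \<in> BB" using ki by (intro Dm.span_base) auto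
      then show ?thesis by (rule Dm.span_scale)
    qed (simp add: Dm.span_zero)
  qed
  finally show ?thesis .
qed

theorem Der_decomposition:
  "Der p m n t = {\<phi> + \<psi> | \<phi> \<psi>. \<phi> \<in> adS p m n t ` NN \<and> \<psi> \<in> BB} \<and> adS p m n t ` NN \<inter> BB = {0}"
proof (intro conjI equalityI subsetI)
  fix \<phi> :: "'a wvec \<Rightarrow> 'a wvec" assume "\<phi> \<in> Der p m n t"
  then have \<phi>: "\<And>X. X \<notin> LL \<Longrightarrow> \<phi> X = 0" "\<And>X. X \<in> LL \<Longrightarrow> \<phi> X \<in> LL" "derW \<phi>"
    unfolding Der_iff by blast+
  obtain z c R where z: "z \<in> WW" "\<forall>X\<in>LL. \<phi> X = br z X + PP c R X"
    using derW_structure[OF \<phi>(3)] by blast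
  define \<beta> where "\<beta> = (\<lambda>X. if X \<in> LL then PP c R X else 0)"
  have \<beta>: "\<beta> \<in> BB" unfolding \<beta>_def by (rule PP_BB)
  then have "\<beta> \<in> Der p m n t" using BB_Der by blast
  then have "PP c R X \<in> LL" if "X \<in> LL" for X using that unfolding Der_iff by (auto simp: \<beta>_def)
  \<comment> \<open>The given derivation and its outer part both preserve S, hence so does ad z.
    Only here does \<open>z\<close>, constructed merely in \<open>WW\<close>, turn out to normalize
    S.\<close>
  then have "br z X \<in> LL" if "X \<in> LL" for X
    using LL_closed(3)[OF \<phi>(2)[OF that], of "PP c R X"] z(2) that by simp
  then have N: "z \<in> NN" using normalizer[OF z(1)] by blast
  have "\<phi> = adS p m n t z + \<beta>"
  proof
    fix X
    have "\<phi> X = adS p m n t z X + \<beta> X"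
      unfolding adS_eq[OF z(1)] \<beta>_def using \<phi>(1) z(2) by simp
    then show "\<phi> X = (adS p m n t z + \<beta>) X" by (simp only: plus_fun_apply)
  qed
  then show "\<phi> \<in> {\<phi> + \<psi> | \<phi> \<psi>. \<phi> \<in> adS p m n t ` NN \<and> \<psi> \<in> BB}" using N \<beta> by blast
next
  fix \<phi> :: "'a wvec \<Rightarrow> 'a wvec"
  assume "\<phi> \<in> {\<phi> + \<psi> | \<phi> \<psi>. \<phi> \<in> adS p m n t ` NN \<and> \<psi> \<in> BB}"
  then obtain z \<psi> where "\<phi> = adS p m n t z + \<psi>" "z \<in> NN" "\<psi> \<in> BB" by blast
  then show "\<phi> \<in> Der p m n t"
    using Dm.subspace_add[OF Der_subspace adS_Der] BB_Der by blast
next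
  fix \<phi> :: "'a wvec \<Rightarrow> 'a wvec"
  assume "\<phi> \<in> adS p m n t ` NN \<inter> BB"
  then obtain z where z: "z \<in> NN" "\<phi> = adS p m n t z" and B: "\<phi> \<in> BB" by blast
  have zW: "z \<in> WW" by (rule NN_D(1)[OF z(1)])
  have \<phi>: "\<phi> X = br z X" if "X \<in> LL" for X using that by (simp add: z(2) adS_eq[OF zW])
  \<comment> \<open>A derivation in the intersection is 0 on all test elements of
    \<open>centralizer\<close>, because every element of \<open>BB\<close> is.\<close>
  have "z = 0"
  proof (rule centralizer[OF zW])
    show "br z (Dvec i) = 0" if "i \<in> Y0 m" for i
      using BB_kills[OF B funpow_Dvec_0(1)] \<phi>[OF Dvec_calS] that by simp
    show "br z (hh i k) = 0" if "i \<in> Y0 m" "k \<in> Y1 m n" for i k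
      using BB_kills[OF B funpow_Dvec_0(2)] \<phi>[OF hh_calS] that by simp
    show "br z (P l (\<lambda>_. 0) (xi {k})) = 0" if "k \<in> Y1 m n" "l \<in> Y1 m n" "k \<noteq> l" for k l
      using BB_kills[OF B funpow_Dvec_0(3)] \<phi>[OF G2_calS] that by simp
    show "br z (P i (\<lambda>_. 0) (xi {k, l})) = 0" if "k \<in> Y1 m n" "l \<in> Y1 m n" "k \<noteq> l" "i \<in> Y0 m" for k l i
      using BB_kills[OF B funpow_Dvec_0(4)] \<phi>[OF G3_calS] that by simp
  qed
  moreover have "adS p m n t (0 :: 'a wvec) = 0"
    unfolding adS_eq[OF WW_closed(1)] by (rule ext) (simp add: zero_fun_apply)
  ultimately show "\<phi> \<in> {0}" using z(2) by simp
next
  have "0 + 0 \<in> NN"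
    using W.span_zero by (intro CollectI exI[of _ 0] conjI refl) (simp_all add: calSbar_iff divW_0 calT_def)
  then have "0 \<in> NN" by simp
  then have "adS p m n t (0 :: 'a wvec) \<in> adS p m n t ` NN" by (rule imageI)
  moreover have "adS p m n t (0 :: 'a wvec) = 0"
    unfolding adS_eq[OF WW_closed(1)] by (rule ext) (simp add: zero_fun_apply)
  ultimately have "0 \<in> adS p m n t ` NN" by (simp only:)
  moreover have "0 \<in> BB" by (rule Dm.span_zero)
  ultimately show "\<phi> \<in> adS p m n t ` NN \<inter> BB" if "\<phi> \<in> {0}" for \<phi>
    using that by (simp only: singleton_iff Int_iff simp_thms)
qed

end

theorem theorem4p3p7:
  fixes p m n :: nat and t :: "nat \<Rightarrow> nat"
  assumes "CHAR('a::field) = p" and "p > 3" and "m \<ge> 3" and "n \<ge> 3"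
    and "\<forall>i\<in>Y0 m. t i \<ge> 1"
  defines "A \<equiv> adS p m n t ` {E + G | E G. E \<in> (calSbar p m n t :: 'a wvec set) \<and> G \<in> calT m n}"
    and "B \<equiv> module.span scaleD {adDpow p m n t i k | i k. i \<in> Y0 m \<and> 1 \<le> k \<and> k < t i}"
  shows "Der p m n t = {\<phi> + \<psi> | \<phi> \<psi>. \<phi> \<in> A \<and> \<psi> \<in> B} \<and> A \<inter> B = {0}"
proof -
  interpret special_lie p m n t "TYPE('a)"
    using assms(1-5) by unfold_locales auto
  show ?thesis unfolding A_def B_def by (rule Der_decomposition)
qed

end
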